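(* Let $\gamma\in(0,1)$, $\sigma\in(0,\infty)$, and let $l:[0,\infty)\to\mathbb{R}$ be measurable with $l(0)=1$. Let $X=(X_t)_{t\ge 0}$ be a centered Gaussian process with sample paths in $D[0,\infty)$, with $X_0\equiv 0$, and with covariance function $$\operatorname{E}X_sX_t=\sigma^2(s\wedge t)^{2\gamma}\,l\!\left(\frac{|s-t|}{s\wedge t}\right),\qquad s\wedge t>0 .$$ Fix $A>0$. Assume that for every $t\in(0,\infty)$ there exist a random process $Y^t=(Y^t_\tau)_{\tau\ge0}$ and a function $a_t:(0,A)\to(0,\infty)$ such that: (y1) $Y^t_1$ is non-degenerate; (y2) $Y^t$ is a random element of $D[0,\infty)$; (a1) $a_t(u)\to0^+$ as $u\to0^+$; (a2) $\left(\dfrac{X_t-X_{t+\tau u}}{a_t(u)}\right)_{\tau\ge0}$ converges weakly in $D[0,\infty)$ to $Y^t$ as $u\to0^+$. Then there exist $\kappa\in(0,1]$ and $L:(0,\infty)\to[0,\infty)$ such that: (i) $L$ is slowly varying at zero; (ii) for every $t\in(0,\infty)$, $a_t(u)\sim c_t\,u^{\kappa}L(u)$ as $u\to0^+$, with $c_t=\sigma t^{\gamma-\kappa}\sqrt{\dfrac{\operatorname{Var}Y^1_1}{\operatorname{Var}Y^t_1}}$; (iii) $l(u)=\frac12\bigl(1+(1+u)^{2\gamma}-(u^{\kappa}L(u))^2\bigr)$ for all $u>0$; (iv) for every $t\in(0,\infty)$, $Y^t$ is (in distribution) a constant multiple of $B^{\kappa}$, and it is the unique, up to a constant multiplier, small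 scale limit of $X$ at $t$.
   Context: $D[0,\infty)$ is the space of real-valued functions on $[0,\infty)$ that are right-continuous and have left limits, with the Skorohod metric (Skorohod topology on $[0,\infty)$) and its Borel $\sigma$-field. Weak convergence in $D[0,\infty)$ means convergence of expectations of bounded continuous functionals on $D[0,\infty)$. The superscript in $Y^t_\tau$ is the point $t$ at which the limit is taken, and the subscript is the time argument; so $Y^1_1$ is the value at time $1$ of the limit process at the point $1$. For $H\in(0,1)$, $B^H=(B^H_t)_{t\ge0}$ is the (continuous) fractional Brownian motion, i.e. the centered Gaussian process with covariance $\frac12(s^{2H}+t^{2H}-|t-s|^{2H})$. For $H=1$, $B^1_t=tZ$, $t\ge0$, with $Z\sim\mathcal N(0,1)$. $f\sim g$ as $u\to0^+$ means $f(u)=g(u)(1+o(1))$. A measurable function $L:(0,\infty)\to[0,\infty)$ is slowly varying at zero if it is positive on some interval $(0,\delta)$ and $L(\lambda u)/L(u)\to1$ as $u\to0^+$ for every fixed $\lambda>0$. A process $Y=(Y_\tau)_{\tau\ge0}$ is a small scale limit of $X$ at $t$ if there is a normalization $a$, positive for small $u>0$, with $a(u)\to0^+$ as $u\to0^+$, such that the finite-dimensional distributions of $\bigl((X_t-X_{t+\tau u})/a(u)\bigr)_{\tau\ge0}$ converge to those of $Y$ as $u\to0^+$. Uniqueness up to a constant multiplier means that every small scale limit at $t$ has the same finite-dimensional distributions as some constant multiple of $Y^t$.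
   Formalization: Clause (ii) is proved as √(Var Y^1_1)·a_t(u) ~ c_t u^κ L(u) with the stated c_t, i.e. a_t(u) ~ σ t^{γ−κ} u^κ L(u)/√(Var Y^t_1); as printed, (ii) contradicts (iii) unless Var Y^1_1 = 1. *)

theory Defs
  imports "HOL-Probability.Probability" "HOL-Library.Landau_Symbols"
begin

section \<open>The Skorohod space on the half-line\<close>

text \<open>Functions on $[0,\infty)$ are extensional functions on the set \<^term>\<open>{0::real..}\<close>,
  so that two elements of the space are equal iff they agree on $[0,\infty)$.\<close>

definition cadlag :: "(real \<Rightarrow> real) set" where
  "cadlag = {x \<in> extensional {0..}.
     (\<forall>t\<ge>0. (x \<longlongrightarrow> x t) (at_right t)) \<and> (\<forall>t>0. \<exists>l. (x \<longlongrightarrow> l) (at_left t))}"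

text \<open>The Skorohod metric in the form of Ethier and Kurtz (Markov Processes, Section 3.5):
  $d(x,y) = \inf_\lambda \max(\gamma(\lambda), \int_0^\infty e^{-u} d(x,y,\lambda,u)\,du)$, where
  $\gamma(\lambda) = \sup_{0 \le s < t} |\log\frac{\lambda(t)-\lambda(s)}{t-s}|$,
  $d(x,y,\lambda,u) = \sup_{t\ge0} \min(1, |x(t\wedge u) - y(\lambda(t)\wedge u)|)$, and $\lambda$
  ranges over the increasing bijections of $[0,\infty)$ with $\gamma(\lambda) < \infty$.\<close>

definition log_slopes :: "(real \<Rightarrow> real) \<Rightarrow> real set" where
  "log_slopes \<phi> = {\<bar>ln ((\<phi> t - \<phi> s) / (t - s))\<bar> |s t. 0 \<le> s \<and> s < t}"

definition time_changes :: "(real \<Rightarrow> real) set" where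
  "time_changes = {\<phi>. strict_mono_on {0..} \<phi> \<and> \<phi> ` {0..} = {0..} \<and> bdd_above (log_slopes \<phi>)}"

definition skorohod_dev ::
  "(real \<Rightarrow> real) \<Rightarrow> (real \<Rightarrow> real) \<Rightarrow> (real \<Rightarrow> real) \<Rightarrow> real \<Rightarrow> real" where
  "skorohod_dev x y \<phi> u = (SUP t\<in>{0..}. min 1 \<bar>x (min t u) - y (min (\<phi> t) u)\<bar>)"

definition skorohod_cost ::
  "(real \<Rightarrow> real) \<Rightarrow> (real \<Rightarrow> real) \<Rightarrow> (real \<Rightarrow> real) \<Rightarrow> real" where
  "skorohod_cost x y \<phi> =
     max (Sup (log_slopes \<phi>)) (LINT u:{0..}|lborel. exp (- u) * skorohod_dev x y \<phi> u)"

definition skorohod_dist :: "(real \<Rightarrow> real) \<Rightarrow> (real \<Rightarrow> real) \<Rightarrow> real" where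
  "skorohod_dist x y = (INF \<phi>\<in>time_changes. skorohod_cost x y \<phi>)"

definition skorohod_topology :: "(real \<Rightarrow> real) topology" where
  "skorohod_topology = Metric_space.mtopology cadlag skorohod_dist"

definition skorohod_borel :: "(real \<Rightarrow> real) measure" where
  "skorohod_borel = sigma cadlag {U. openin skorohod_topology U}"

subsection \<open>The Skorohod metric is a metric\<close>

subsubsection \<open>Time changes\<close>

lemma log_slopes_nonempty: "log_slopes \<phi> \<noteq> {}"
proof -
  have "\<bar>ln ((\<phi> 1 - \<phi> 0) / (1 - 0))\<bar> \<in> log_slopes \<phi>"
    unfolding log_slopes_def by (intro CollectI exI[of _ 0] exI[of _ 1]) simp
  then show ?thesis by blast
qed

lemma log_slope_le:
  assumes "\<phi> \<in> time_changes" "0 \<le> s" "s < t"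
  shows "\<bar>ln ((\<phi> t - \<phi> s) / (t - s))\<bar> \<le> Sup (log_slopes \<phi>)"
proof (rule cSup_upper)
  show "\<bar>ln ((\<phi> t - \<phi> s) / (t - s))\<bar> \<in> log_slopes \<phi>"
    unfolding log_slopes_def using assms(2,3) by blast
  show "bdd_above (log_slopes \<phi>)" using assms(1) by (simp add: time_changes_def)
qed

lemma Sup_log_slopes_nonneg:
  assumes "\<phi> \<in> time_changes" shows "0 \<le> Sup (log_slopes \<phi>)"
  by (rule order_trans[OF abs_ge_zero log_slope_le[OF assms order_refl zero_less_one]])

lemma Sup_log_slopes_le:
  assumes "\<And>s t. 0 \<le> s \<Longrightarrow> s < t \<Longrightarrow> \<bar>ln ((\<phi> t - \<phi> s) / (t - s))\<bar> \<le> c"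
  shows "Sup (log_slopes \<phi>) \<le> c" "bdd_above (log_slopes \<phi>)"
proof -
  have *: "z \<le> c" if "z \<in> log_slopes \<phi>" for z
    using that assms unfolding log_slopes_def by blast
  show "Sup (log_slopes \<phi>) \<le> c" by (rule cSup_least[OF log_slopes_nonempty *])
  show "bdd_above (log_slopes \<phi>)" by (rule bdd_aboveI[OF *])
qed

lemma time_change_less:
  assumes "\<phi> \<in> time_changes" "0 \<le> s" "s < t"
  shows "\<phi> s < \<phi> t"
proof -
  have "strict_mono_on {0..} \<phi>" using assms(1) by (simp add: time_changes_def)
  then show ?thesis by (rule strict_mono_onD) (use assms(2,3) in auto)
qed

lemma time_change_nonneg:
  assumes "\<phi> \<in> time_changes" "0 \<le> t" shows "0 \<le> \<phi> t"
proof -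
  have "\<phi> ` {0..} = {0..}" using assms(1) by (simp add: time_changes_def)
  then have "\<phi> t \<in> {0..}" using assms(2) by (metis atLeast_iff imageI)
  then show ?thesis by simp
qed

lemma time_change_0:
  assumes "\<phi> \<in> time_changes" shows "\<phi> 0 = 0"
proof -
  have "\<phi> ` {0..} = {0..}" using assms by (simp add: time_changes_def)
  then have "0 \<in> \<phi> ` {0..}" by simp
  then obtain t where t: "0 \<le> t" "\<phi> t = 0" by auto
  have "\<not> 0 < t"
    using time_change_less[OF assms order_refl, of t] time_change_nonneg[OF assms order_refl] t(2)
    by linarith
  then show ?thesis using t by simp
qed

lemma time_change_slope_bounds:
  assumes l: "\<phi> \<in> time_changes" and "0 \<le> s" "s < t"
  defines "c \<equiv> Sup (log_slopes \<phi>)"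
  shows "exp (- c) * (t - s) \<le> \<phi> t - \<phi> s" "\<phi> t - \<phi> s \<le> exp c * (t - s)"
proof -
  have pos: "0 < (\<phi> t - \<phi> s) / (t - s)"
    using time_change_less[OF assms(1-3)] assms(3) by simp
  have "\<bar>ln ((\<phi> t - \<phi> s) / (t - s))\<bar> \<le> c"
    unfolding c_def by (rule log_slope_le[OF assms(1-3)])
  then have "- c \<le> ln ((\<phi> t - \<phi> s) / (t - s))" "ln ((\<phi> t - \<phi> s) / (t - s)) \<le> c" by auto
  then have "exp (- c) \<le> (\<phi> t - \<phi> s) / (t - s)" "(\<phi> t - \<phi> s) / (t - s) \<le> exp c"
    using pos by (metis exp_le_cancel_iff exp_ln)+
  then show "exp (- c) * (t - s) \<le> \<phi> t - \<phi> s" "\<phi> t - \<phi> s \<le> exp c * (t - s)"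
    using assms(3) by (simp_all add: field_simps)
qed

lemma time_change_tendsto_right:
  assumes l: "\<phi> \<in> time_changes" and t: "0 \<le> t"
  shows "filterlim \<phi> (at_right (\<phi> t)) (at_right t)"
proof -
  define c where "c = Sup (log_slopes \<phi>)"
  have ev: "\<forall>\<^sub>F s in at_right t. s > t" by (rule eventually_at_right_less)
  have "((\<lambda>s. \<phi> t + exp c * (s - t)) \<longlongrightarrow> \<phi> t + exp c * (t - t)) (at_right t)"
    by (intro tendsto_intros)
  then have up: "((\<lambda>s. \<phi> t + exp c * (s - t)) \<longlongrightarrow> \<phi> t) (at_right t)" by simp
  have "(\<phi> \<longlongrightarrow> \<phi> t) (at_right t)"
    using ev time_change_slope_bounds(2)[OF l t] time_change_less[OF l t]
    by (intro tendsto_sandwich[OF _ _ tendsto_const up])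
      (auto elim!: eventually_mono simp: c_def less_imp_le algebra_simps)
  moreover have "\<forall>\<^sub>F s in at_right t. \<phi> s \<in> {\<phi> t<..}"
    using ev time_change_less[OF l t] by (auto elim!: eventually_mono)
  ultimately show ?thesis
    by (auto simp: filterlim_at elim!: eventually_mono)
qed

lemma id_time_change: "(\<lambda>t. t) \<in> time_changes" and Sup_log_slopes_id: "Sup (log_slopes (\<lambda>t. t)) = 0"
proof -
  have *: "\<bar>ln ((t - s) / (t - s))\<bar> \<le> 0" if "s < t" for s t :: real using that by simp
  show t: "(\<lambda>t. t) \<in> time_changes"
    unfolding time_changes_def
    using Sup_log_slopes_le(2)[of "\<lambda>t. t" 0] * by (auto simp: strict_mono_on_def)
  show "Sup (log_slopes (\<lambda>t. t)) = 0"
    using Sup_log_slopes_le(1)[of "\<lambda>t. t" 0] * Sup_log_slopes_nonneg[OF t] by fastforce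
qed

lemma comp_time_change:
  assumes l: "\<phi> \<in> time_changes" and m: "\<psi> \<in> time_changes"
  shows "(\<lambda>t. \<psi> (\<phi> t)) \<in> time_changes"
    and "Sup (log_slopes (\<lambda>t. \<psi> (\<phi> t))) \<le> Sup (log_slopes \<phi>) + Sup (log_slopes \<psi>)"
proof -
  have *: "\<bar>ln ((\<psi> (\<phi> t) - \<psi> (\<phi> s)) / (t - s))\<bar> \<le> Sup (log_slopes \<phi>) + Sup (log_slopes \<psi>)"
    if st: "0 \<le> s" "s < t" for s t
  proof -
    have l1: "\<phi> s < \<phi> t" "0 \<le> \<phi> s"
      using time_change_less[OF l st] time_change_nonneg[OF l st(1)] by auto
    have m1: "\<psi> (\<phi> s) < \<psi> (\<phi> t)" by (rule time_change_less[OF m l1(2,1)])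
    have "(\<psi> (\<phi> t) - \<psi> (\<phi> s)) / (t - s) =
        ((\<psi> (\<phi> t) - \<psi> (\<phi> s)) / (\<phi> t - \<phi> s)) * ((\<phi> t - \<phi> s) / (t - s))"
      using l1 by simp
    then have "ln ((\<psi> (\<phi> t) - \<psi> (\<phi> s)) / (t - s)) =
        ln ((\<psi> (\<phi> t) - \<psi> (\<phi> s)) / (\<phi> t - \<phi> s)) + ln ((\<phi> t - \<phi> s) / (t - s))"
      using l1 m1 st by (simp only: ln_mult_pos divide_pos_pos diff_gt_0_iff_gt)
    then show ?thesis
      using log_slope_le[OF l st] log_slope_le[OF m l1(2,1)] by linarith
  qed
  show "Sup (log_slopes (\<lambda>t. \<psi> (\<phi> t))) \<le> Sup (log_slopes \<phi>) + Sup (log_slopes \<psi>)"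
    by (rule Sup_log_slopes_le(1)) (rule *)
  have "bdd_above (log_slopes (\<lambda>t. \<psi> (\<phi> t)))"
    by (rule Sup_log_slopes_le(2)) (rule *)
  moreover have "(\<lambda>t. \<psi> (\<phi> t)) ` {0..} = {0..}"
    using l m unfolding time_changes_def by (metis (mono_tags, lifting) image_image mem_Collect_eq)
  moreover have "strict_mono_on {0..} (\<lambda>t. \<psi> (\<phi> t))"
    using time_change_less[OF l] time_change_nonneg[OF l] time_change_less[OF m]
    by (auto simp: strict_mono_on_def)
  ultimately show "(\<lambda>t. \<psi> (\<phi> t)) \<in> time_changes" by (simp add: time_changes_def)
qed

lemma inverse_time_change:
  assumes l: "\<phi> \<in> time_changes"
  defines "\<psi> \<equiv> inv_into {0..} \<phi>"
  shows "\<And>t. 0 \<le> t \<Longrightarrow> \<psi> (\<phi> t) = t" "\<And>t. 0 \<le> t \<Longrightarrow> \<phi> (\<psi> t) = t"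
    "\<psi> \<in> time_changes" "Sup (log_slopes \<psi>) \<le> Sup (log_slopes \<phi>)"
proof -
  have inj: "inj_on \<phi> {0..}"
    using l unfolding time_changes_def by (auto intro: strict_mono_on_imp_inj_on)
  have im: "\<phi> ` {0..} = {0..}" using l unfolding time_changes_def by auto
  show left: "\<psi> (\<phi> t) = t" if "0 \<le> t" for t
    unfolding \<psi>_def using inj that by (simp add: inv_into_f_f)
  show right: "\<phi> (\<psi> t) = t" if "0 \<le> t" for t
    unfolding \<psi>_def using im that by (intro f_inv_into_f) auto
  have nonneg: "0 \<le> \<psi> t" if "0 \<le> t" for t
    using inv_into_into[of t \<phi> "{0..}"] im that unfolding \<psi>_def by auto
  have mono: "\<psi> s < \<psi> t" if "0 \<le> s" "s < t" for s t
  proof (rule ccontr)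
    assume "\<not> \<psi> s < \<psi> t"
    then have "\<phi> (\<psi> t) \<le> \<phi> (\<psi> s)"
      using time_change_less[OF l, of "\<psi> t" "\<psi> s"] nonneg[of t] that by fastforce
    then show False using right that by simp
  qed
  have *: "\<bar>ln ((\<psi> t - \<psi> s) / (t - s))\<bar> \<le> Sup (log_slopes \<phi>)" if st: "0 \<le> s" "s < t" for s t
  proof -
    have "\<bar>ln ((\<phi> (\<psi> t) - \<phi> (\<psi> s)) / (\<psi> t - \<psi> s))\<bar> \<le> Sup (log_slopes \<phi>)"
      using log_slope_le[OF l nonneg[OF st(1)] mono[OF st]] .
    moreover have "\<phi> (\<psi> t) - \<phi> (\<psi> s) = t - s" using right st by simp
    moreover have "ln ((t - s) / (\<psi> t - \<psi> s)) = - ln ((\<psi> t - \<psi> s) / (t - s))"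
      using mono[OF st] st by (simp add: ln_div)
    ultimately show ?thesis by simp
  qed
  show "Sup (log_slopes \<psi>) \<le> Sup (log_slopes \<phi>)" by (rule Sup_log_slopes_le(1)) (rule *)
  have "bdd_above (log_slopes \<psi>)" by (rule Sup_log_slopes_le(2)) (rule *)
  moreover have "\<psi> ` {0..} = {0..}"
  proof
    show "\<psi> ` {0..} \<subseteq> {0..}" using nonneg by auto
    show "{0..} \<subseteq> \<psi> ` {0..}"
    proof
      fix t :: real assume "t \<in> {0..}"
      then have "t = \<psi> (\<phi> t)" "\<phi> t \<in> {0..}" using left time_change_nonneg[OF l] by auto
      then show "t \<in> \<psi> ` {0..}" by (rule image_eqI)
    qed
  qed
  moreover have "strict_mono_on {0..} \<psi>" using mono by (auto simp: strict_mono_on_def)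
  ultimately show "\<psi> \<in> time_changes" by (simp add: time_changes_def)
qed

subsubsection \<open>The deviation under a time change\<close>

lemma skorohod_dev_bdd: "bdd_above ((\<lambda>t. min 1 \<bar>x (min t u) - y (min (\<phi> t) u)\<bar>) ` T)"
  for x y \<phi> :: "real \<Rightarrow> real"
  by (intro bdd_aboveI2[where M = 1]) simp

lemma skorohod_dev_upper:
  "0 \<le> t \<Longrightarrow> min 1 \<bar>x (min t u) - y (min (\<phi> t) u)\<bar> \<le> skorohod_dev x y \<phi> u"
  unfolding skorohod_dev_def by (intro cSUP_upper skorohod_dev_bdd) auto

lemma skorohod_dev_least:
  "(\<And>t. 0 \<le> t \<Longrightarrow> min 1 \<bar>x (min t u) - y (min (\<phi> t) u)\<bar> \<le> c) \<Longrightarrow> skorohod_dev x y \<phi> u \<le> c"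
  unfolding skorohod_dev_def by (intro cSUP_least) auto

lemma skorohod_dev_nonneg: "0 \<le> skorohod_dev x y \<phi> u"
proof -
  have "0 \<le> min 1 \<bar>x (min 0 u) - y (min (\<phi> 0) u)\<bar>" by simp
  also have "\<dots> \<le> skorohod_dev x y \<phi> u" by (rule skorohod_dev_upper) simp
  finally show ?thesis .
qed

lemma skorohod_dev_le_1: "skorohod_dev x y \<phi> u \<le> 1"
  by (rule skorohod_dev_least) simp

lemma min_abs_triangle: "min 1 \<bar>a - c\<bar> \<le> min 1 \<bar>a - b\<bar> + min 1 \<bar>b - c\<bar>" for a b c :: real
  by (auto simp: min_def)

lemma skorohod_dev_triangle:
  assumes "\<phi> \<in> time_changes"
  shows "skorohod_dev x z (\<lambda>t. \<psi> (\<phi> t)) u \<le> skorohod_dev x y \<phi> u + skorohod_dev y z \<psi> u"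
proof (rule skorohod_dev_least)
  fix t :: real assume t: "0 \<le> t"
  show "min 1 \<bar>x (min t u) - z (min (\<psi> (\<phi> t)) u)\<bar> \<le> skorohod_dev x y \<phi> u + skorohod_dev y z \<psi> u"
    using skorohod_dev_upper[OF t, of x u y \<phi>]
      skorohod_dev_upper[OF time_change_nonneg[OF assms t], of y u z \<psi>]
      min_abs_triangle[of "x (min t u)" "z (min (\<psi> (\<phi> t)) u)" "y (min (\<phi> t) u)"]
    by (meson add_mono order_trans)
qed

lemma skorohod_dev_inverse:
  assumes l: "\<phi> \<in> time_changes"
  shows "skorohod_dev y x (inv_into {0..} \<phi>) u = skorohod_dev x y \<phi> u"
proof (rule antisym; rule skorohod_dev_least)
  fix t :: real assume t: "0 \<le> t"
  let ?s = "inv_into {0..} \<phi> t"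
  have "0 \<le> ?s" by (rule time_change_nonneg[OF inverse_time_change(3)[OF l] t])
  from skorohod_dev_upper[OF this, of x u y \<phi>]
  show "min 1 \<bar>y (min t u) - x (min ?s u)\<bar> \<le> skorohod_dev x y \<phi> u"
    using inverse_time_change(2)[OF l t] by (simp add: abs_minus_commute)
  from skorohod_dev_upper[OF time_change_nonneg[OF l t], of y u x "inv_into {0..} \<phi>"]
  show "min 1 \<bar>x (min t u) - y (min (\<phi> t) u)\<bar> \<le> skorohod_dev y x (inv_into {0..} \<phi>) u"
    using inverse_time_change(1)[OF l t] by (simp add: abs_minus_commute)
qed

lemma cadlag_right:
  assumes "x \<in> cadlag" "0 \<le> t" shows "(x \<longlongrightarrow> x t) (at_right t)"
  using assms by (simp add: cadlag_def)

lemma cadlag_min_right: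
  assumes x: "x \<in> cadlag" and t: "0 \<le> g t" and u: "0 \<le> u"
    and g: "filterlim g (at_right (g t)) (at_right t)"
  shows "((\<lambda>s. x (min (g s) u)) \<longlongrightarrow> x (min (g t) u)) (at_right t)"
proof (cases "g t < u")
  case True
  have lim: "((\<lambda>s. x (g s)) \<longlongrightarrow> x (g t)) (at_right t)"
    by (rule filterlim_compose[OF cadlag_right[OF x t] g])
  have "(g \<longlongrightarrow> g t) (at_right t)" using g by (simp add: filterlim_at)
  then have "\<forall>\<^sub>F s in at_right t. g s < u" using True by (rule order_tendstoD)
  then have "\<forall>\<^sub>F s in at_right t. x (g s) = x (min (g s) u)" by eventually_elim simp
  from Lim_transform_eventually[OF lim this] show ?thesis using True by simp
next
  case False
  have "\<forall>\<^sub>F s in at_right t. g s > g t"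
    using g by (auto simp: filterlim_at elim!: eventually_mono)
  then have "\<forall>\<^sub>F s in at_right t. x (min (g t) u) = x (min (g s) u)"
    by (rule eventually_mono) (use False in \<open>simp add: min_def\<close>)
  from Lim_transform_eventually[OF tendsto_const this] show ?thesis .
qed

lemma cadlag_measurable:
  assumes x: "x \<in> cadlag"
  shows "(\<lambda>u. x (max 0 u)) \<in> borel_measurable borel"
proof (rule borel_measurable_LIMSEQ_real)
  let ?q = "\<lambda>n u::real. (real_of_int \<lfloor>real (Suc n) * max 0 u\<rfloor> + 1) / real (Suc n)"
  fix u :: real
  let ?v = "max 0 u"
  have gt: "?v < ?q n u" for n
  proof -
    have "real (Suc n) * ?v < real_of_int \<lfloor>real (Suc n) * ?v\<rfloor> + 1" by linarith
    then have "?v * real (Suc n) < real_of_int \<lfloor>real (Suc n) * ?v\<rfloor> + 1"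
      by (simp only: mult.commute)
    then show ?thesis by (subst pos_less_divide_eq) simp_all
  qed
  have le: "?q n u \<le> ?v + inverse (real (Suc n))" for n
  proof -
    have "real_of_int \<lfloor>real (Suc n) * ?v\<rfloor> + 1 \<le> real (Suc n) * ?v + 1" by linarith
    then have "?q n u \<le> (real (Suc n) * ?v + 1) / real (Suc n)"
      by (intro divide_right_mono) auto
    also have "\<dots> = ?v + inverse (real (Suc n))" by (simp add: field_simps)
    finally show ?thesis .
  qed
  have up: "(\<lambda>n. ?v + inverse (real (Suc n))) \<longlonglongrightarrow> ?v"
    using tendsto_add[OF tendsto_const[of ?v] LIMSEQ_inverse_real_of_nat] by simp
  have lim: "(\<lambda>n. ?q n u) \<longlonglongrightarrow> ?v"
    by (rule tendsto_sandwich[OF always_eventually always_eventually tendsto_const up])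
      (intro allI less_imp_le gt le)+
  have gt': "?q n u \<in> {?v<..} \<and> ?q n u \<noteq> ?v" for n
    using gt[of n] less_imp_neq[OF gt[of n], THEN not_sym]
    by (intro conjI) (simp_all only: greaterThan_iff not_False_eq_True)
  have "filterlim (\<lambda>n. ?q n u) (at_right ?v) sequentially"
    unfolding filterlim_at
    by (rule conjI[OF always_eventually[OF allI[OF gt']] lim])
  then show "(\<lambda>n. x (?q n u)) \<longlonglongrightarrow> x ?v"
    by (rule filterlim_compose[OF cadlag_right[OF x], rotated]) simp
next
  fix n
  have "(\<lambda>u::real. \<lfloor>real (Suc n) * max 0 u\<rfloor>) \<in> measurable borel (count_space UNIV)"
    by measurable
  moreover have "(\<lambda>k::int. x ((real_of_int k + 1) / real (Suc n))) \<in>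
      borel_measurable (count_space UNIV)" by simp
  ultimately show "(\<lambda>u. x ((real_of_int \<lfloor>real (Suc n) * max 0 u\<rfloor> + 1) / real (Suc n))) \<in>
      borel_measurable borel"
    by (rule measurable_compose)
qed

lemma skorohod_dev_rat:
  assumes x: "x \<in> cadlag" and y: "y \<in> cadlag" and l: "\<phi> \<in> time_changes" and u: "0 \<le> u"
  shows "skorohod_dev x y \<phi> u = (SUP t\<in>\<rat> \<inter> {0..}. min 1 \<bar>x (min t u) - y (min (\<phi> t) u)\<bar>)"
    (is "_ = (SUP t\<in>?Q. ?h t)")
proof (rule antisym)
  have ne: "?Q \<noteq> {}" by (metis Int_iff Rats_0 atLeast_iff empty_iff order_refl)
  show "(SUP t\<in>?Q. ?h t) \<le> skorohod_dev x y \<phi> u"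
    by (intro cSUP_least[OF ne] skorohod_dev_upper) auto
  show "skorohod_dev x y \<phi> u \<le> (SUP t\<in>?Q. ?h t)"
  proof (rule skorohod_dev_least)
    fix t :: real assume t: "0 \<le> t"
    have id: "filterlim (\<lambda>s. s) (at_right t) (at_right t)" by (rule filterlim_ident)
    have lim: "(?h \<longlongrightarrow> ?h t) (at_right t)"
      by (intro tendsto_intros cadlag_min_right[OF x, of "\<lambda>s. s"] cadlag_min_right[OF y, of \<phi>]
          t u id time_change_tendsto_right[OF l t] time_change_nonneg[OF l t])
    show "?h t \<le> (SUP t\<in>?Q. ?h t)"
    proof (rule ccontr)
      assume "\<not> ?h t \<le> (SUP t\<in>?Q. ?h t)"
      then have "\<forall>\<^sub>F s in at_right t. (SUP t\<in>?Q. ?h t) < ?h s"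
        by (intro order_tendstoD(1)[OF lim]) (simp only: not_le)
      then obtain b where b: "b > t" "\<And>s. t < s \<Longrightarrow> s < b \<Longrightarrow> (SUP t\<in>?Q. ?h t) < ?h s"
        unfolding eventually_at_right_field by blast
      obtain s where s: "s \<in> \<rat>" "t < s" "s < b" using Rats_dense_in_real[OF b(1)] by blast
      then have "?h s \<le> (SUP t\<in>?Q. ?h t)"
        using t by (intro cSUP_upper skorohod_dev_bdd) auto
      then show False using b(2)[OF s(2,3)] by simp
    qed
  qed
qed

lemma skorohod_dev_integrable:
  assumes x: "x \<in> cadlag" and y: "y \<in> cadlag" and l: "\<phi> \<in> time_changes"
  shows "set_integrable lborel {0..} (\<lambda>u. exp (- u) * skorohod_dev x y \<phi> u)"
proof -
  let ?Q = "\<rat> \<inter> {0::real..}"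
  let ?g = "\<lambda>u. SUP t\<in>?Q. min 1 \<bar>x (max 0 (min t u)) - y (max 0 (min (\<phi> t) u))\<bar>"
  have mx: "(\<lambda>u. x (max 0 (min c u))) \<in> borel_measurable borel" if "x \<in> cadlag" for x c
    by (rule measurable_compose[OF _ cadlag_measurable[OF that]]) measurable
  have g: "?g \<in> borel_measurable borel"
  proof (rule borel_measurable_cSUP)
    show "countable ?Q" using countable_rat by (rule countable_Int1)
    show "(\<lambda>u. min 1 \<bar>x (max 0 (min t u)) - y (max 0 (min (\<phi> t) u))\<bar>) \<in> borel_measurable borel"
      for t using mx[OF x, of t] mx[OF y, of "\<phi> t"] by measurable
    show "bdd_above ((\<lambda>t. min 1 \<bar>x (max 0 (min t u)) - y (max 0 (min (\<phi> t) u))\<bar>) ` ?Q)" for u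
      by (intro bdd_aboveI2[where M = 1]) simp
  qed
  have eq: "skorohod_dev x y \<phi> u = ?g u" if "0 \<le> u" for u
    unfolding skorohod_dev_rat[OF x y l that]
    by (intro SUP_cong refl) (use that time_change_nonneg[OF l] in \<open>auto simp: max_def min_def\<close>)
  have m: "set_borel_measurable lborel {0..} (\<lambda>u. exp (- u) * ?g u)"
    unfolding set_borel_measurable_def using g by measurable
  have m': "set_borel_measurable lborel {0..} (\<lambda>u. exp (- u) * skorohod_dev x y \<phi> u)"
    using m eq unfolding set_borel_measurable_def
    by (subst measurable_cong[where g = "\<lambda>u. indicator {0..} u *\<^sub>R (exp (- u) * ?g u)"])
      (auto simp: indicator_def)
  have "set_integrable lborel {0::real..} (\<lambda>u. exp (- u))"
  proof -
    have "set_integrable lborel {0::real<..} (\<lambda>u. exp (- u * 1))"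
      using integrable_I0i_exp_mscale[of 1] by (simp add: ac_simps)
    moreover have "AE u in lborel. u \<noteq> (0::real)" by (rule AE_lborel_singleton)
    ultimately show ?thesis
      unfolding set_integrable_def
      by (subst integrable_cong_AE[where g = "\<lambda>u. indicator {0<..} u *\<^sub>R exp (- u * 1)"])
        (auto simp: indicator_def elim!: eventually_mono)
  qed
  then show ?thesis
    by (rule set_integrable_bound[OF _ m'])
      (use skorohod_dev_nonneg skorohod_dev_le_1 in \<open>auto simp: abs_mult intro!: AE_I2 mult_left_le\<close>)
qed

subsubsection \<open>The metric axioms\<close>

lemma skorohod_integral_nonneg: "0 \<le> (LINT u:{0..}|lborel. exp (- u) * skorohod_dev x y \<phi> u)"
  unfolding set_lebesgue_integral_def
  by (intro Bochner_Integration.integral_nonneg) (simp add: skorohod_dev_nonneg)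

lemma skorohod_cost_nonneg: "0 \<le> skorohod_cost x y \<phi>"
  unfolding skorohod_cost_def using skorohod_integral_nonneg by (simp add: le_max_iff_disj)

lemma skorohod_dist_nonneg: "0 \<le> skorohod_dist x y"
  unfolding skorohod_dist_def using id_time_change skorohod_cost_nonneg by (intro cINF_greatest) auto

lemma skorohod_dist_le: "\<phi> \<in> time_changes \<Longrightarrow> skorohod_dist x y \<le> skorohod_cost x y \<phi>"
  unfolding skorohod_dist_def
  by (intro cINF_lower bdd_belowI2[where m = 0] skorohod_cost_nonneg)

lemma skorohod_dist_less:
  assumes "skorohod_dist x y < c"
  obtains \<phi> where "\<phi> \<in> time_changes" "skorohod_cost x y \<phi> < c"
proof -
  have "\<exists>z\<in>skorohod_cost x y ` time_changes. z < c"
    using assms id_time_change unfolding skorohod_dist_def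
    by (intro cInf_lessD) auto
  then show ?thesis using that by blast
qed

lemma skorohod_cost_triangle:
  assumes x: "x \<in> cadlag" and y: "y \<in> cadlag" and z: "z \<in> cadlag"
    and l: "\<phi> \<in> time_changes" and m: "\<psi> \<in> time_changes"
  shows "skorohod_cost x z (\<lambda>t. \<psi> (\<phi> t)) \<le> skorohod_cost x y \<phi> + skorohod_cost y z \<psi>"
proof -
  have I1: "set_integrable lborel {0..} (\<lambda>u. exp (- u) * skorohod_dev x y \<phi> u)"
    by (rule skorohod_dev_integrable[OF x y l])
  have I2: "set_integrable lborel {0..} (\<lambda>u. exp (- u) * skorohod_dev y z \<psi> u)"
    by (rule skorohod_dev_integrable[OF y z m])
  have I3: "set_integrable lborel {0..} (\<lambda>u. exp (- u) * skorohod_dev x z (\<lambda>t. \<psi> (\<phi> t)) u)"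
    by (rule skorohod_dev_integrable[OF x z comp_time_change(1)[OF l m]])
  have "(LINT u:{0..}|lborel. exp (- u) * skorohod_dev x z (\<lambda>t. \<psi> (\<phi> t)) u) \<le>
     (LINT u:{0..}|lborel. exp (- u) * skorohod_dev x y \<phi> u + exp (- u) * skorohod_dev y z \<psi> u)"
  proof (rule set_integral_mono[OF I3 set_integral_add(1)[OF I1 I2]])
    fix u :: real
    show "exp (- u) * skorohod_dev x z (\<lambda>t. \<psi> (\<phi> t)) u \<le>
        exp (- u) * skorohod_dev x y \<phi> u + exp (- u) * skorohod_dev y z \<psi> u"
      unfolding distrib_left[symmetric] by (intro mult_left_mono skorohod_dev_triangle[OF l]) simp
  qed
  also have "\<dots> = (LINT u:{0..}|lborel. exp (- u) * skorohod_dev x y \<phi> u) +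
     (LINT u:{0..}|lborel. exp (- u) * skorohod_dev y z \<psi> u)"
    by (rule set_integral_add(2)[OF I1 I2])
  finally show ?thesis
    using comp_time_change(2)[OF l m] unfolding skorohod_cost_def by linarith
qed

lemma skorohod_cost_inverse:
  assumes l: "\<phi> \<in> time_changes"
  shows "skorohod_cost y x (inv_into {0..} \<phi>) \<le> skorohod_cost x y \<phi>"
  using inverse_time_change(4)[OF l] skorohod_dev_inverse[OF l]
  unfolding skorohod_cost_def by (simp only:)

lemma skorohod_dist_close:
  assumes x: "x \<in> cadlag" and y: "y \<in> cadlag" and e: "0 < e" "e \<le> 1" and N: "0 \<le> N"
    and d: "skorohod_dist x y < e * exp (- (N + 1))"
  obtains \<phi> where "\<phi> \<in> time_changes" "Sup (log_slopes \<phi>) < e"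
    "\<And>s. 0 \<le> s \<Longrightarrow> s \<le> N \<Longrightarrow> \<phi> s \<le> N \<Longrightarrow> \<bar>x s - y (\<phi> s)\<bar> < e"
proof -
  from skorohod_dist_less[OF d] obtain \<phi>
    where l: "\<phi> \<in> time_changes" and c: "skorohod_cost x y \<phi> < e * exp (- (N + 1))" .
  have "e * exp (- (N + 1)) \<le> e" using e N by (intro mult_left_le) auto
  then have slope: "Sup (log_slopes \<phi>) < e" using c unfolding skorohod_cost_def by linarith
  have int: "(LINT u:{0..}|lborel. exp (- u) * skorohod_dev x y \<phi> u) < e * exp (- (N + 1))"
    using c unfolding skorohod_cost_def by simp
  have "\<exists>u\<in>{N..N+1}. skorohod_dev x y \<phi> u < e"
  proof (rule ccontr)
    assume "\<not> ?thesis"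
    then have big: "e \<le> skorohod_dev x y \<phi> u" if "N \<le> u" "u \<le> N + 1" for u using that by force
    have I: "set_integrable lborel {0..} (\<lambda>u. exp (- u) * skorohod_dev x y \<phi> u)"
      by (rule skorohod_dev_integrable[OF x y l])
    have "e * exp (- (N + 1)) = (LINT u:{N..N+1}|lborel. e * exp (- (N + 1)))"
      unfolding set_lebesgue_integral_def by simp
    also have "\<dots> \<le> (LINT u:{0..}|lborel. exp (- u) * skorohod_dev x y \<phi> u)"
      unfolding set_lebesgue_integral_def
    proof (rule integral_mono)
      show "integrable lborel (\<lambda>u. indicator {N..N+1} u *\<^sub>R (e * exp (- (N + 1))))" by simp
      show "integrable lborel (\<lambda>u. indicator {0..} u *\<^sub>R (exp (- u) * skorohod_dev x y \<phi> u))"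
        using I unfolding set_integrable_def .
      fix u :: real
      have "exp (- (N + 1)) * e \<le> exp (- u) * skorohod_dev x y \<phi> u" if "N \<le> u" "u \<le> N + 1"
        using big[OF that] that e by (intro mult_mono) auto
      then show "indicator {N..N+1} u *\<^sub>R (e * exp (- (N + 1))) \<le>
          indicator {0..} u *\<^sub>R (exp (- u) * skorohod_dev x y \<phi> u)"
        using N skorohod_dev_nonneg[of x y \<phi> u] by (auto simp: indicator_def mult.commute)
    qed
    finally show False using int by simp
  qed
  then obtain u where u: "N \<le> u" "skorohod_dev x y \<phi> u < e" by auto
  show ?thesis
  proof (rule that[OF l slope])
    fix s assume s: "0 \<le> s" "s \<le> N" "\<phi> s \<le> N"
    then have "min s u = s" "min (\<phi> s) u = \<phi> s" using u by auto
    then have "min 1 \<bar>x s - y (\<phi> s)\<bar> < e"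
      using skorohod_dev_upper[OF s(1), of x u y \<phi>] u(2) by simp
    then show "\<bar>x s - y (\<phi> s)\<bar> < e" using e by linarith
  qed
qed

lemma skorohod_dist_refl: "skorohod_dist x x = 0"
proof -
  have "skorohod_dev x x (\<lambda>t. t) u = 0" for u
    using skorohod_dev_nonneg[of x x "\<lambda>t. t" u] skorohod_dev_least[of x u x "\<lambda>t. t" 0] by simp
  then have "skorohod_cost x x (\<lambda>t. t) = 0"
    unfolding skorohod_cost_def Sup_log_slopes_id by (simp add: set_lebesgue_integral_def)
  then show ?thesis
    using skorohod_dist_le[OF id_time_change, of x x] skorohod_dist_nonneg[of x x] by simp
qed

lemma skorohod_dist_eq_0:
  assumes x: "x \<in> cadlag" and y: "y \<in> cadlag" and d: "skorohod_dist x y = 0"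
  shows "x = y"
proof (rule extensionalityI[where A = "{0..}"])
  show "x \<in> extensional {0..}" "y \<in> extensional {0..}" using x y by (auto simp: cadlag_def)
  fix t :: real assume "t \<in> {0..}"
  then have t: "0 \<le> t" by simp
  show "x t = y t"
  proof (rule ccontr)
    assume ne: "x t \<noteq> y t"
    define e where "e = min 1 (\<bar>x t - y t\<bar> / 3)"
    have e: "0 < e" "e \<le> 1" "3 * e \<le> \<bar>x t - y t\<bar>" using ne by (auto simp: e_def min_def)
    have near: "\<exists>b>t. \<forall>s>t. s < b \<longrightarrow> \<bar>x s - x t\<bar> < e" if "x \<in> cadlag" for x
    proof -
      have "\<forall>\<^sub>F s in at_right t. dist (x s) (x t) < e"
        by (rule tendstoD[OF cadlag_right[OF that t] e(1)])
      then show ?thesis unfolding eventually_at_right_field dist_real_def .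
    qed
    obtain b1 where b1: "b1 > t" "\<And>s. t < s \<Longrightarrow> s < b1 \<Longrightarrow> \<bar>x s - x t\<bar> < e"
      using near[OF x] by blast
    obtain b2 where b2: "b2 > t" "\<And>s. t < s \<Longrightarrow> s < b2 \<Longrightarrow> \<bar>y s - y t\<bar> < e"
      using near[OF y] by blast
    define b where "b = min b1 b2"
    define s where "s = (t + b) / 2"
    have s: "t < s" "s < b" "0 < s" using b1(1) b2(1) t by (auto simp: s_def b_def)
    have "((\<lambda>c. exp c * s) \<longlongrightarrow> exp 0 * s) (at_right (0::real))" by (intro tendsto_intros)
    then have "\<forall>\<^sub>F c in at_right (0::real). exp c * s < b"
      using s by (intro order_tendstoD) auto
    moreover have "((\<lambda>c. exp (- c) * s) \<longlongrightarrow> exp (- 0) * s) (at_right (0::real))"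
      by (intro tendsto_intros)
    then have "\<forall>\<^sub>F c in at_right (0::real). t < exp (- c) * s"
      using s by (intro order_tendstoD) auto
    moreover have "\<forall>\<^sub>F c in at_right (0::real). 0 < c \<and> c \<le> e"
      using e(1) eventually_at_right_real[OF e(1)] by (auto elim!: eventually_mono)
    ultimately have "\<forall>\<^sub>F c in at_right (0::real). exp c * s < b \<and> t < exp (- c) * s \<and> 0 < c \<and> c \<le> e"
      by eventually_elim simp
    then obtain c where c: "exp c * s < b" "t < exp (- c) * s" "0 < c" "c \<le> e"
      using eventually_happens'[OF trivial_limit_at_right_real] by blast
    have "skorohod_dist x y < c * exp (- (b + 1))" using d c by simp
    then obtain \<phi> where l: "\<phi> \<in> time_changes" "Sup (log_slopes \<phi>) < c"
      "\<And>s. 0 \<le> s \<Longrightarrow> s \<le> b \<Longrightarrow> \<phi> s \<le> b \<Longrightarrow> \<bar>x s - y (\<phi> s)\<bar> < c"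
      by (rule skorohod_dist_close[OF x y c(3) order_trans[OF c(4) e(2)], rotated])
        (use s in \<open>auto intro: less_imp_le\<close>)
    have "exp (- c) * s \<le> exp (- Sup (log_slopes \<phi>)) * s" "exp (Sup (log_slopes \<phi>)) * s \<le> exp c * s"
      using l(2) s by (auto intro!: mult_right_mono)
    moreover have "exp (- Sup (log_slopes \<phi>)) * s \<le> \<phi> s" "\<phi> s \<le> exp (Sup (log_slopes \<phi>)) * s"
      using time_change_slope_bounds[OF l(1), of 0 s] time_change_0[OF l(1)] s by auto
    ultimately have "t < \<phi> s" "\<phi> s < b" using c(1,2) by linarith+
    then have "\<bar>x s - y (\<phi> s)\<bar> < e" "\<bar>y (\<phi> s) - y t\<bar> < e" "\<bar>x s - x t\<bar> < e"
      using l(3)[of s] b2(2)[of "\<phi> s"] b1(2)[of s] s c by (auto simp: b_def)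
    then show False using e(3) by linarith
  qed
qed

lemma Metric_space_skorohod: "Metric_space cadlag skorohod_dist"
proof
  show "0 \<le> skorohod_dist x y" for x y by (rule skorohod_dist_nonneg)
  show "(skorohod_dist x y = 0) = (x = y)" if "x \<in> cadlag" "y \<in> cadlag" for x y
    using skorohod_dist_eq_0[OF that] skorohod_dist_refl by blast
next
  have le: "skorohod_dist y x \<le> skorohod_dist x y" for x y
  proof (rule field_le_epsilon)
    fix e :: real assume "0 < e"
    then obtain \<phi> where "\<phi> \<in> time_changes" "skorohod_cost x y \<phi> < skorohod_dist x y + e"
      using skorohod_dist_less[of x y "skorohod_dist x y + e"] by auto
    then show "skorohod_dist y x \<le> skorohod_dist x y + e"
      using skorohod_cost_inverse inverse_time_change(3) skorohod_dist_le
      by (meson less_imp_le order_trans)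
  qed
  show "skorohod_dist x y = skorohod_dist y x" for x y
    using le[of x y] le[of y x] by simp
  show "skorohod_dist x z \<le> skorohod_dist x y + skorohod_dist y z"
    if xyz: "x \<in> cadlag" "y \<in> cadlag" "z \<in> cadlag" for x y z
  proof (rule field_le_epsilon)
    fix e :: real assume e: "0 < e"
    obtain \<phi> where l: "\<phi> \<in> time_changes" "skorohod_cost x y \<phi> < skorohod_dist x y + e / 2"
      using skorohod_dist_less[of x y "skorohod_dist x y + e / 2"] e by auto
    obtain \<psi> where m: "\<psi> \<in> time_changes" "skorohod_cost y z \<psi> < skorohod_dist y z + e / 2"
      using skorohod_dist_less[of y z "skorohod_dist y z + e / 2"] e by auto
    show "skorohod_dist x z \<le> skorohod_dist x y + skorohod_dist y z + e"
      using skorohod_dist_le[OF comp_time_change(1)[OF l(1) m(1)], of x z]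
        skorohod_cost_triangle[OF xyz l(1) m(1)] l(2) m(2) by linarith
  qed
qed

section \<open>Processes indexed by the half-line\<close>

definition stochastic_process :: "'a measure \<Rightarrow> (real \<Rightarrow> 'a \<Rightarrow> real) \<Rightarrow> bool" where
  "stochastic_process M X \<longleftrightarrow> prob_space M \<and> (\<forall>t\<ge>0. X t \<in> borel_measurable M)"

definition sample_path :: "(real \<Rightarrow> 'a \<Rightarrow> real) \<Rightarrow> 'a \<Rightarrow> real \<Rightarrow> real" where
  "sample_path X \<omega> = (\<lambda>t\<in>{0..}. X t \<omega>)"

text \<open>Constants count as (degenerate) Gaussian random variables.\<close>

definition gaussian_variable :: "'a measure \<Rightarrow> ('a \<Rightarrow> real) \<Rightarrow> bool" where
  "gaussian_variable M Z \<longleftrightarrow> Z \<in> borel_measurable M \<and>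
     ((\<exists>m s. s > 0 \<and> distributed M lborel Z (normal_density m s)) \<or> (\<exists>m. AE \<omega> in M. Z \<omega> = m))"

definition centered_gaussian_process :: "'a measure \<Rightarrow> (real \<Rightarrow> 'a \<Rightarrow> real) \<Rightarrow> bool" where
  "centered_gaussian_process M X \<longleftrightarrow> stochastic_process M X \<and>
     (\<forall>S c. finite S \<and> S \<subseteq> {0..} \<longrightarrow> gaussian_variable M (\<lambda>\<omega>. \<Sum>t\<in>S. c t * X t \<omega>)) \<and>
     (\<forall>t\<ge>0. prob_space.expectation M (X t) = 0)"

definition fractional_brownian_motion ::
  "real \<Rightarrow> 'a measure \<Rightarrow> (real \<Rightarrow> 'a \<Rightarrow> real) \<Rightarrow> bool" where
  "fractional_brownian_motion H M B \<longleftrightarrow> stochastic_process M B \<and>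
     (if H = 1 then
        \<exists>Z. distributed M lborel Z std_normal_density \<and> (\<forall>t\<ge>0. \<forall>\<omega>\<in>space M. B t \<omega> = t * Z \<omega>)
      else
        0 < H \<and> H < 1 \<and> centered_gaussian_process M B \<and>
        (\<forall>s\<ge>0. \<forall>t\<ge>0. prob_space.expectation M (\<lambda>\<omega>. B s \<omega> * B t \<omega>) =
           (s powr (2 * H) + t powr (2 * H) - \<bar>t - s\<bar> powr (2 * H)) / 2) \<and>
        (\<forall>\<omega>\<in>space M. continuous_on {0..} (\<lambda>t. B t \<omega>)))"

definition same_fdd ::
  "'a measure \<Rightarrow> (real \<Rightarrow> 'a \<Rightarrow> real) \<Rightarrow> 'b measure \<Rightarrow> (real \<Rightarrow> 'b \<Rightarrow> real) \<Rightarrow> bool" where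
  "same_fdd M X N Y \<longleftrightarrow> (\<forall>S. finite S \<and> S \<subseteq> {0..} \<longrightarrow>
     distr M (PiM S (\<lambda>_. borel)) (\<lambda>\<omega>. \<lambda>t\<in>S. X t \<omega>) =
     distr N (PiM S (\<lambda>_. borel)) (\<lambda>\<omega>. \<lambda>t\<in>S. Y t \<omega>))"

section \<open>Weak convergence and small scale limits\<close>

definition weakly_converges :: "'x topology \<Rightarrow> 'a measure \<Rightarrow> (real \<Rightarrow> 'a \<Rightarrow> 'x) \<Rightarrow> real filter \<Rightarrow>
    'b measure \<Rightarrow> ('b \<Rightarrow> 'x) \<Rightarrow> bool" where
  "weakly_converges T M X F N Y \<longleftrightarrow>
     (\<forall>f. continuous_map T euclideanreal f \<and> bounded (f ` topspace T) \<longrightarrow>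
        ((\<lambda>u. prob_space.expectation M (\<lambda>\<omega>. f (X u \<omega>))) \<longlongrightarrow>
          prob_space.expectation N (\<lambda>\<omega>. f (Y \<omega>))) F)"

definition fdd_converges :: "'a measure \<Rightarrow> (real \<Rightarrow> real \<Rightarrow> 'a \<Rightarrow> real) \<Rightarrow> real filter \<Rightarrow>
    'b measure \<Rightarrow> (real \<Rightarrow> 'b \<Rightarrow> real) \<Rightarrow> bool" where
  "fdd_converges M X F N Y \<longleftrightarrow> (\<forall>S. finite S \<and> S \<subseteq> {0..} \<longrightarrow>
     weakly_converges (product_topology (\<lambda>_. euclideanreal) S)
       M (\<lambda>u \<omega>. \<lambda>\<tau>\<in>S. X u \<tau> \<omega>) F N (\<lambda>\<omega>. \<lambda>\<tau>\<in>S. Y \<tau> \<omega>))"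

definition scaled_increment ::
  "(real \<Rightarrow> 'a \<Rightarrow> real) \<Rightarrow> real \<Rightarrow> (real \<Rightarrow> real) \<Rightarrow> real \<Rightarrow> real \<Rightarrow> 'a \<Rightarrow> real" where
  "scaled_increment X t a u \<tau> \<omega> = (X t \<omega> - X (t + \<tau> * u) \<omega>) / a u"

definition small_scale_limit :: "'a measure \<Rightarrow> (real \<Rightarrow> 'a \<Rightarrow> real) \<Rightarrow> real \<Rightarrow>
    'b measure \<Rightarrow> (real \<Rightarrow> 'b \<Rightarrow> real) \<Rightarrow> bool" where
  "small_scale_limit M X t N Y \<longleftrightarrow> stochastic_process N Y \<and>
     (\<exists>a. (\<forall>\<^sub>F u in at_right 0. a u > 0) \<and> (a \<longlongrightarrow> 0) (at_right 0) \<and>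
        fdd_converges M (scaled_increment X t a) (at_right 0) N Y)"

definition slowly_varying_at_zero :: "(real \<Rightarrow> real) \<Rightarrow> bool" where
  "slowly_varying_at_zero L \<longleftrightarrow>
     L \<in> borel_measurable (restrict_space borel {0<..}) \<and> (\<forall>u>0. L u \<ge> 0) \<and>
     (\<exists>\<delta>>0. \<forall>u. 0 < u \<and> u < \<delta> \<longrightarrow> L u > 0) \<and>
     (\<forall>c>0. ((\<lambda>u. L (c * u) / L u) \<longlongrightarrow> 1) (at_right 0))"

end

theory Submission
  imports Defs
begin

text \<open>Let \<open>g h = 1 + (1 + h) powr (2 * \<gamma>) - 2 * l h\<close>. The form of the covariance gives
\<open>E (X s - X s')\<^sup>2 = \<sigma>\<^sup>2 * s powr (2 * \<gamma>) * g ((s' - s) / s)\<close> for \<open>0 < s \<le> s'\<close>, so the whole small scale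
behaviour of \<open>X\<close>, at every point, is the behaviour of the one function \<open>g\<close> at zero. The slowly varying
function is forced by the required form of \<open>l\<close>: \<open>u powr \<kappa> * L u = sqrt (g u)\<close>. What has to be shown is that \<open>g\<close> is
regularly varying at zero with index \<open>2 * \<kappa>\<close> in \<open>(0, 2]\<close>, and that the limit is a fractional Brownian motion.

The first task is to extract pointwise information from weak convergence in the Skorohod space, where
evaluation at a time is not continuous. Time averages \<open>\<integral>\<^sub>0\<^sup>\<epsilon> \<psi> (x (\<tau>\<^sub>1 + r), \<dots>, x (\<tau>\<^sub>n + r)) dr\<close>
are continuous, because Skorohod convergence implies convergence off the countable set of jump times.
They show that the scaled increments have small variance at most times near zero
(time averages of a characteristic function tend to one). An arbitrary increment is a difference of two
others whose variances are, by the homogeneity of the covariance, values of the same variance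
function at two other times, and a measure argument of Steinhaus type picks both times outside the
exceptional set (\<open>V_small\<close>). Hence the scaled increments are equicontinuous in mean square, uniformly for
small scales (\<open>D_small\<close>), time averages may be replaced by values, and all finite-dimensional
distributions converge, with no exceptional times (\<open>coord_lipschitz_convergence\<close>, \<open>fdd_convergence\<close>).

Since the scaled increments are centered Gaussian, so is \<open>Y\<close>, and second moments converge
(\<open>centered_normal_limit\<close>). At base point 1 this says that \<open>g (r * h) / g h\<close> tends to a limit \<open>w r\<close> for every
\<open>r > 0\<close>. The limit is multiplicative and locally bounded, hence a power \<open>r powr (2 * \<kappa>)\<close>
(\<open>regular_variation\<close>). The exponent is positive because \<open>Y\<close> is continuous in mean square at zero and at most
2 because \<open>Y\<close> has stationary increments, which bounds \<open>E (Y 2)\<^sup>2\<close> by \<open>4 * E (Y 1)\<^sup>2\<close>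
(\<open>power_law\<close>). The asymptotics of the normalization follow by comparing \<open>a t u\<close> with
\<open>sqrt (g (u / t))\<close>.

Stationary increments with \<open>E (Y r)\<^sup>2 = c\<^sup>2 * r powr (2 * \<kappa>)\<close> determine the covariance of fractional Brownian motion.
Its paths can be taken continuous since \<open>Y\<close> has left and right limits and, by Gaussian moment bounds
and Borel-Cantelli, its increments along the dyadic grids tend to zero. If \<open>\<kappa> = 1\<close>, then \<open>Y r - r * Y 1\<close> has
variance zero. Finally, the ratio of two normalizations that lead to limits converges, by the
Gaussian form of the characteristic functions, which gives uniqueness (\<open>small_scale_limit_unique\<close>).\<close>

section \<open>Skorohod convergence at continuity points\<close>

text \<open>One-sided limits exist everywhere, so for each \<open>n\<close> the points where the oscillation is at least
\<open>1 / (n + 1)\<close> cannot accumulate at a positive time.\<close>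

lemma cadlag_discontinuities_countable:
  assumes x: "x \<in> cadlag"
  shows "countable {s. 0 < s \<and> \<not> isCont x s}"
proof -
  define J where "J n = {s::real. 0 < s \<and>
    \<not> (\<exists>d>0. \<forall>a b. \<bar>a - s\<bar> < d \<longrightarrow> \<bar>b - s\<bar> < d \<longrightarrow> \<bar>x a - x b\<bar> < 1 / real (Suc n))}" for n
  have "J n sparse_in {0<..}" for n
    unfolding sparse_in_eventually_iff[OF open_greaterThan]
  proof
    fix p :: real assume "p \<in> {0<..}"
    then have p: "0 < p" by simp
    define e where "e = 1 / real (Suc n)"
    have e: "0 < e" by (simp add: e_def)
    have close: "\<bar>u - v\<bar> < e" if "dist u l < e / 2" "dist v l < e / 2" for u v l :: real
      using that unfolding dist_real_def by linarith
    obtain l where "(x \<longlongrightarrow> l) (at_left p)" using x p by (auto simp: cadlag_def)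
    then have "\<forall>\<^sub>F s in at_left p. dist (x s) l < e / 2"
      by (rule tendstoD) (use e in simp)
    then obtain b where b: "b < p" "\<And>s. b < s \<Longrightarrow> s < p \<Longrightarrow> dist (x s) l < e / 2"
      by (auto simp: eventually_at_left_field)
    have "s \<notin> J n" if "b < s" "s < p" for s
    proof -
      have "\<forall>u v. \<bar>u - s\<bar> < min (s - b) (p - s) \<longrightarrow> \<bar>v - s\<bar> < min (s - b) (p - s) \<longrightarrow> \<bar>x u - x v\<bar> < e"
        by (intro allI impI close[where l = l] b(2)) linarith+
      moreover have "0 < min (s - b) (p - s)" using that by simp
      ultimately show ?thesis unfolding J_def e_def by blast
    qed
    then have L: "\<forall>\<^sub>F s in at_left p. s \<notin> J n" using b(1) by (auto simp: eventually_at_left_field)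
    have "\<forall>\<^sub>F s in at_right p. dist (x s) (x p) < e / 2"
      by (rule tendstoD[OF cadlag_right[OF x]]) (use e p in simp_all)
    then obtain c where c: "p < c" "\<And>s. p < s \<Longrightarrow> s < c \<Longrightarrow> dist (x s) (x p) < e / 2"
      by (auto simp: eventually_at_right_field)
    have "s \<notin> J n" if "p < s" "s < c" for s
    proof -
      have "\<forall>u v. \<bar>u - s\<bar> < min (s - p) (c - s) \<longrightarrow> \<bar>v - s\<bar> < min (s - p) (c - s) \<longrightarrow> \<bar>x u - x v\<bar> < e"
        by (intro allI impI close[where l = "x p"] c(2)) linarith+
      moreover have "0 < min (s - p) (c - s)" using that by simp
      ultimately show ?thesis unfolding J_def e_def by blast
    qed
    then have "\<forall>\<^sub>F s in at_right p. s \<notin> J n" using c(1) by (auto simp: eventually_at_right_field)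
    with L show "\<forall>\<^sub>F s in at p. s \<notin> J n" by (simp add: eventually_at_split)
  qed
  then have "countable ({0<..} \<inter> J n)" for n by (intro sparse_imp_countable open_greaterThan)
  then have "countable (\<Union>n. {0<..} \<inter> J n)" by blast
  moreover have "{s. 0 < s \<and> \<not> isCont x s} \<subseteq> (\<Union>n. {0<..} \<inter> J n)"
  proof (rule subsetI, rule ccontr)
    fix s assume s: "s \<in> {s. 0 < s \<and> \<not> isCont x s}" and "s \<notin> (\<Union>n. {0<..} \<inter> J n)"
    then have J: "\<exists>d>0. \<forall>a b. \<bar>a - s\<bar> < d \<longrightarrow> \<bar>b - s\<bar> < d \<longrightarrow> \<bar>x a - x b\<bar> < 1 / real (Suc n)" for n
      by (auto simp: J_def)
    have "isCont x s"
      unfolding continuous_at_eps_delta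
    proof (intro allI impI)
      fix e :: real assume "0 < e"
      then obtain n where n: "1 / real (Suc n) < e" using nat_approx_posE by auto
      obtain d where d: "d > 0" "\<And>a b. \<bar>a - s\<bar> < d \<Longrightarrow> \<bar>b - s\<bar> < d \<Longrightarrow> \<bar>x a - x b\<bar> < 1 / real (Suc n)"
        using J by blast
      have "dist (x v) (x s) < e" if "dist v s < d" for v
        using d(2)[of v s] that d(1) n unfolding dist_real_def by simp
      then show "\<exists>d>0. \<forall>x'. dist x' s < d \<longrightarrow> dist (x x') (x s) < e" using d(1) by blast
    qed
    then show False using s by simp
  qed
  ultimately show ?thesis by (rule countable_subset[rotated])
qed

text \<open>The time changes that realize the Skorohod distance move \<open>s\<close> by a factor close to one, and continuity
of the limit at \<open>s\<close> absorbs this displacement.\<close>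

lemma skorohod_convergence_at_continuity_point:
  assumes x: "x \<in> cadlag" and y: "\<And>n::nat. y n \<in> cadlag"
    and d: "(\<lambda>n. skorohod_dist (y n) x) \<longlonglongrightarrow> 0" and s: "0 < s" "isCont x s"
  shows "(\<lambda>n. y n s) \<longlonglongrightarrow> x s"
proof (rule LIMSEQ_I)
  fix r :: real assume r: "0 < r"
  obtain c where c: "c > 0" "\<And>v. dist v s < c \<Longrightarrow> dist (x v) (x s) < r / 2"
    using s(2) r unfolding continuous_at_eps_delta by (meson half_gt_zero)
  have "((\<lambda>e. exp e * s) \<longlongrightarrow> exp 0 * s) (at_right (0::real))" by (intro tendsto_intros)
  then have "\<forall>\<^sub>F e in at_right (0::real). exp e * s < s + min c 1"
    using s c(1) by (intro order_tendstoD) auto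
  moreover have "((\<lambda>e. exp (- e) * s) \<longlongrightarrow> exp (- 0) * s) (at_right (0::real))"
    by (intro tendsto_intros)
  then have "\<forall>\<^sub>F e in at_right (0::real). s - c < exp (- e) * s"
    using s c(1) by (intro order_tendstoD) auto
  moreover have "\<forall>\<^sub>F e in at_right (0::real). 0 < e \<and> e \<le> min 1 (r / 2)"
    using eventually_at_right_real[of 0 "min 1 (r / 2)"] r by (auto elim!: eventually_mono)
  ultimately have "\<forall>\<^sub>F e in at_right (0::real).
      exp e * s < s + min c 1 \<and> s - c < exp (- e) * s \<and> 0 < e \<and> e \<le> min 1 (r / 2)"
    by eventually_elim simp
  then obtain e where e: "exp e * s < s + min c 1" "s - c < exp (- e) * s" "0 < e" "e \<le> min 1 (r / 2)"
    using eventually_happens'[OF trivial_limit_at_right_real] by blast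
  have "\<forall>\<^sub>F n in sequentially. skorohod_dist (y n) x < e * exp (- (s + 1 + 1))"
    by (rule order_tendstoD(2)[OF d]) (use e in simp)
  then obtain n0 where n0: "\<And>n. n \<ge> n0 \<Longrightarrow> skorohod_dist (y n) x < e * exp (- (s + 1 + 1))"
    by (auto simp: eventually_sequentially)
  show "\<exists>n0. \<forall>n\<ge>n0. norm (y n s - x s) < r"
  proof (intro exI allI impI)
    fix n assume "n \<ge> n0"
    have e1: "e \<le> 1" and s1: "0 \<le> s + 1" using e s by auto
    obtain \<phi> where l: "\<phi> \<in> time_changes" "Sup (log_slopes \<phi>) < e"
      "\<And>v. 0 \<le> v \<Longrightarrow> v \<le> s + 1 \<Longrightarrow> \<phi> v \<le> s + 1 \<Longrightarrow> \<bar>y n v - x (\<phi> v)\<bar> < e"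
      using skorohod_dist_close[OF y x e(3) e1 s1 n0[OF \<open>n \<ge> n0\<close>]] by blast
    have "exp (- e) * s \<le> exp (- Sup (log_slopes \<phi>)) * s" "exp (Sup (log_slopes \<phi>)) * s \<le> exp e * s"
      using l(2) s by (auto intro!: mult_right_mono)
    moreover have "exp (- Sup (log_slopes \<phi>)) * s \<le> \<phi> s" "\<phi> s \<le> exp (Sup (log_slopes \<phi>)) * s"
      using time_change_slope_bounds[OF l(1), of 0 s] time_change_0[OF l(1)] s by auto
    ultimately have "\<bar>\<phi> s - s\<bar> < c" "\<phi> s \<le> s + 1" using e(1,2) by linarith+
    then have "\<bar>y n s - x (\<phi> s)\<bar> < e" "dist (x (\<phi> s)) (x s) < r / 2"
      using l(3)[of s] s c(2)[of "\<phi> s"] by (auto simp: dist_real_def)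
    then show "norm (y n s - x s) < r" using e(4) unfolding dist_real_def real_norm_def by linarith
  qed
qed

section \<open>Functionals of finitely many coordinates\<close>

text \<open>Functionals on paths are functions of the whole path. The Lipschitz bound in the coordinates of \<open>S\<close>
makes them depend on these coordinates only, which avoids restricting the paths to \<open>S\<close>.\<close>

definition coord_lipschitz :: "real set \<Rightarrow> real \<Rightarrow> ((real \<Rightarrow> real) \<Rightarrow> real) \<Rightarrow> bool" where
  "coord_lipschitz S K \<psi> \<longleftrightarrow> (\<forall>x y. \<bar>\<psi> x - \<psi> y\<bar> \<le> K * (\<Sum>i\<in>S. \<bar>x i - y i\<bar>))"

lemma coord_lipschitzD: "coord_lipschitz S K \<psi> \<Longrightarrow> \<bar>\<psi> x - \<psi> y\<bar> \<le> K * (\<Sum>i\<in>S. \<bar>x i - y i\<bar>)"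
  by (simp add: coord_lipschitz_def)

lemma coord_lipschitz_cong:
  assumes "coord_lipschitz S K \<psi>" "\<And>i. i \<in> S \<Longrightarrow> x i = y i"
  shows "\<psi> x = \<psi> y"
  using coord_lipschitzD[OF assms(1), of x y] assms(2) by simp

lemma coord_lipschitz_tendsto:
  assumes \<psi>: "coord_lipschitz S K \<psi>" and lim: "\<And>i. i \<in> S \<Longrightarrow> ((\<lambda>n. x n i) \<longlongrightarrow> y i) F"
  shows "((\<lambda>n. \<psi> (x n)) \<longlongrightarrow> \<psi> y) F"
proof -
  have "((\<lambda>n. K * (\<Sum>i\<in>S. \<bar>x n i - y i\<bar>)) \<longlongrightarrow> K * (\<Sum>i\<in>S. \<bar>y i - y i\<bar>)) F"
    by (intro tendsto_intros lim)
  then have "((\<lambda>n. K * (\<Sum>i\<in>S. \<bar>x n i - y i\<bar>)) \<longlongrightarrow> 0) F" by simp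
  then have "((\<lambda>n. \<psi> (x n) - \<psi> y) \<longlongrightarrow> 0) F"
    by (rule Lim_null_comparison[rotated]) (simp add: coord_lipschitzD[OF \<psi>])
  then show ?thesis by (simp add: LIM_zero_iff)
qed

lemma continuous_map_coord_lipschitz:
  assumes S: "finite S" and \<psi>: "coord_lipschitz S K \<psi>"
  shows "continuous_map (product_topology (\<lambda>_. euclideanreal) S) euclideanreal \<psi>"
proof -
  let ?T = "product_topology (\<lambda>_::real. euclideanreal) S"
  show ?thesis
    unfolding continuous_map_def
  proof (intro conjI allI impI)
    fix U :: "real set" assume "openin euclideanreal U"
    then have U: "open U" by simp
    show "openin ?T {x \<in> topspace ?T. \<psi> x \<in> U}"
    proof (subst openin_subopen, intro ballI)
      fix x assume x: "x \<in> {x \<in> topspace ?T. \<psi> x \<in> U}"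
      obtain e where e: "e > 0" "\<And>v. dist v (\<psi> x) < e \<Longrightarrow> v \<in> U"
        using U x by (auto simp: open_dist)
      have "continuous_map ?T euclideanreal (\<lambda>y. K * (\<Sum>i\<in>S. \<bar>y i - x i\<bar>))"
        by (intro continuous_map_real_mult continuous_map_sum S continuous_map_real_abs
            continuous_map_diff continuous_map_product_projection) auto
      then have "openin ?T {y \<in> topspace ?T. K * (\<Sum>i\<in>S. \<bar>y i - x i\<bar>) \<in> {..<e}}"
        by (rule openin_continuous_map_preimage) simp
      moreover have "x \<in> {y \<in> topspace ?T. K * (\<Sum>i\<in>S. \<bar>y i - x i\<bar>) \<in> {..<e}}"
        using x e by simp
      moreover have "{y \<in> topspace ?T. K * (\<Sum>i\<in>S. \<bar>y i - x i\<bar>) \<in> {..<e}} \<subseteq> {x \<in> topspace ?T. \<psi> x \<in> U}"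
      proof safe
        fix y assume "K * (\<Sum>i\<in>S. \<bar>y i - x i\<bar>) < e"
        then have "dist (\<psi> y) (\<psi> x) < e"
          using coord_lipschitzD[OF \<psi>, of y x] by (simp add: dist_real_def)
        then show "\<psi> y \<in> U" by (rule e(2))
      qed
      ultimately show "\<exists>T. openin ?T T \<and> x \<in> T \<and> T \<subseteq> {x \<in> topspace ?T. \<psi> x \<in> U}" by blast
    qed
  qed simp
qed

lemma continuous_map_coords_tendsto:
  assumes f: "continuous_map (product_topology (\<lambda>_. euclideanreal) S) euclideanreal f"
    and ext: "\<And>n. x n \<in> extensional S" "y \<in> extensional S"
    and lim: "\<And>i. i \<in> S \<Longrightarrow> ((\<lambda>n. x n i) \<longlongrightarrow> y i) F"
  shows "((\<lambda>n. f (x n)) \<longlongrightarrow> f y) F"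
proof -
  have "limitin (product_topology (\<lambda>_. euclideanreal) S) x y F"
    using ext lim by (simp add: limitin_componentwise PiE_def)
  from continuous_map_limit[OF f this] show ?thesis by (simp add: comp_def)
qed

text \<open>Rounding each coordinate to a multiple of \<open>1 / (n + 1)\<close> leaves countably many values for the
argument of \<open>f\<close>, so the rounded composition is measurable whatever \<open>f\<close> is; continuity gives the limit.\<close>

lemma measurable_continuous_map_coords:
  assumes S: "finite S"
    and f: "continuous_map (product_topology (\<lambda>_. euclideanreal) S) euclideanreal f"
    and Z: "\<And>i. i \<in> S \<Longrightarrow> Z i \<in> borel_measurable M"
  shows "(\<lambda>\<omega>. f (\<lambda>i\<in>S. Z i \<omega>)) \<in> borel_measurable M"
proof (rule borel_measurable_LIMSEQ_real)
  let ?q = "\<lambda>n \<omega>. (\<lambda>i\<in>S. \<lfloor>real (Suc n) * Z i \<omega>\<rfloor>)"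
  let ?E = "PiE S (\<lambda>_. UNIV :: int set)"
  fix n
  have q: "?q n \<in> measurable M (count_space ?E)"
  proof (subst measurable_count_space_eq_countable)
    show "countable ?E" by (intro countable_PiE S) auto
    show "?q n \<in> space M \<rightarrow> ?E \<and> (\<forall>a\<in>?E. ?q n -` {a} \<inter> space M \<in> sets M)"
    proof (intro conjI ballI)
      fix k assume k: "k \<in> ?E"
      have eq: "?q n -` {k} \<inter> space M = {\<omega> \<in> space M. \<forall>i\<in>S. \<lfloor>real (Suc n) * Z i \<omega>\<rfloor> = k i}"
        using k by (auto simp: PiE_def extensional_def fun_eq_iff restrict_def)
      show "?q n -` {k} \<inter> space M \<in> sets M"
        unfolding eq
      proof (rule sets.sets_Collect_finite_All[OF _ S])
        fix i assume "i \<in> S"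
        note [measurable] = Z[OF this]
        show "{\<omega> \<in> space M. \<lfloor>real (Suc n) * Z i \<omega>\<rfloor> = k i} \<in> sets M" by measurable
      qed
    qed auto
  qed
  show "(\<lambda>\<omega>. f (\<lambda>i\<in>S. real_of_int (?q n \<omega> i) / real (Suc n))) \<in> borel_measurable M"
    by (rule measurable_compose[OF q]) simp
next
  fix \<omega>
  show "(\<lambda>n. f (\<lambda>i\<in>S. real_of_int ((\<lambda>i\<in>S. \<lfloor>real (Suc n) * Z i \<omega>\<rfloor>) i) / real (Suc n)))
      \<longlonglongrightarrow> f (\<lambda>i\<in>S. Z i \<omega>)"
  proof (rule continuous_map_coords_tendsto[OF f])
    fix i assume i: "i \<in> S"
    have "(\<lambda>n. real_of_int \<lfloor>real (Suc n) * Z i \<omega>\<rfloor> / real (Suc n)) \<longlonglongrightarrow> Z i \<omega>"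
    proof (rule tendsto_sandwich[OF always_eventually always_eventually])
      show "\<forall>n. Z i \<omega> - inverse (real (Suc n)) \<le> real_of_int \<lfloor>real (Suc n) * Z i \<omega>\<rfloor> / real (Suc n)"
      proof
        fix n
        have "real (Suc n) * Z i \<omega> - 1 \<le> real_of_int \<lfloor>real (Suc n) * Z i \<omega>\<rfloor>" by linarith
        then have "(real (Suc n) * Z i \<omega> - 1) / real (Suc n) \<le> real_of_int \<lfloor>real (Suc n) * Z i \<omega>\<rfloor> / real (Suc n)"
          by (intro divide_right_mono) auto
        then show "Z i \<omega> - inverse (real (Suc n)) \<le> real_of_int \<lfloor>real (Suc n) * Z i \<omega>\<rfloor> / real (Suc n)"
          by (simp add: diff_divide_distrib inverse_eq_divide)
      qed
      show "\<forall>n. real_of_int \<lfloor>real (Suc n) * Z i \<omega>\<rfloor> / real (Suc n) \<le> Z i \<omega>"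
      proof
        fix n
        have "real_of_int \<lfloor>real (Suc n) * Z i \<omega>\<rfloor> \<le> Z i \<omega> * real (Suc n)"
          by (metis of_int_floor_le mult.commute)
        then show "real_of_int \<lfloor>real (Suc n) * Z i \<omega>\<rfloor> / real (Suc n) \<le> Z i \<omega>"
          by (subst pos_divide_le_eq) simp_all
      qed
      show "(\<lambda>n. Z i \<omega> - inverse (real (Suc n))) \<longlonglongrightarrow> Z i \<omega>"
        using tendsto_diff[OF tendsto_const[of "Z i \<omega>"] LIMSEQ_inverse_real_of_nat] by simp
    qed simp
    then show "(\<lambda>n. (\<lambda>i\<in>S. real_of_int ((\<lambda>i\<in>S. \<lfloor>real (Suc n) * Z i \<omega>\<rfloor>) i) / real (Suc n)) i)
      \<longlonglongrightarrow> (\<lambda>i\<in>S. Z i \<omega>) i" using i by simp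
  qed auto
qed

lemma measurable_coord_lipschitz:
  assumes S: "finite S" and \<psi>: "coord_lipschitz S K \<psi>"
    and Z: "\<And>i. i \<in> S \<Longrightarrow> Z i \<in> borel_measurable M"
  shows "(\<lambda>\<omega>. \<psi> (\<lambda>i. Z i \<omega>)) \<in> borel_measurable M"
proof -
  have "(\<lambda>\<omega>. \<psi> (\<lambda>i\<in>S. Z i \<omega>)) \<in> borel_measurable M"
    by (rule measurable_continuous_map_coords[OF S continuous_map_coord_lipschitz[OF S \<psi>] Z])
  moreover have "\<psi> (\<lambda>i\<in>S. Z i \<omega>) = \<psi> (\<lambda>i. Z i \<omega>)" for \<omega>
    by (rule coord_lipschitz_cong[OF \<psi>]) simp
  ultimately show ?thesis by simp
qed

text \<open>The half of the portmanteau theorem that reduces continuous functions to Lipschitz ones. A bounded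
continuous \<open>f\<close> is the increasing limit of its infimal convolutions
\<open>inf\<^sub>y (f y + k * \<Sum>i. \<bar>x i - y i\<bar>)\<close>, which are Lipschitz.\<close>

lemma coord_lipschitz_lower_expectation:
  assumes S: "finite S"
    and M: "prob_space M" and N: "prob_space N"
    and Z: "\<forall>\<^sub>F u in F. \<forall>i\<in>S. Z u i \<in> borel_measurable M" and Y: "\<And>i. i \<in> S \<Longrightarrow> Y i \<in> borel_measurable N"
    and conv: "\<And>\<psi> K B. coord_lipschitz S K \<psi> \<Longrightarrow> (\<And>x. \<bar>\<psi> x\<bar> \<le> B) \<Longrightarrow>
      ((\<lambda>u. LINT \<omega>|M. \<psi> (\<lambda>i. Z u i \<omega>)) \<longlongrightarrow> (LINT \<omega>|N. \<psi> (\<lambda>i. Y i \<omega>))) F"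
    and f: "continuous_map (product_topology (\<lambda>_. euclideanreal) S) euclideanreal f"
    and B: "\<And>x. x \<in> extensional S \<Longrightarrow> \<bar>f x\<bar> \<le> B"
    and e: "0 < e"
  shows "\<forall>\<^sub>F u in F. (LINT \<omega>|N. f (\<lambda>i\<in>S. Y i \<omega>)) - e < (LINT \<omega>|M. f (\<lambda>i\<in>S. Z u i \<omega>))"
proof -
  interpret M: prob_space M by fact
  interpret N: prob_space N by fact
  define dst where "dst x y = (\<Sum>i\<in>S. \<bar>x i - y i\<bar>)" for x y :: "real \<Rightarrow> real"
  have dst: "0 \<le> dst x y" "dst x y \<le> dst x z + dst z y" "dst x x = 0" for x y z
    by (auto simp: dst_def sum_nonneg sum.distrib[symmetric] intro!: sum_mono)
  \<comment> \<open>The infimal convolution of \<open>f\<close> with \<open>k\<close> times the distance.\<close>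
  define \<psi> where "\<psi> k x = (INF y\<in>extensional S. f y + real k * dst x y)" for k x
  have ne: "extensional S \<noteq> ({} :: (real \<Rightarrow> real) set)" using restrict_extensional by blast
  have lowb: "- B \<le> f y + real k * dst x y" if "y \<in> extensional S" for k x y
  proof -
    have "0 \<le> real k * dst x y" using dst(1) by simp
    then show ?thesis using B[OF that] by linarith
  qed
  have bdd: "bdd_below ((\<lambda>y. f y + real k * dst x y) ` extensional S)" for k x
    using lowb by (intro bdd_belowI2[where m = "- B"]) auto
  have up: "\<psi> k x \<le> f y + real k * dst x y" if "y \<in> extensional S" for k x y
    unfolding \<psi>_def by (rule cINF_lower[OF bdd that])
  have lowpsi: "- B \<le> \<psi> k x" for k x
    unfolding \<psi>_def by (rule cINF_greatest[OF ne]) (rule lowb)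
  have le_f: "\<psi> k x \<le> f (restrict x S)" for k x
    using up[of "restrict x S" k x] by (simp add: dst_def)
  have \<psi>B: "\<bar>\<psi> k x\<bar> \<le> B" for k x
    using lowpsi[of k x] le_f[of k x] B[of "restrict x S"] by (simp add: abs_le_iff)
  have lip: "coord_lipschitz S (real k) (\<psi> k)" for k
  proof -
    have "\<psi> k x - real k * dst x y \<le> \<psi> k y" for x y
      unfolding \<psi>_def[of k y]
    proof (rule cINF_greatest[OF ne])
      fix z :: "real \<Rightarrow> real" assume z: "z \<in> extensional S"
      have "real k * dst x z \<le> real k * (dst x y + dst y z)"
        by (intro mult_left_mono dst) auto
      then show "\<psi> k x - real k * dst x y \<le> f z + real k * dst y z"
        using up[OF z, of k x] by (simp add: algebra_simps)
    qed
    then have half: "\<psi> k x - \<psi> k y \<le> real k * dst x y" for x y by (simp add: algebra_simps)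
    have "\<bar>\<psi> k x - \<psi> k y\<bar> \<le> real k * dst x y" for x y
    proof -
      have "dst y x = dst x y" by (simp add: dst_def abs_minus_commute)
      then show ?thesis using half[of x y] half[of y x] by (simp add: abs_le_iff)
    qed
    then show ?thesis unfolding coord_lipschitz_def dst_def by blast
  qed
  have lim: "(\<lambda>k. \<psi> k x) \<longlonglongrightarrow> f x" if x: "x \<in> extensional S" for x
  proof -
    have "\<exists>y\<in>extensional S. f y + real k * dst x y < \<psi> k x + inverse (real (Suc k))" for k
    proof -
      have "(INF y\<in>extensional S. f y + real k * dst x y) < \<psi> k x + inverse (real (Suc k))"
        by (simp add: \<psi>_def)
      then show ?thesis by (simp only: cINF_less_iff[OF ne bdd])
    qed
    then obtain y where y: "\<And>k. y k \<in> extensional S"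
      "\<And>k. f (y k) + real k * dst x (y k) < \<psi> k x + inverse (real (Suc k))" by metis
    have xf: "\<psi> k x \<le> f x" for k using up[OF x, of k x] by (simp add: dst)
    have d: "real (Suc k) * dst x (y (Suc k)) \<le> 2 * B + 1" for k
    proof -
      have "inverse (real (Suc (Suc k))) \<le> 1" by (simp add: field_simps)
      then show ?thesis using y(2)[of "Suc k"] xf[of "Suc k"] B[OF x] B[OF y(1)[of "Suc k"]] by (simp add: abs_le_iff)
    qed
    have "(\<lambda>k. dst x (y (Suc k))) \<longlonglongrightarrow> 0"
    proof (rule tendsto_sandwich[OF always_eventually always_eventually tendsto_const])
      show "\<forall>k. dst x (y (Suc k)) \<le> (2 * B + 1) * inverse (real (Suc k))"
        using d by (simp add: field_simps del: of_nat_Suc)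
      show "(\<lambda>k. (2 * B + 1) * inverse (real (Suc k))) \<longlonglongrightarrow> 0"
        using tendsto_mult_right_zero[OF LIMSEQ_inverse_real_of_nat] .
    qed (simp add: dst)
    note dlim = this
    have "(\<lambda>k. y (Suc k) i) \<longlonglongrightarrow> x i" if i: "i \<in> S" for i
    proof -
      have "\<bar>x i - y (Suc k) i\<bar> \<le> dst x (y (Suc k))" for k
        unfolding dst_def by (rule member_le_sum[OF i _ S]) simp
      then have "\<forall>k. norm (y (Suc k) i - x i) \<le> dst x (y (Suc k))" by (simp add: abs_minus_commute)
      from Lim_null_comparison[OF always_eventually[OF this] dlim] show ?thesis by (rule LIM_zero_cancel)
    qed
    then have "(\<lambda>k. f (y (Suc k))) \<longlonglongrightarrow> f x"
      by (intro continuous_map_coords_tendsto[OF f] y x)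
    then have "(\<lambda>k. f (y (Suc k)) - inverse (real (Suc (Suc k)))) \<longlonglongrightarrow> f x - 0"
      by (intro tendsto_diff LIMSEQ_Suc[OF LIMSEQ_inverse_real_of_nat])
    then have low: "(\<lambda>k. f (y (Suc k)) - inverse (real (Suc (Suc k)))) \<longlonglongrightarrow> f x" by simp
    have "(\<lambda>k. \<psi> (Suc k) x) \<longlonglongrightarrow> f x"
    proof (rule tendsto_sandwich[OF always_eventually always_eventually low tendsto_const])
      show "\<forall>k. f (y (Suc k)) - inverse (real (Suc (Suc k))) \<le> \<psi> (Suc k) x"
      proof
        fix k
        have "0 \<le> real (Suc k) * dst x (y (Suc k))" by (intro mult_nonneg_nonneg dst) auto
        then show "f (y (Suc k)) - inverse (real (Suc (Suc k))) \<le> \<psi> (Suc k) x"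
          using y(2)[of "Suc k"] by linarith
      qed
    qed (simp add: xf)
    then show ?thesis by (rule LIMSEQ_imp_Suc)
  qed
  have fY: "(\<lambda>\<omega>. f (\<lambda>i\<in>S. Y i \<omega>)) \<in> borel_measurable N"
    by (rule measurable_continuous_map_coords[OF S f Y])
  have "(\<lambda>k. LINT \<omega>|N. \<psi> k (\<lambda>i\<in>S. Y i \<omega>)) \<longlonglongrightarrow> (LINT \<omega>|N. f (\<lambda>i\<in>S. Y i \<omega>))"
  proof (rule integral_dominated_convergence[where w = "\<lambda>_. B"])
    show "(\<lambda>\<omega>. \<psi> k (\<lambda>i\<in>S. Y i \<omega>)) \<in> borel_measurable N" for k
      by (rule measurable_continuous_map_coords[OF S continuous_map_coord_lipschitz[OF S lip] Y])
  qed (use fY \<psi>B in \<open>auto intro!: lim\<close>)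
  then have "\<forall>\<^sub>F k in sequentially. (LINT \<omega>|N. f (\<lambda>i\<in>S. Y i \<omega>)) - e < (LINT \<omega>|N. \<psi> k (\<lambda>i\<in>S. Y i \<omega>))"
    by (rule order_tendstoD(1)) (use e in simp)
  then obtain k where k: "(LINT \<omega>|N. f (\<lambda>i\<in>S. Y i \<omega>)) - e < (LINT \<omega>|N. \<psi> k (\<lambda>i\<in>S. Y i \<omega>))"
    by (auto simp: eventually_sequentially)
  have restr: "\<psi> k (\<lambda>i\<in>S. x i) = \<psi> k x" for x by (rule coord_lipschitz_cong[OF lip]) simp
  have "\<forall>\<^sub>F u in F. (LINT \<omega>|N. f (\<lambda>i\<in>S. Y i \<omega>)) - e < (LINT \<omega>|M. \<psi> k (\<lambda>i. Z u i \<omega>))"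
    by (rule order_tendstoD(1)[OF conv[OF lip \<psi>B]]) (use k restr in simp)
  then show ?thesis using Z
  proof eventually_elim
    case (elim u)
    have "(LINT \<omega>|M. \<psi> k (\<lambda>i. Z u i \<omega>)) \<le> (LINT \<omega>|M. f (\<lambda>i\<in>S. Z u i \<omega>))"
    proof (rule integral_mono)
      show "integrable M (\<lambda>\<omega>. \<psi> k (\<lambda>i. Z u i \<omega>))"
        by (rule M.integrable_const_bound[of _ B])
          (use \<psi>B elim in \<open>auto intro!: measurable_coord_lipschitz[OF S lip]\<close>)
      show "integrable M (\<lambda>\<omega>. f (\<lambda>i\<in>S. Z u i \<omega>))"
        by (rule M.integrable_const_bound[of _ B])
          (use B elim in \<open>auto intro!: measurable_continuous_map_coords[OF S f]\<close>)
      show "\<psi> k (\<lambda>i. Z u i \<omega>) \<le> f (\<lambda>i\<in>S. Z u i \<omega>)" for \<omega> by (rule le_f)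
    qed
    then show ?case using elim by linarith
  qed
qed

text \<open>The lower bound for \<open>f\<close> and for \<open>- f\<close> gives convergence.\<close>

lemma weakly_converges_coordsI:
  assumes S: "finite S"
    and M: "prob_space M" and N: "prob_space N"
    and Z: "\<forall>\<^sub>F u in F. \<forall>i\<in>S. Z u i \<in> borel_measurable M" and Y: "\<And>i. i \<in> S \<Longrightarrow> Y i \<in> borel_measurable N"
    and conv: "\<And>\<psi> K B. coord_lipschitz S K \<psi> \<Longrightarrow> (\<And>x. \<bar>\<psi> x\<bar> \<le> B) \<Longrightarrow>
      ((\<lambda>u. LINT \<omega>|M. \<psi> (\<lambda>i. Z u i \<omega>)) \<longlongrightarrow> (LINT \<omega>|N. \<psi> (\<lambda>i. Y i \<omega>))) F"
  shows "weakly_converges (product_topology (\<lambda>_. euclideanreal) S) M (\<lambda>u \<omega>. \<lambda>i\<in>S. Z u i \<omega>) F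
    N (\<lambda>\<omega>. \<lambda>i\<in>S. Y i \<omega>)"
  unfolding weakly_converges_def
proof (intro allI impI, elim conjE)
  let ?T = "product_topology (\<lambda>_::real. euclideanreal) S"
  fix f assume f: "continuous_map ?T euclideanreal f" and bd: "bounded (f ` topspace ?T)"
  obtain B where "\<forall>v\<in>f ` topspace ?T. norm v \<le> B" using bd unfolding bounded_iff by blast
  then have B: "\<And>x. x \<in> extensional S \<Longrightarrow> \<bar>f x\<bar> \<le> B" by (simp add: PiE_def)
  have f': "continuous_map ?T euclideanreal (\<lambda>x. - f x)" using f by simp
  have B': "\<And>x. x \<in> extensional S \<Longrightarrow> \<bar>- f x\<bar> \<le> B" using B by simp
  show "((\<lambda>u. LINT \<omega>|M. f (\<lambda>i\<in>S. Z u i \<omega>)) \<longlongrightarrow> (LINT \<omega>|N. f (\<lambda>i\<in>S. Y i \<omega>))) F"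
  proof (rule tendstoI)
    fix e :: real assume e: "0 < e"
    have "\<forall>\<^sub>F u in F. (LINT \<omega>|N. f (\<lambda>i\<in>S. Y i \<omega>)) - e < (LINT \<omega>|M. f (\<lambda>i\<in>S. Z u i \<omega>))"
      using S M N Z Y conv f B e by (rule coord_lipschitz_lower_expectation)
    moreover have "\<forall>\<^sub>F u in F. (LINT \<omega>|N. - f (\<lambda>i\<in>S. Y i \<omega>)) - e < (LINT \<omega>|M. - f (\<lambda>i\<in>S. Z u i \<omega>))"
      using S M N Z Y conv f' B' e by (rule coord_lipschitz_lower_expectation)
    ultimately show "\<forall>\<^sub>F u in F. dist (LINT \<omega>|M. f (\<lambda>i\<in>S. Z u i \<omega>)) (LINT \<omega>|N. f (\<lambda>i\<in>S. Y i \<omega>)) < e"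
      by eventually_elim (auto simp: dist_real_def abs_less_iff)
  qed
qed

text \<open>Bounded Lipschitz functions decrease to the indicator of a box, so expectations of the
former determine the probabilities of the latter.\<close>

lemma coord_lipschitz_box_approximation:
  fixes a :: "real \<Rightarrow> real"
  assumes S: "finite S"
  defines "h \<equiv> \<lambda>n x. max 0 (1 - real n * (\<Sum>i\<in>S. max 0 (x i - a i)))"
  shows "coord_lipschitz S (real n) (h n)" "\<bar>h n x\<bar> \<le> 1"
    "(\<lambda>n. h n x) \<longlonglongrightarrow> indicator {x. \<forall>i\<in>S. x i \<le> a i} x"
proof -
  show "coord_lipschitz S (real n) (h n)"
    unfolding coord_lipschitz_def
  proof (intro allI)
    fix x y :: "real \<Rightarrow> real"
    let ?s = "\<lambda>x. \<Sum>i\<in>S. max 0 (x i - a i)"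
    have "\<bar>h n x - h n y\<bar> \<le> \<bar>real n * ?s x - real n * ?s y\<bar>" by (auto simp: h_def max_def)
    also have "\<dots> = real n * \<bar>\<Sum>i\<in>S. max 0 (x i - a i) - max 0 (y i - a i)\<bar>"
      by (simp add: right_diff_distrib[symmetric] abs_mult sum_subtractf[symmetric])
    also have "\<dots> \<le> real n * (\<Sum>i\<in>S. \<bar>x i - y i\<bar>)"
      by (intro mult_left_mono order_trans[OF sum_abs] sum_mono) (auto simp: max_def)
    finally show "\<bar>h n x - h n y\<bar> \<le> real n * (\<Sum>i\<in>S. \<bar>x i - y i\<bar>)" .
  qed
  have "0 \<le> real n * (\<Sum>i\<in>S. max 0 (x i - a i))" by (intro mult_nonneg_nonneg sum_nonneg) auto
  then show "\<bar>h n x\<bar> \<le> 1" by (simp add: h_def)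
  show "(\<lambda>n. h n x) \<longlonglongrightarrow> indicator {x. \<forall>i\<in>S. x i \<le> a i} x"
  proof (cases "\<forall>i\<in>S. x i \<le> a i")
    case True
    then have "(\<Sum>i\<in>S. max 0 (x i - a i)) = 0" by (intro sum.neutral) auto
    then show ?thesis using True by (simp add: h_def)
  next
    case False
    then obtain i where i: "i \<in> S" "a i < x i" by force
    have "x i - a i \<le> max 0 (x i - a i)" by simp
    also have "\<dots> \<le> (\<Sum>i\<in>S. max 0 (x i - a i))" by (rule member_le_sum[OF i(1) _ S]) simp
    finally have pos: "0 < (\<Sum>i\<in>S. max 0 (x i - a i))" using i by simp
    obtain n0 :: nat where n0: "1 < real n0 * (\<Sum>i\<in>S. max 0 (x i - a i))" using reals_Archimedean3[OF pos] by blast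
    have "h n x = 0" if "n \<ge> n0" for n
    proof -
      have "real n0 * (\<Sum>i\<in>S. max 0 (x i - a i)) \<le> real n * (\<Sum>i\<in>S. max 0 (x i - a i))"
        using that pos by (intro mult_right_mono) auto
      then show ?thesis using n0 by (simp add: h_def)
    qed
    then have "\<forall>\<^sub>F n in sequentially. 0 = h n x" by (auto simp: eventually_sequentially)
    from Lim_transform_eventually[OF tendsto_const this] show ?thesis using False by simp
  qed
qed

lemma box_probability_eq:
  assumes S: "finite S" and P: "prob_space P" and Q: "prob_space Q"
    and Z: "\<And>i. i \<in> S \<Longrightarrow> Z i \<in> borel_measurable P" and W: "\<And>i. i \<in> S \<Longrightarrow> W i \<in> borel_measurable Q"
    and eq: "\<And>\<psi> K B. coord_lipschitz S K \<psi> \<Longrightarrow> (\<And>x. \<bar>\<psi> x\<bar> \<le> B) \<Longrightarrow>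
      (LINT \<omega>|P. \<psi> (\<lambda>i. Z i \<omega>)) = (LINT \<omega>|Q. \<psi> (\<lambda>i. W i \<omega>))"
  shows "measure P {\<omega>\<in>space P. \<forall>i\<in>S. Z i \<omega> \<le> a i} = measure Q {\<omega>\<in>space Q. \<forall>i\<in>S. W i \<omega> \<le> a i}"
proof -
  define h where "h n x = max 0 (1 - real n * (\<Sum>i\<in>S. max 0 (x i - a i)))" for n :: nat and x
  note h = coord_lipschitz_box_approximation[OF S, where a = a, folded h_def]
  have lim: "(\<lambda>n. LINT \<omega>|R. h n (\<lambda>i. U i \<omega>)) \<longlonglongrightarrow> measure R {\<omega>\<in>space R. \<forall>i\<in>S. U i \<omega> \<le> a i}"
    if R: "prob_space R" and U: "\<And>i. i \<in> S \<Longrightarrow> U i \<in> borel_measurable R" for R :: "'d measure" and U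
  proof -
    interpret R: prob_space R by fact
    have set: "{\<omega>\<in>space R. \<forall>i\<in>S. U i \<omega> \<le> a i} \<in> sets R"
    proof (rule sets.sets_Collect_finite_All[OF _ S])
      fix i assume "i \<in> S"
      note [measurable] = U[OF this]
      show "{\<omega>\<in>space R. U i \<omega> \<le> a i} \<in> sets R" by measurable
    qed
    have "(\<lambda>n. LINT \<omega>|R. h n (\<lambda>i. U i \<omega>)) \<longlonglongrightarrow> (LINT \<omega>|R. indicator {\<omega>\<in>space R. \<forall>i\<in>S. U i \<omega> \<le> a i} \<omega>)"
    proof (rule integral_dominated_convergence[where w = "\<lambda>_. 1"])
      show "(\<lambda>\<omega>. indicat_real {\<omega>\<in>space R. \<forall>i\<in>S. U i \<omega> \<le> a i} \<omega>) \<in> borel_measurable R"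
        using set by simp
      show "(\<lambda>\<omega>. h n (\<lambda>i. U i \<omega>)) \<in> borel_measurable R" for n
        by (rule measurable_coord_lipschitz[OF S h(1) U])
      show "AE \<omega> in R. (\<lambda>n. h n (\<lambda>i. U i \<omega>)) \<longlonglongrightarrow> indicat_real {\<omega>\<in>space R. \<forall>i\<in>S. U i \<omega> \<le> a i} \<omega>"
      proof (rule AE_I2)
        fix \<omega> assume "\<omega> \<in> space R"
        then have "indicat_real {x. \<forall>i\<in>S. x i \<le> a i} (\<lambda>i. U i \<omega>) = indicat_real {\<omega>\<in>space R. \<forall>i\<in>S. U i \<omega> \<le> a i} \<omega>"
          by (simp add: indicator_def)
        then show "(\<lambda>n. h n (\<lambda>i. U i \<omega>)) \<longlonglongrightarrow> indicat_real {\<omega>\<in>space R. \<forall>i\<in>S. U i \<omega> \<le> a i} \<omega>"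
          using h(3)[of "\<lambda>i. U i \<omega>"] by simp
      qed
    qed (use h(2) in auto)
    then show ?thesis using set by simp
  qed
  have "(LINT \<omega>|P. h n (\<lambda>i. Z i \<omega>)) = (LINT \<omega>|Q. h n (\<lambda>i. W i \<omega>))" for n
    by (rule eq[OF h(1), where B = 1]) (rule h(2))
  moreover have "(\<lambda>n. LINT \<omega>|P. h n (\<lambda>i. Z i \<omega>)) \<longlonglongrightarrow> measure P {\<omega>\<in>space P. \<forall>i\<in>S. Z i \<omega> \<le> a i}"
    by (rule lim[OF P]) (rule Z)
  moreover have "(\<lambda>n. LINT \<omega>|Q. h n (\<lambda>i. W i \<omega>)) \<longlonglongrightarrow> measure Q {\<omega>\<in>space Q. \<forall>i\<in>S. W i \<omega> \<le> a i}"
    by (rule lim[OF Q]) (rule W)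
  ultimately show ?thesis by (simp add: LIMSEQ_unique)
qed

text \<open>Boxes that are unbounded below are stable under intersection and generate the product \<open>\<sigma>\<close>-algebra.\<close>

lemma coord_lipschitz_law_unique:
  assumes S: "finite S" and P: "prob_space P" and Q: "prob_space Q"
    and Z: "\<And>i. i \<in> S \<Longrightarrow> Z i \<in> borel_measurable P" and W: "\<And>i. i \<in> S \<Longrightarrow> W i \<in> borel_measurable Q"
    and eq: "\<And>\<psi> K B. coord_lipschitz S K \<psi> \<Longrightarrow> (\<And>x. \<bar>\<psi> x\<bar> \<le> B) \<Longrightarrow>
      (LINT \<omega>|P. \<psi> (\<lambda>i. Z i \<omega>)) = (LINT \<omega>|Q. \<psi> (\<lambda>i. W i \<omega>))"
  shows "distr P (PiM S (\<lambda>_. borel)) (\<lambda>\<omega>. \<lambda>i\<in>S. Z i \<omega>) = distr Q (PiM S (\<lambda>_. borel)) (\<lambda>\<omega>. \<lambda>i\<in>S. W i \<omega>)"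
proof -
  let ?\<Omega> = "PiE S (\<lambda>_. UNIV :: real set)"
  define box where "box a = {x\<in>?\<Omega>. \<forall>i\<in>S. x i \<le> a i}" for a :: "real \<Rightarrow> real"
  have gen: "sets (PiM S (\<lambda>_. borel :: real measure)) = sigma_sets ?\<Omega> (range box)"
  proof -
    let ?E = "range (\<lambda>c::real. {..c})"
    let ?P = "{{f\<in>?\<Omega>. \<forall>i\<in>j. f i \<in> A i} |A j. j \<in> {S} \<and> A \<in> Pi j (\<lambda>_. ?E)}"
    have "sets (PiM S (\<lambda>_. sigma UNIV ?E)) = sets (sigma ?\<Omega> ?P)"
    proof (rule sets_PiM_sigma)
      show "\<exists>T\<subseteq>?E. countable T \<and> UNIV = \<Union>T"
      proof (intro exI conjI)
        show "range (\<lambda>n::nat. {..real n}) \<subseteq> ?E" by auto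
        show "UNIV = \<Union>(range (\<lambda>n::nat. {..real n}))" using real_arch_simple by auto
      qed simp
    qed (use S in auto)
    also have "\<dots> = sigma_sets ?\<Omega> ?P" by (rule sets_measure_of) auto
    also have "?P = range box"
    proof
      show "?P \<subseteq> range box"
      proof safe
        fix A assume A: "A \<in> Pi S (\<lambda>_. ?E)"
        then have "\<forall>i\<in>S. \<exists>c. A i = {..c}" by auto
        then obtain c where "\<And>i. i \<in> S \<Longrightarrow> A i = {..c i}" by metis
        then have "{f\<in>?\<Omega>. \<forall>i\<in>S. f i \<in> A i} = box c" by (auto simp: box_def)
        then show "{f\<in>?\<Omega>. \<forall>i\<in>S. f i \<in> A i} \<in> range box" by simp
      qed
      show "range box \<subseteq> ?P"
      proof safe
        fix c
        have "box c = {f\<in>?\<Omega>. \<forall>i\<in>S. f i \<in> {..c i}}" by (simp add: box_def)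
        moreover have "(\<lambda>i. {..c i}) \<in> Pi S (\<lambda>_. ?E)" by auto
        ultimately show "\<exists>A j. box c = {f\<in>?\<Omega>. \<forall>i\<in>j. f i \<in> A i} \<and> j \<in> {S} \<and> A \<in> Pi j (\<lambda>_. ?E)"
          by (intro exI[of _ "\<lambda>i. {..c i}"] exI[of _ S]) simp
      qed
    qed
    finally show ?thesis by (simp add: borel_eq_atMost[symmetric])
  qed
  have mP: "(\<lambda>\<omega>. \<lambda>i\<in>S. Z i \<omega>) \<in> measurable P (PiM S (\<lambda>_. borel))"
    and mQ: "(\<lambda>\<omega>. \<lambda>i\<in>S. W i \<omega>) \<in> measurable Q (PiM S (\<lambda>_. borel))"
    using Z W by (auto intro!: measurable_restrict)
  have boxm: "box a \<in> sets (PiM S (\<lambda>_. borel))" for a unfolding gen by auto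
  interpret P: prob_space P by fact
  interpret Q: prob_space Q by fact
  have em: "emeasure (distr P (PiM S (\<lambda>_. borel)) (\<lambda>\<omega>. \<lambda>i\<in>S. Z i \<omega>)) (box a) =
      emeasure (distr Q (PiM S (\<lambda>_. borel)) (\<lambda>\<omega>. \<lambda>i\<in>S. W i \<omega>)) (box a)" for a
  proof -
    have "(\<lambda>\<omega>. \<lambda>i\<in>S. Z i \<omega>) -` box a \<inter> space P = {\<omega>\<in>space P. \<forall>i\<in>S. Z i \<omega> \<le> a i}"
      "(\<lambda>\<omega>. \<lambda>i\<in>S. W i \<omega>) -` box a \<inter> space Q = {\<omega>\<in>space Q. \<forall>i\<in>S. W i \<omega> \<le> a i}"
      by (auto simp: box_def)
    moreover have "measure P {\<omega>\<in>space P. \<forall>i\<in>S. Z i \<omega> \<le> a i} = measure Q {\<omega>\<in>space Q. \<forall>i\<in>S. W i \<omega> \<le> a i}"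
      using S P Q Z W eq by (rule box_probability_eq)
    ultimately show ?thesis
      by (simp add: emeasure_distr[OF mP boxm] emeasure_distr[OF mQ boxm] P.emeasure_eq_measure Q.emeasure_eq_measure)
  qed
  show ?thesis
  proof (rule measure_eqI_generator_eq[where E = "range box" and \<Omega> = ?\<Omega> and A = "\<lambda>n. box (\<lambda>_. real n)"])
    have "box a \<inter> box b = box (\<lambda>i. min (a i) (b i))" for a b by (auto simp: box_def)
    then show "Int_stable (range box)" by (auto simp: Int_stable_def)
    show "(\<Union>n. box (\<lambda>_. real n)) = ?\<Omega>"
    proof
      show "?\<Omega> \<subseteq> (\<Union>n. box (\<lambda>_. real n))"
      proof
        fix x assume x: "x \<in> ?\<Omega>"
        obtain b where "\<And>i. i \<in> S \<Longrightarrow> x i \<le> b"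
          using bdd_above_finite[OF finite_imageI[OF S], of x] unfolding bdd_above_def by auto
        moreover obtain n :: nat where "b \<le> real n" using real_arch_simple by blast
        ultimately have "x \<in> box (\<lambda>_. real n)" using x by (auto simp: box_def intro: order_trans)
        then show "x \<in> (\<Union>n. box (\<lambda>_. real n))" by blast
      qed
    qed (auto simp: box_def)
    show "emeasure (distr P (PiM S (\<lambda>_. borel)) (\<lambda>\<omega>. \<lambda>i\<in>S. Z i \<omega>)) (box (\<lambda>_. real n)) \<noteq> \<infinity>" for n
      by (simp add: emeasure_distr[OF mP boxm] P.emeasure_eq_measure)
  qed (use em gen in \<open>auto simp: box_def\<close>)
qed

section \<open>Time averages along a path\<close>

text \<open>The truncation at zero makes the average defined for all arguments; for \<open>S \<subseteq> {0..}\<close> and \<open>r \<ge> 0\<close> all the times \<open>\<tau> + r\<close>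
with \<open>\<tau>\<close> in \<open>S\<close> are nonnegative.\<close>

definition window :: "((real \<Rightarrow> real) \<Rightarrow> real) \<Rightarrow> real \<Rightarrow> (real \<Rightarrow> real) \<Rightarrow> real" where
  "window \<psi> \<epsilon> x = (LINT r:{0..\<epsilon>}|lborel. \<psi> (\<lambda>\<tau>. x (max 0 (\<tau> + r))))"

lemma (in Metric_space) continuous_map_real_sequentially:
  assumes f: "\<And>y x. (\<And>n::nat. y n \<in> M) \<Longrightarrow> x \<in> M \<Longrightarrow> (\<lambda>n. d (y n) x) \<longlonglongrightarrow> 0 \<Longrightarrow> (\<lambda>n. f (y n)) \<longlonglongrightarrow> (f x :: real)"
  shows "continuous_map mtopology euclideanreal f"
  unfolding continuous_map_def
proof (intro conjI allI impI)
  fix U :: "real set" assume "openin euclideanreal U"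
  then have U: "open U" by simp
  show "openin mtopology {x \<in> topspace mtopology. f x \<in> U}"
    unfolding openin_mtopology topspace_mtopology
  proof (intro conjI allI impI)
    fix x assume x: "x \<in> {x \<in> M. f x \<in> U}"
    show "\<exists>r>0. mball x r \<subseteq> {x \<in> M. f x \<in> U}"
    proof (rule ccontr)
      assume no: "\<not> ?thesis"
      have "\<exists>y. y \<in> mball x (inverse (real (Suc n))) \<and> f y \<notin> U" for n
      proof -
        have "\<not> mball x (inverse (real (Suc n))) \<subseteq> {x \<in> M. f x \<in> U}" using no by simp
        then show ?thesis by auto
      qed
      then obtain y where y: "\<And>n. y n \<in> mball x (inverse (real (Suc n)))" "\<And>n. f (y n) \<notin> U"
        by metis
      have "(\<lambda>n. d (y n) x) \<longlonglongrightarrow> 0"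
      proof (rule tendsto_sandwich[OF always_eventually always_eventually tendsto_const LIMSEQ_inverse_real_of_nat])
        show "\<forall>n. d (y n) x \<le> inverse (real (Suc n))" using y(1) by (metis commute in_mball less_imp_le)
      qed simp
      then have "(\<lambda>n. f (y n)) \<longlonglongrightarrow> f x" using y(1) x by (intro f) auto
      then have "\<forall>\<^sub>F n in sequentially. f (y n) \<in> U" using U x by (auto dest: topological_tendstoD)
      then show False using y(2) by (auto simp: eventually_sequentially)
    qed
  qed auto
qed simp

lemma borel_measurable_window_integrand:
  assumes "finite S" "coord_lipschitz S K \<psi>" "x \<in> cadlag"
  shows "(\<lambda>r. \<psi> (\<lambda>\<tau>. x (max 0 (\<tau> + r)))) \<in> borel_measurable borel"
proof (rule measurable_coord_lipschitz[OF assms(1,2)])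
  fix i :: real
  show "(\<lambda>r. x (max 0 (i + r))) \<in> borel_measurable borel"
    by (rule measurable_compose[OF _ cadlag_measurable[OF assms(3)]]) measurable
qed

lemma integrable_indicator_interval: "integrable lborel (\<lambda>r. indicator {a..b} r *\<^sub>R (B::real))" for a b :: real
  by (intro integrable_scaleR_left integrable_real_indicator) (cases "a \<le> b"; simp)+

lemma set_integrable_bounded_interval:
  fixes f :: "real \<Rightarrow> real"
  assumes "f \<in> borel_measurable borel" "\<And>r. \<bar>f r\<bar> \<le> B"
  shows "set_integrable lborel {a..b} f"
  unfolding set_integrable_def
proof (rule Bochner_Integration.integrable_bound)
  show "integrable lborel (\<lambda>r. indicator {a..b} r *\<^sub>R B)" by (rule integrable_indicator_interval)
  show "(\<lambda>r. indicator {a..b} r *\<^sub>R f r) \<in> borel_measurable lborel" using assms(1) by measurable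
  show "AE r in lborel. norm (indicator {a..b} r *\<^sub>R f r) \<le> norm (indicator {a..b} r *\<^sub>R B)"
    using assms(2) by (intro AE_I2) (auto simp: indicator_def intro: order_trans abs_ge_self)
qed

text \<open>For almost every \<open>r\<close> all the times \<open>\<tau> + r\<close> with \<open>\<tau>\<close> in \<open>S\<close> are continuity points of the limit path.
Dominated convergence does the rest.\<close>

lemma continuous_map_window:
  assumes S: "finite S" "S \<subseteq> {0..}" and \<psi>: "coord_lipschitz S K \<psi>" and B: "\<And>x. \<bar>\<psi> x\<bar> \<le> B"
  shows "continuous_map skorohod_topology euclideanreal (window \<psi> \<epsilon>)"
proof -
  interpret Metric_space cadlag skorohod_dist by (rule Metric_space_skorohod)
  show ?thesis
    unfolding skorohod_topology_def
  proof (rule continuous_map_real_sequentially)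
    fix y :: "nat \<Rightarrow> real \<Rightarrow> real" and x
    assume y: "\<And>n. y n \<in> cadlag" and x: "x \<in> cadlag" and d: "(\<lambda>n. skorohod_dist (y n) x) \<longlonglongrightarrow> 0"
    let ?D = "\<Union>i\<in>S. (\<lambda>s. s - i) ` ({s. 0 < s \<and> \<not> isCont x s} \<union> {0})"
    have D: "countable ?D"
      using S cadlag_discontinuities_countable[OF x] by (intro countable_UN countable_image countable_Un) (auto simp: countable_finite)
    have ae: "AE r in lborel. r \<notin> ?D"
      by (rule AE_not_in[OF countable_imp_null_set_lborel[OF D]])
    show "(\<lambda>n. window \<psi> \<epsilon> (y n)) \<longlonglongrightarrow> window \<psi> \<epsilon> x"
      unfolding window_def set_lebesgue_integral_def
    proof (rule integral_dominated_convergence[where w = "\<lambda>r. indicator {0..\<epsilon>} r *\<^sub>R B"])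
      show "AE r in lborel. (\<lambda>n. indicator {0..\<epsilon>} r *\<^sub>R \<psi> (\<lambda>\<tau>. y n (max 0 (\<tau> + r))))
          \<longlonglongrightarrow> indicator {0..\<epsilon>} r *\<^sub>R \<psi> (\<lambda>\<tau>. x (max 0 (\<tau> + r)))"
        using ae
      proof eventually_elim
        case (elim r)
        show ?case
        proof (cases "r \<in> {0..\<epsilon>}")
          case True
          have "(\<lambda>n. \<psi> (\<lambda>\<tau>. y n (max 0 (\<tau> + r)))) \<longlonglongrightarrow> \<psi> (\<lambda>\<tau>. x (max 0 (\<tau> + r)))"
          proof (rule coord_lipschitz_tendsto[OF \<psi>])
            fix i assume i: "i \<in> S"
            then have "0 \<le> i + r" using S True by auto
            moreover have "i + r - i \<notin> (\<lambda>s. s - i) ` ({s. 0 < s \<and> \<not> isCont x s} \<union> {0})"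
              using elim i by (simp only: add_diff_cancel_left') blast
            then have "i + r \<notin> {s. 0 < s \<and> \<not> isCont x s} \<union> {0}" by blast
            ultimately have "0 < i + r" "isCont x (i + r)" by auto
            then show "(\<lambda>n. y n (max 0 (i + r))) \<longlonglongrightarrow> x (max 0 (i + r))"
              using skorohod_convergence_at_continuity_point[OF x y d] by (simp add: max_def)
          qed
          then show ?thesis by (intro tendsto_intros)
        qed simp
      qed
      show "integrable lborel (\<lambda>r. indicator {0..\<epsilon>} r *\<^sub>R B)" by (rule integrable_indicator_interval)
      show "(\<lambda>r. indicator {0..\<epsilon>} r *\<^sub>R \<psi> (\<lambda>\<tau>. x (max 0 (\<tau> + r)))) \<in> borel_measurable lborel"
        using borel_measurable_window_integrand[OF S(1) \<psi> x] by measurable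
      show "(\<lambda>r. indicator {0..\<epsilon>} r *\<^sub>R \<psi> (\<lambda>\<tau>. y n (max 0 (\<tau> + r)))) \<in> borel_measurable lborel" for n
        using borel_measurable_window_integrand[OF S(1) \<psi> y] by measurable
      show "AE r in lborel. norm (indicator {0..\<epsilon>} r *\<^sub>R \<psi> (\<lambda>\<tau>. y n (max 0 (\<tau> + r)))) \<le> indicator {0..\<epsilon>} r *\<^sub>R B" for n
        using B by (intro AE_I2) (auto simp: indicator_def)
    qed
  qed
qed

lemma bounded_window:
  assumes "finite S" "coord_lipschitz S K \<psi>" "\<And>x. \<bar>\<psi> x\<bar> \<le> B" "0 \<le> \<epsilon>"
  shows "bounded (window \<psi> \<epsilon> ` cadlag)"
proof (rule boundedI)
  fix v assume "v \<in> window \<psi> \<epsilon> ` cadlag"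
  then obtain x where x: "x \<in> cadlag" and v: "v = window \<psi> \<epsilon> x" by auto
  have I: "set_integrable lborel {0..\<epsilon>} (\<lambda>r. \<psi> (\<lambda>\<tau>. x (max 0 (\<tau> + r))))"
    by (rule set_integrable_bounded_interval[OF borel_measurable_window_integrand[OF assms(1,2) x] assms(3)])
  have "norm v \<le> (LINT r:{0..\<epsilon>}|lborel. B)"
    unfolding v window_def set_lebesgue_integral_def
    by (rule Bochner_Integration.integral_norm_bound_integral)
      (use I assms(3) integrable_indicator_interval in \<open>auto simp: set_integrable_def simp del: real_scaleR_def split: split_indicator\<close>)
  also have "\<dots> = \<epsilon> * B" using assms(4) by (simp add: set_lebesgue_integral_def)
  finally show "norm v \<le> \<epsilon> * B" .
qed

lemma floor_approximation_at_right:
  assumes "0 \<le> v"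
  shows "filterlim (\<lambda>n. (real_of_int \<lfloor>real (Suc n) * v\<rfloor> + 1) / real (Suc n)) (at_right v) sequentially"
proof -
  let ?q = "\<lambda>n. (real_of_int \<lfloor>real (Suc n) * v\<rfloor> + 1) / real (Suc n)"
  have gt: "v < ?q n" for n
  proof -
    have "v * real (Suc n) < real_of_int \<lfloor>real (Suc n) * v\<rfloor> + 1"
      by (subst mult.commute) linarith
    then show ?thesis by (subst pos_less_divide_eq) simp_all
  qed
  have le: "?q n \<le> v + inverse (real (Suc n))" for n
  proof -
    have "?q n \<le> (real (Suc n) * v + 1) / real (Suc n)"
      by (intro divide_right_mono) (use of_int_floor_le in auto)
    also have "\<dots> = v + inverse (real (Suc n))" by (simp add: field_simps)
    finally show ?thesis .
  qed
  have up: "(\<lambda>n. v + inverse (real (Suc n))) \<longlonglongrightarrow> v"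
    using tendsto_add[OF tendsto_const[of v] LIMSEQ_inverse_real_of_nat] by simp
  have "?q \<longlonglongrightarrow> v"
    by (rule tendsto_sandwich[OF always_eventually always_eventually tendsto_const up])
      (intro allI less_imp_le gt le)+
  then show ?thesis
    unfolding filterlim_at using gt by (auto intro!: always_eventually simp: less_imp_neq[symmetric] dest: less_imp_neq)
qed

definition cadlag_process :: "'a measure \<Rightarrow> (real \<Rightarrow> 'a \<Rightarrow> real) \<Rightarrow> bool" where
  "cadlag_process M Z \<longleftrightarrow> stochastic_process M Z \<and> (\<forall>\<omega>\<in>space M. sample_path Z \<omega> \<in> cadlag)"

lemma cadlag_process_right:
  assumes "cadlag_process M Z" "\<omega> \<in> space M" "0 \<le> t"
  shows "((\<lambda>s. Z s \<omega>) \<longlongrightarrow> Z t \<omega>) (at_right t)"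
proof -
  have "(sample_path Z \<omega> \<longlongrightarrow> sample_path Z \<omega> t) (at_right t)"
    using assms by (intro cadlag_right) (auto simp: cadlag_process_def)
  moreover have "\<forall>\<^sub>F s in at_right t. sample_path Z \<omega> s = Z s \<omega>"
    using eventually_at_right_less[of t] by eventually_elim (use assms in \<open>simp add: sample_path_def\<close>)
  ultimately show ?thesis
    using assms(3) by (subst (asm) tendsto_cong) (auto simp: sample_path_def)
qed

text \<open>By right-continuity the process is the limit of processes that are constant in time on the intervals
of a grid and take there the value at the right end point.\<close>

lemma cadlag_process_jointly_measurable:
  assumes Z: "cadlag_process M Z"
  shows "(\<lambda>(\<omega>, r). Z (max 0 r) \<omega>) \<in> borel_measurable (M \<Otimes>\<^sub>M borel)"
proof (rule borel_measurable_LIMSEQ_real)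
  let ?q = "\<lambda>n p. (real_of_int \<lfloor>real (Suc n) * max 0 (snd p)\<rfloor> + 1) / real (Suc n)"
  fix p assume "p \<in> space (M \<Otimes>\<^sub>M (borel :: real measure))"
  then have "fst p \<in> space M" by (auto simp: space_pair_measure)
  from filterlim_compose[OF cadlag_process_right[OF Z this] floor_approximation_at_right, of "max 0 (snd p)"]
  show "(\<lambda>n. Z (max 0 (?q n p)) (fst p)) \<longlonglongrightarrow> (case p of (\<omega>, r) \<Rightarrow> Z (max 0 r) \<omega>)"
  proof -
    assume "0 \<le> max 0 (snd p) \<Longrightarrow> 0 \<le> max 0 (snd p) \<Longrightarrow> (\<lambda>n. Z (?q n p) (fst p)) \<longlonglongrightarrow> Z (max 0 (snd p)) (fst p)"
    moreover have "max 0 (?q n p) = ?q n p" for n by (intro max_absorb2 divide_nonneg_nonneg) simp_all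
    ultimately show ?thesis by (simp add: case_prod_beta del: of_nat_Suc)
  qed
next
  fix n
  let ?N = "M \<Otimes>\<^sub>M (borel :: real measure)"
  have f: "(\<lambda>p. \<lfloor>real (Suc n) * max 0 (snd p)\<rfloor>) \<in> measurable ?N (count_space UNIV)" by measurable
  have "(\<lambda>p. Z (max 0 ((real_of_int k + 1) / real (Suc n))) (fst p)) \<in> borel_measurable ?N" for k
    by (rule measurable_compose[OF measurable_fst])
      (use Z in \<open>simp add: cadlag_process_def stochastic_process_def\<close>)
  from measurable_compose_countable[OF this f]
  show "(\<lambda>p. Z (max 0 ((real_of_int \<lfloor>real (Suc n) * max 0 (snd p)\<rfloor> + 1) / real (Suc n))) (fst p)) \<in> borel_measurable ?N" .
qed

text \<open>Fubini's theorem turns the expectation of a time average into the time average of expectations, which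
are accessible for a Gaussian process.\<close>

lemma expectation_window:
  assumes S: "finite S" and \<psi>: "coord_lipschitz S K \<psi>" and B: "\<And>x. \<bar>\<psi> x\<bar> \<le> B"
    and Z: "cadlag_process M Z"
  shows "(\<lambda>r. prob_space.expectation M (\<lambda>\<omega>. \<psi> (\<lambda>\<tau>. Z (max 0 (\<tau> + r)) \<omega>))) \<in> borel_measurable borel"
    and "prob_space.expectation M (\<lambda>\<omega>. window \<psi> \<epsilon> (sample_path Z \<omega>)) =
      (LINT r:{0..\<epsilon>}|lborel. prob_space.expectation M (\<lambda>\<omega>. \<psi> (\<lambda>\<tau>. Z (max 0 (\<tau> + r)) \<omega>)))"
proof -
  interpret prob_space M using Z by (simp add: cadlag_process_def stochastic_process_def)
  interpret P: pair_sigma_finite M "lborel :: real measure" ..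
  have m: "(\<lambda>p. \<psi> (\<lambda>\<tau>. Z (max 0 (\<tau> + snd p)) (fst p))) \<in> borel_measurable (M \<Otimes>\<^sub>M borel)"
  proof (rule measurable_coord_lipschitz[OF S \<psi>])
    fix i :: real
    have "(\<lambda>p. (fst p, i + snd p)) \<in> measurable (M \<Otimes>\<^sub>M borel) (M \<Otimes>\<^sub>M borel)"
      by (intro measurable_Pair measurable_fst borel_measurable_add measurable_const measurable_snd) simp
    from measurable_compose[OF this cadlag_process_jointly_measurable[OF Z]]
    show "(\<lambda>p. Z (max 0 (i + snd p)) (fst p)) \<in> borel_measurable (M \<Otimes>\<^sub>M borel)" by simp
  qed
  have m': "(\<lambda>(r, \<omega>). \<psi> (\<lambda>\<tau>. Z (max 0 (\<tau> + r)) \<omega>)) \<in> borel_measurable (borel \<Otimes>\<^sub>M M)"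
    using measurable_compose[OF measurable_pair_swap' m] by (simp add: case_prod_beta)
  show "(\<lambda>r. expectation (\<lambda>\<omega>. \<psi> (\<lambda>\<tau>. Z (max 0 (\<tau> + r)) \<omega>))) \<in> borel_measurable borel"
    by (rule borel_measurable_lebesgue_integral[OF m'])
  have m2: "(\<lambda>p. \<psi> (\<lambda>\<tau>. Z (max 0 (\<tau> + snd p)) (fst p))) \<in> borel_measurable (M \<Otimes>\<^sub>M lborel)"
    using m by (simp cong: measurable_cong_sets sets_pair_measure_cong)
  have I: "integrable (M \<Otimes>\<^sub>M lborel) (\<lambda>(\<omega>, r). indicator {0..\<epsilon>} r *\<^sub>R \<psi> (\<lambda>\<tau>. Z (max 0 (\<tau> + r)) \<omega>))"
  proof (rule Bochner_Integration.integrable_bound)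
    show "integrable (M \<Otimes>\<^sub>M lborel) (\<lambda>p. indicator (space M \<times> {0..\<epsilon>}) p *\<^sub>R B)"
      by (intro integrable_scaleR_left integrable_real_indicator)
        (cases "0 \<le> \<epsilon>"; auto simp: lborel.emeasure_pair_measure_Times emeasure_space_1)+
    show "(\<lambda>(\<omega>, r). indicator {0..\<epsilon>} r *\<^sub>R \<psi> (\<lambda>\<tau>. Z (max 0 (\<tau> + r)) \<omega>)) \<in> borel_measurable (M \<Otimes>\<^sub>M lborel)"
      unfolding case_prod_beta using m2 by measurable
    show "AE p in M \<Otimes>\<^sub>M lborel. norm (case p of (\<omega>, r) \<Rightarrow> indicator {0..\<epsilon>} r *\<^sub>R \<psi> (\<lambda>\<tau>. Z (max 0 (\<tau> + r)) \<omega>))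
        \<le> norm (indicator (space M \<times> {0..\<epsilon>}) p *\<^sub>R B)"
      using order_trans[OF B abs_ge_self] by (intro AE_I2) (auto simp: indicator_def space_pair_measure)
  qed
  have "expectation (\<lambda>\<omega>. window \<psi> \<epsilon> (sample_path Z \<omega>)) =
      expectation (\<lambda>\<omega>. LINT r|lborel. indicator {0..\<epsilon>} r *\<^sub>R \<psi> (\<lambda>\<tau>. Z (max 0 (\<tau> + r)) \<omega>))"
    by (simp add: window_def set_lebesgue_integral_def sample_path_def)
  also have "\<dots> = (LINT r|lborel. expectation (\<lambda>\<omega>. indicator {0..\<epsilon>} r *\<^sub>R \<psi> (\<lambda>\<tau>. Z (max 0 (\<tau> + r)) \<omega>)))"
    by (rule P.Fubini_integral[OF I, symmetric])
  also have "\<dots> = (LINT r:{0..\<epsilon>}|lborel. expectation (\<lambda>\<omega>. \<psi> (\<lambda>\<tau>. Z (max 0 (\<tau> + r)) \<omega>)))"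
    by (simp add: set_lebesgue_integral_def)
  finally show "expectation (\<lambda>\<omega>. window \<psi> \<epsilon> (sample_path Z \<omega>)) =
      (LINT r:{0..\<epsilon>}|lborel. expectation (\<lambda>\<omega>. \<psi> (\<lambda>\<tau>. Z (max 0 (\<tau> + r)) \<omega>)))" .
qed

lemma window_expectation_tendsto:
  assumes S: "finite S" "S \<subseteq> {0..}" and \<psi>: "coord_lipschitz S K \<psi>" and B: "\<And>x. \<bar>\<psi> x\<bar> \<le> B"
    and \<epsilon>: "0 \<le> \<epsilon>"
    and W: "weakly_converges skorohod_topology M (\<lambda>u. sample_path (Z u)) F N (sample_path Y)"
    and Z: "\<forall>\<^sub>F u in F. cadlag_process M (Z u)" and Y: "cadlag_process N Y"
  shows "((\<lambda>u. LINT r:{0..\<epsilon>}|lborel. prob_space.expectation M (\<lambda>\<omega>. \<psi> (\<lambda>\<tau>. Z u (max 0 (\<tau> + r)) \<omega>)))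
    \<longlongrightarrow> (LINT r:{0..\<epsilon>}|lborel. prob_space.expectation N (\<lambda>\<omega>. \<psi> (\<lambda>\<tau>. Y (max 0 (\<tau> + r)) \<omega>)))) F"
proof -
  interpret Metric_space cadlag skorohod_dist by (rule Metric_space_skorohod)
  have "topspace skorohod_topology = cadlag" by (simp add: skorohod_topology_def)
  then have "((\<lambda>u. prob_space.expectation M (\<lambda>\<omega>. window \<psi> \<epsilon> (sample_path (Z u) \<omega>))) \<longlongrightarrow>
      prob_space.expectation N (\<lambda>\<omega>. window \<psi> \<epsilon> (sample_path Y \<omega>))) F"
    using W continuous_map_window[OF S \<psi> B] bounded_window[OF S(1) \<psi> B \<epsilon>]
    unfolding weakly_converges_def by simp
  moreover have "\<forall>\<^sub>F u in F. prob_space.expectation M (\<lambda>\<omega>. window \<psi> \<epsilon> (sample_path (Z u) \<omega>)) =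
      (LINT r:{0..\<epsilon>}|lborel. prob_space.expectation M (\<lambda>\<omega>. \<psi> (\<lambda>\<tau>. Z u (max 0 (\<tau> + r)) \<omega>)))"
    using Z by eventually_elim (rule expectation_window(2)[OF S(1) \<psi> B])
  ultimately show ?thesis
    unfolding expectation_window(2)[OF S(1) \<psi> B Y] by (rule Lim_transform_eventually)
qed

text \<open>Time changes fix zero, so evaluation at zero is continuous in the Skorohod topology.\<close>

lemma evaluation_at_0_expectation_tendsto:
  assumes W: "weakly_converges skorohod_topology M (\<lambda>u. sample_path (Z u)) F N (sample_path Y)"
    and f: "continuous_on UNIV (f :: real \<Rightarrow> real)" and B: "\<And>x. \<bar>f x\<bar> \<le> B"
  shows "((\<lambda>u. prob_space.expectation M (\<lambda>\<omega>. f (Z u 0 \<omega>))) \<longlongrightarrow> prob_space.expectation N (\<lambda>\<omega>. f (Y 0 \<omega>))) F"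
proof -
  interpret Metric_space cadlag skorohod_dist by (rule Metric_space_skorohod)
  have "continuous_map skorohod_topology euclideanreal (\<lambda>x. f (x 0))"
    unfolding skorohod_topology_def
  proof (rule continuous_map_real_sequentially)
    fix y :: "nat \<Rightarrow> real \<Rightarrow> real" and x
    assume y: "\<And>n. y n \<in> cadlag" and x: "x \<in> cadlag" and d: "(\<lambda>n. skorohod_dist (y n) x) \<longlonglongrightarrow> 0"
    have "(\<lambda>n. y n 0) \<longlonglongrightarrow> x 0"
    proof (rule LIMSEQ_I)
      fix r :: real assume r: "0 < r"
      define e where "e = min 1 r"
      have e: "0 < e" "e \<le> 1" "e \<le> r" using r by (auto simp: e_def)
      have "\<forall>\<^sub>F n in sequentially. skorohod_dist (y n) x < e * exp (- (0 + 1))"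
        by (rule order_tendstoD(2)[OF d]) (use e in simp)
      then obtain n0 where n0: "\<And>n. n \<ge> n0 \<Longrightarrow> skorohod_dist (y n) x < e * exp (- (0 + 1))"
        by (auto simp: eventually_sequentially)
      show "\<exists>n0. \<forall>n\<ge>n0. norm (y n 0 - x 0) < r"
      proof (intro exI allI impI)
        fix n assume "n \<ge> n0"
        obtain \<phi> where l: "\<phi> \<in> time_changes"
          "\<And>v. 0 \<le> v \<Longrightarrow> v \<le> 0 \<Longrightarrow> \<phi> v \<le> 0 \<Longrightarrow> \<bar>y n v - x (\<phi> v)\<bar> < e"
          using skorohod_dist_close[OF y x e(1,2) order_refl n0[OF \<open>n \<ge> n0\<close>]] by blast
        then show "norm (y n 0 - x 0) < r"
          using l(2)[of 0] time_change_0[OF l(1)] e(3) by simp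
      qed
    qed
    then show "(\<lambda>n. f (y n 0)) \<longlonglongrightarrow> f (x 0)"
      using f by (auto simp: continuous_on_def intro: tendsto_compose)
  qed
  moreover have "topspace skorohod_topology = cadlag" by (simp add: skorohod_topology_def)
  moreover have "bounded ((\<lambda>x. f (x 0)) ` cadlag)" using B by (intro boundedI[of _ B]) auto
  ultimately show ?thesis
    using W[unfolded weakly_converges_def, THEN spec, of "\<lambda>x. f (x 0)"] by (simp add: sample_path_def)
qed

lemma expectation_right_continuous:
  assumes S: "finite S" "S \<subseteq> {0..}" and \<psi>: "coord_lipschitz S K \<psi>" and B: "\<And>x. \<bar>\<psi> x\<bar> \<le> B"
    and Y: "cadlag_process N Y"
  shows "((\<lambda>r. prob_space.expectation N (\<lambda>\<omega>. \<psi> (\<lambda>\<tau>. Y (max 0 (\<tau> + r)) \<omega>))) \<longlongrightarrow>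
    prob_space.expectation N (\<lambda>\<omega>. \<psi> (\<lambda>\<tau>. Y \<tau> \<omega>))) (at_right 0)"
  unfolding tendsto_at_iff_sequentially comp_def
proof (intro allI impI)
  fix x :: "nat \<Rightarrow> real" assume x: "\<forall>i. x i \<in> {0<..} - {0}" and lim: "x \<longlonglongrightarrow> 0"
  interpret prob_space N using Y by (simp add: cadlag_process_def stochastic_process_def)
  have Ym: "Y t \<in> borel_measurable N" if "0 \<le> t" for t
    using Y that by (simp add: cadlag_process_def stochastic_process_def)
  show "(\<lambda>n. expectation (\<lambda>\<omega>. \<psi> (\<lambda>\<tau>. Y (max 0 (\<tau> + x n)) \<omega>))) \<longlonglongrightarrow> expectation (\<lambda>\<omega>. \<psi> (\<lambda>\<tau>. Y \<tau> \<omega>))"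
  proof (rule integral_dominated_convergence[where w = "\<lambda>_. B"])
    show "(\<lambda>\<omega>. \<psi> (\<lambda>\<tau>. Y \<tau> \<omega>)) \<in> borel_measurable N"
      by (rule measurable_coord_lipschitz[OF S(1) \<psi>]) (use S Ym in auto)
    show "(\<lambda>\<omega>. \<psi> (\<lambda>\<tau>. Y (max 0 (\<tau> + x n)) \<omega>)) \<in> borel_measurable N" for n
      by (rule measurable_coord_lipschitz[OF S(1) \<psi>]) (simp add: Ym)
    show "AE \<omega> in N. (\<lambda>n. \<psi> (\<lambda>\<tau>. Y (max 0 (\<tau> + x n)) \<omega>)) \<longlonglongrightarrow> \<psi> (\<lambda>\<tau>. Y \<tau> \<omega>)"
    proof (rule AE_I2, rule coord_lipschitz_tendsto[OF \<psi>])
      fix \<omega> i assume \<omega>: "\<omega> \<in> space N" and i: "i \<in> S"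
      then have i0: "0 \<le> i" using S by auto
      have "(\<lambda>n. i + x n) \<longlonglongrightarrow> i + 0" by (intro tendsto_intros lim)
      moreover have "i < i + x n" for n using x by (auto dest: spec[of _ n])
      ultimately have "filterlim (\<lambda>n. i + x n) (at_right i) sequentially"
        unfolding filterlim_at by (auto intro!: always_eventually simp: less_imp_neq[symmetric] dest: less_imp_neq)
      from filterlim_compose[OF cadlag_process_right[OF Y \<omega> i0] this]
      have "(\<lambda>n. Y (i + x n) \<omega>) \<longlonglongrightarrow> Y i \<omega>" .
      moreover have "max 0 (i + x n) = i + x n" for n using i0 x by (auto dest: spec[of _ n])
      ultimately show "(\<lambda>n. Y (max 0 (i + x n)) \<omega>) \<longlonglongrightarrow> Y i \<omega>" by simp
    qed
  qed (use B in auto)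
qed

lemma window_average_close:
  fixes f :: "real \<Rightarrow> real"
  assumes f: "f \<in> borel_measurable borel" "\<And>r. \<bar>f r\<bar> \<le> B" and \<epsilon>: "0 \<le> \<epsilon>"
    and close: "\<And>r. 0 \<le> r \<Longrightarrow> r \<le> \<epsilon> \<Longrightarrow> \<bar>f r - c\<bar> \<le> e"
  shows "\<bar>(LINT r:{0..\<epsilon>}|lborel. f r) - \<epsilon> * c\<bar> \<le> \<epsilon> * e"
proof -
  have I: "set_integrable lborel {0..\<epsilon>} f" by (rule set_integrable_bounded_interval[OF f])
  have const: "(LINT r:{0..\<epsilon>}|lborel. (k::real)) = \<epsilon> * k" "set_integrable lborel {0..\<epsilon>} (\<lambda>_. k)" for k
    using \<epsilon> integrable_indicator_interval[of 0 \<epsilon> k]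
    by (auto simp: set_lebesgue_integral_def set_integrable_def)
  have "(LINT r:{0..\<epsilon>}|lborel. f r) \<le> (LINT r:{0..\<epsilon>}|lborel. c + e)"
    by (rule set_integral_mono[OF I const(2)]) (use close in \<open>auto simp: abs_le_iff\<close>, smt (verit) close)
  moreover have "(LINT r:{0..\<epsilon>}|lborel. c - e) \<le> (LINT r:{0..\<epsilon>}|lborel. f r)"
    by (rule set_integral_mono[OF const(2) I]) (smt (verit) close atLeastAtMost_iff)
  ultimately show ?thesis unfolding const(1) by (auto simp: abs_le_iff algebra_simps)
qed

section \<open>Centered normal variables\<close>

text \<open>The normal law of mean 0 and variance \<open>q\<close>, as the image of the standard one under scaling;
for \<open>q = 0\<close> it is the point mass at zero, so that degenerate combinations are covered.\<close>

definition centered_normal :: "'a measure \<Rightarrow> ('a \<Rightarrow> real) \<Rightarrow> real \<Rightarrow> bool" where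
  "centered_normal M Z q \<longleftrightarrow> prob_space M \<and> Z \<in> borel_measurable M \<and> 0 \<le> q \<and>
     distr M borel Z = distr std_normal_distribution borel (\<lambda>x. sqrt q * x)"

lemma prob_space_std_normal: "prob_space std_normal_distribution"
  using real_dist_normal_dist by (simp add: real_distribution_def)

lemma centered_normal_transfer:
  fixes f :: "real \<Rightarrow> 'b :: {banach, second_countable_topology}"
  assumes Z: "centered_normal M Z q" and f: "f \<in> borel_measurable borel"
  shows "integrable M (\<lambda>\<omega>. f (Z \<omega>)) \<longleftrightarrow> integrable std_normal_distribution (\<lambda>x. f (sqrt q * x))"
    and "(LINT \<omega>|M. f (Z \<omega>)) = (LINT x|std_normal_distribution. f (sqrt q * x))"
proof -
  have Zm: "Z \<in> borel_measurable M" and s: "(\<lambda>x. sqrt q * x) \<in> borel_measurable std_normal_distribution"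
    and eq: "distr M borel Z = distr std_normal_distribution borel (\<lambda>x. sqrt q * x)"
    using Z by (auto simp: centered_normal_def)
  show "integrable M (\<lambda>\<omega>. f (Z \<omega>)) \<longleftrightarrow> integrable std_normal_distribution (\<lambda>x. f (sqrt q * x))"
    using integrable_distr_eq[OF Zm f] integrable_distr_eq[OF s f] eq by simp
  show "(LINT \<omega>|M. f (Z \<omega>)) = (LINT x|std_normal_distribution. f (sqrt q * x))"
    using integral_distr[OF Zm f] integral_distr[OF s f] eq by simp
qed

lemma centered_normal_moments:
  assumes Z: "centered_normal M Z q"
  shows "integrable M (\<lambda>\<omega>. Z \<omega> ^ k)"
    and "(LINT \<omega>|M. Z \<omega> ^ (2 * k)) = q ^ k * (fact (2 * k) / (2 ^ k * fact k))"
    and "odd k \<Longrightarrow> (LINT \<omega>|M. Z \<omega> ^ k) = 0"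
proof -
  have q: "0 \<le> q" using Z by (simp add: centered_normal_def)
  show "integrable M (\<lambda>\<omega>. Z \<omega> ^ k)"
    by (subst centered_normal_transfer(1)[OF Z])
      (auto simp: power_mult_distrib integrable_std_normal_distribution_moment)
  show "(LINT \<omega>|M. Z \<omega> ^ (2 * k)) = q ^ k * (fact (2 * k) / (2 ^ k * fact k))"
  proof -
    have "(LINT \<omega>|M. Z \<omega> ^ (2 * k)) = (LINT x|std_normal_distribution. (sqrt q * x) ^ (2 * k))"
      by (rule centered_normal_transfer(2)[OF Z]) simp
    also have "\<dots> = (LINT x|std_normal_distribution. q ^ k * x ^ (2 * k))"
    proof -
      have "(sqrt q * x) ^ (2 * k) = q ^ k * x ^ (2 * k)" for x
        unfolding power_mult_distrib power_mult[of "sqrt q"] using q by simp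
      then show ?thesis by simp
    qed
    also have "\<dots> = q ^ k * (fact (2 * k) / (2 ^ k * fact k))"
      by (subst integral_mult_right_zero) (simp only: std_normal_distribution_even_moments)
    finally show ?thesis .
  qed
  show "(LINT \<omega>|M. Z \<omega> ^ k) = 0" if "odd k"
    by (subst centered_normal_transfer(2)[OF Z])
      (auto simp: power_mult_distrib integral_std_normal_distribution_moment_odd that)
qed

lemma centered_normal_integrable: "centered_normal M Z q \<Longrightarrow> integrable M Z"
  and centered_normal_square_integrable: "centered_normal M Z q \<Longrightarrow> integrable M (\<lambda>\<omega>. (Z \<omega>)\<^sup>2)"
  and centered_normal_mean: "centered_normal M Z q \<Longrightarrow> (LINT \<omega>|M. Z \<omega>) = 0"
  and centered_normal_second_moment: "centered_normal M Z q \<Longrightarrow> (LINT \<omega>|M. (Z \<omega>)\<^sup>2) = q"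
  using centered_normal_moments(1)[of M Z q 1] centered_normal_moments(1)[of M Z q 2]
    centered_normal_moments(3)[of M Z q 1] centered_normal_moments(2)[of M Z q 1]
  by (simp_all add: fact_2)

lemma centered_normal_char:
  assumes Z: "centered_normal M Z q"
  shows "(LINT \<omega>|M. iexp (\<theta> * Z \<omega>)) = complex_of_real (exp (- (\<theta>\<^sup>2 * q / 2)))"
proof -
  have q: "0 \<le> q" using Z by (simp add: centered_normal_def)
  have "(LINT \<omega>|M. iexp (\<theta> * Z \<omega>)) = char std_normal_distribution (\<theta> * sqrt q)"
    unfolding char_def by (subst centered_normal_transfer(2)[OF Z]) (simp_all add: mult.assoc)
  then show ?thesis using q by (simp add: char_std_normal_distribution power_mult_distrib)
qed

lemma integrable_iexp_variable:
  assumes "prob_space M" "Z \<in> borel_measurable M"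
  shows "integrable M (\<lambda>\<omega>. iexp (\<theta> * Z \<omega>))"
proof -
  interpret prob_space M by fact
  show ?thesis
    using assms(2) by (intro integrable_const_bound[of _ 1]) (auto simp del: of_real_mult)
qed

lemma Re_Im_iexp_integral:
  assumes "prob_space M" "Z \<in> borel_measurable M"
  shows "Re (LINT \<omega>|M. iexp (\<theta> * Z \<omega>)) = (LINT \<omega>|M. cos (\<theta> * Z \<omega>))"
    and "Im (LINT \<omega>|M. iexp (\<theta> * Z \<omega>)) = (LINT \<omega>|M. sin (\<theta> * Z \<omega>))"
  using integral_Re[OF integrable_iexp_variable[OF assms, of \<theta>]]
    integral_Im[OF integrable_iexp_variable[OF assms, of \<theta>]]
  by (simp_all add: Re_exp Im_exp)

lemma centered_normal_cos_sin:
  assumes Z: "centered_normal M Z q"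
  shows "(LINT \<omega>|M. cos (\<theta> * Z \<omega>)) = exp (- (\<theta>\<^sup>2 * q / 2))"
    and "(LINT \<omega>|M. sin (\<theta> * Z \<omega>)) = 0"
  using Re_Im_iexp_integral[of M Z \<theta>] centered_normal_char[OF Z, of \<theta>] Z
  unfolding centered_normal_def by (simp_all only: Re_complex_of_real Im_complex_of_real)

text \<open>The two integrals are the real and imaginary parts of the characteristic function, and Levy's uniqueness
theorem identifies the law.\<close>

lemma centered_normalI:
  assumes M: "prob_space M" and Z: "Z \<in> borel_measurable M" and q: "0 \<le> q"
    and cos: "\<And>\<theta>. (LINT \<omega>|M. cos (\<theta> * Z \<omega>)) = exp (- (\<theta>\<^sup>2 * q / 2))"
    and sin: "\<And>\<theta>. (LINT \<omega>|M. sin (\<theta> * Z \<omega>)) = 0"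
  shows "centered_normal M Z q"
proof -
  interpret prob_space M by fact
  interpret std: prob_space std_normal_distribution by (rule prob_space_std_normal)
  have "distr M borel Z = distr std_normal_distribution borel (\<lambda>x. sqrt q * x)"
  proof (rule Levy_uniqueness)
    show "real_distribution (distr M borel Z)" using Z by simp
    show "real_distribution (distr std_normal_distribution borel (\<lambda>x. sqrt q * x))"
      by (rule std.real_distribution_distr) simp
    show "char (distr M borel Z) = char (distr std_normal_distribution borel (\<lambda>x. sqrt q * x))"
    proof
      fix \<theta>
      have "char (distr M borel Z) \<theta> = (LINT \<omega>|M. iexp (\<theta> * Z \<omega>))"
        unfolding char_def using Z by (subst integral_distr) auto
      also have "\<dots> = complex_of_real (exp (- (\<theta>\<^sup>2 * q / 2)))"
        using Re_Im_iexp_integral[OF M Z, of \<theta>] cos sin by (simp add: complex_eq_iff)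
      also have "\<dots> = char std_normal_distribution (\<theta> * sqrt q)"
        using q by (simp add: char_std_normal_distribution power_mult_distrib)
      also have "\<dots> = char (distr std_normal_distribution borel (\<lambda>x. sqrt q * x)) \<theta>"
        unfolding char_def by (subst integral_distr) (auto simp: mult.assoc)
      finally show "char (distr M borel Z) \<theta> = char (distr std_normal_distribution borel (\<lambda>x. sqrt q * x)) \<theta>" .
    qed
  qed
  then show ?thesis using assms by (simp add: centered_normal_def)
qed

lemma distr_std_normal_scaled:
  assumes "0 < s"
  shows "distr std_normal_distribution borel (\<lambda>x. s * x) = density lborel (normal_density 0 s)"
proof -
  interpret prob_space std_normal_distribution by (rule prob_space_std_normal)
  have "distributed std_normal_distribution lborel (\<lambda>x. x) std_normal_density"
    unfolding distributed_def
    by (auto intro!: measure_eqI simp: emeasure_distr emeasure_density)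
  from normal_density_affine[OF this, of s 0] assms
  have "distributed std_normal_distribution lborel (\<lambda>x. s * x) (normal_density 0 s)" by simp
  then have "distr std_normal_distribution lborel (\<lambda>x. s * x) = density lborel (normal_density 0 s)"
    by (rule distributed_distr_eq_density)
  moreover have "distr std_normal_distribution borel (\<lambda>x. s * x) = distr std_normal_distribution lborel (\<lambda>x. s * x)"
    by (rule distr_cong) auto
  ultimately show ?thesis by simp
qed

lemma distr_borel_lborel: "distr M borel Z = distr M lborel Z"
  by (rule distr_cong) auto

lemma centered_normal_pos_distributed:
  assumes Z: "centered_normal M Z q" and q: "0 < q"
  shows "distributed M lborel Z (normal_density 0 (sqrt q))"
proof -
  have "distr M lborel Z = density lborel (normal_density 0 (sqrt q))"
    using Z q distr_std_normal_scaled[of "sqrt q"] by (simp add: centered_normal_def distr_borel_lborel)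
  moreover have "Z \<in> measurable M lborel" using Z by (simp add: centered_normal_def)
  ultimately show ?thesis by (simp add: distributed_def)
qed

lemma centered_normal_0_AE:
  assumes Z: "centered_normal M Z 0"
  shows "AE \<omega> in M. Z \<omega> = 0"
proof -
  have "AE \<omega> in M. (Z \<omega>)\<^sup>2 = 0"
    using integral_nonneg_eq_0_iff_AE[OF centered_normal_square_integrable[OF Z]]
      centered_normal_second_moment[OF Z] by simp
  then show ?thesis by simp
qed

lemma centered_normal_gaussian_variable:
  assumes Z: "centered_normal M Z q"
  shows "gaussian_variable M Z"
proof (cases "q = 0")
  case True
  then show ?thesis using Z centered_normal_0_AE[of M Z]
    unfolding gaussian_variable_def centered_normal_def by blast
next
  case False
  then have "0 < q" using Z by (simp add: centered_normal_def)
  then have "0 < sqrt q" "distributed M lborel Z (normal_density 0 (sqrt q))"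
    using centered_normal_pos_distributed[OF Z] by auto
  then show ?thesis using Z unfolding gaussian_variable_def centered_normal_def by blast
qed

lemma centered_normal_AE_0:
  assumes M: "prob_space M" and Z: "Z \<in> borel_measurable M" "AE \<omega> in M. Z \<omega> = 0"
  shows "centered_normal M Z 0"
proof (rule centered_normalI[OF M Z(1)])
  interpret prob_space M by fact
  fix \<theta>
  have "(LINT \<omega>|M. cos (\<theta> * Z \<omega>)) = (LINT \<omega>|M. 1)"
    using Z by (intro integral_cong_AE) auto
  then show "(LINT \<omega>|M. cos (\<theta> * Z \<omega>)) = exp (- (\<theta>\<^sup>2 * 0 / 2))" by (simp add: prob_space)
  have "(LINT \<omega>|M. sin (\<theta> * Z \<omega>)) = (LINT \<omega>|M. 0)"
    using Z by (intro integral_cong_AE) auto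
  then show "(LINT \<omega>|M. sin (\<theta> * Z \<omega>)) = 0" by simp
qed simp

lemma gaussian_variable_centered_normal:
  assumes M: "prob_space M" and Z: "gaussian_variable M Z" and mean: "(LINT \<omega>|M. Z \<omega>) = 0"
  shows "centered_normal M Z (LINT \<omega>|M. (Z \<omega>)\<^sup>2)"
proof -
  interpret prob_space M by fact
  have Zm: "Z \<in> borel_measurable M" using Z by (simp add: gaussian_variable_def)
  have "\<exists>q. centered_normal M Z q"
    using Z unfolding gaussian_variable_def
  proof (elim conjE disjE exE)
    fix m s assume s: "s > 0" and D: "distributed M lborel Z (normal_density m s)"
    have "m = 0" using normal_distributed_expectation[OF s D] mean by simp
    then have "distr M borel Z = distr std_normal_distribution borel (\<lambda>x. s * x)"
      using distributed_distr_eq_density[OF D] distr_std_normal_scaled[OF s] by (simp add: distr_borel_lborel)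
    then have "centered_normal M Z (s\<^sup>2)" using s Zm M by (simp add: centered_normal_def)
    then show ?thesis ..
  next
    fix m assume m: "AE \<omega> in M. Z \<omega> = m"
    have "(LINT \<omega>|M. Z \<omega>) = (LINT \<omega>|M. m)" using m Zm by (intro integral_cong_AE) auto
    then have "m = 0" using mean by (simp add: prob_space)
    then show ?thesis using centered_normal_AE_0[OF M Zm] m by auto
  qed
  then obtain q where "centered_normal M Z q" ..
  then show ?thesis using centered_normal_second_moment[of M Z q] by simp
qed

lemma gaussian_process_sum:
  assumes X: "centered_gaussian_process M X" and S: "finite S" "S \<subseteq> {0..}"
  shows "gaussian_variable M (\<lambda>\<omega>. \<Sum>t\<in>S. c t * X t \<omega>)"
proof -
  have "\<forall>S c. finite S \<and> S \<subseteq> {0..} \<longrightarrow> gaussian_variable M (\<lambda>\<omega>. \<Sum>t\<in>S. c t * X t \<omega>)"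
    using X unfolding centered_gaussian_process_def by (elim conjE)
  from spec[OF spec[OF this, of S], of c] S show ?thesis by (elim mp) (intro conjI)
qed

text \<open>Terms with the same time are collected, as the definition of a Gaussian process sums over sets of times.
Here the index set is arbitrary, which suits increments sharing a base point.\<close>

lemma gaussian_process_combination:
  assumes X: "centered_gaussian_process M X" and I: "finite I" and s: "\<And>i. i \<in> I \<Longrightarrow> 0 \<le> s i"
  shows "centered_normal M (\<lambda>\<omega>. \<Sum>i\<in>I. b i * X (s i) \<omega>) (LINT \<omega>|M. (\<Sum>i\<in>I. b i * X (s i) \<omega>)\<^sup>2)"
proof (rule gaussian_variable_centered_normal)
  show M: "prob_space M" using X by (simp add: centered_gaussian_process_def stochastic_process_def)
  let ?c = "\<lambda>t. \<Sum>i | i \<in> I \<and> s i = t. b i"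
  have eq: "(\<Sum>i\<in>I. b i * X (s i) \<omega>) = (\<Sum>t\<in>s ` I. ?c t * X t \<omega>)" for \<omega>
  proof -
    have "(\<Sum>i\<in>I. b i * X (s i) \<omega>) = (\<Sum>t\<in>s ` I. \<Sum>i | i \<in> I \<and> s i = t. b i * X (s i) \<omega>)"
      by (rule sum.image_gen[OF I])
    also have "\<dots> = (\<Sum>t\<in>s ` I. ?c t * X t \<omega>)"
      unfolding sum_distrib_right by (intro sum.cong refl) simp
    finally show ?thesis .
  qed
  show "gaussian_variable M (\<lambda>\<omega>. \<Sum>i\<in>I. b i * X (s i) \<omega>)"
    unfolding eq
  proof -
    have "finite (s ` I) \<and> s ` I \<subseteq> {0..}" using I s by auto
    then show "gaussian_variable M (\<lambda>\<omega>. \<Sum>t\<in>s ` I. ?c t * X t \<omega>)"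
      by (intro gaussian_process_sum[OF X]) auto
  qed
  have i: "integrable M (X t)" if "0 \<le> t" for t
  proof -
    have "gaussian_variable M (\<lambda>\<omega>. \<Sum>t\<in>{t}. 1 * X t \<omega>)"
      by (rule gaussian_process_sum[OF X]) (use that in auto)
    then have "gaussian_variable M (X t)" by simp
    moreover have "(LINT \<omega>|M. X t \<omega>) = 0" using X that by (simp add: centered_gaussian_process_def)
    ultimately show ?thesis
      by (rule centered_normal_integrable[OF gaussian_variable_centered_normal[OF M]])
  qed
  have mean: "(LINT \<omega>|M. X (s i) \<omega>) = 0" if "i \<in> I" for i
    using X s[OF that] by (simp add: centered_gaussian_process_def)
  have "(LINT \<omega>|M. (\<Sum>i\<in>I. b i * X (s i) \<omega>)) = (\<Sum>i\<in>I. (LINT \<omega>|M. b i * X (s i) \<omega>))"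
    by (rule Bochner_Integration.integral_sum) (intro integrable_mult_right i s)
  then show "(LINT \<omega>|M. (\<Sum>i\<in>I. b i * X (s i) \<omega>)) = 0"
    by (simp add: mean)
qed

text \<open>Pointwise \<open>\<bar>z\<bar> \<le> \<alpha> + z\<^sup>2 / \<alpha>\<close>. Choosing \<open>\<alpha>\<^sup>2\<close> as a bound for the second moment makes the right side
\<open>2 * \<alpha>\<close>.\<close>

lemma integral_abs_le_second_moment:
  fixes Z :: "'a \<Rightarrow> real"
  assumes "prob_space M" and Z: "Z \<in> borel_measurable M" "integrable M (\<lambda>\<omega>. (Z \<omega>)\<^sup>2)" and \<alpha>: "0 < \<alpha>"
  shows "integrable M (\<lambda>\<omega>. \<bar>Z \<omega>\<bar>)" "(LINT \<omega>|M. \<bar>Z \<omega>\<bar>) \<le> \<alpha> + (LINT \<omega>|M. (Z \<omega>)\<^sup>2) / \<alpha>"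
proof -
  interpret prob_space M by fact
  have le: "\<bar>z\<bar> \<le> \<alpha> + z\<^sup>2 / \<alpha>" for z
  proof (cases "\<bar>z\<bar> \<le> \<alpha>")
    case True
    moreover have "0 \<le> z\<^sup>2 / \<alpha>" using \<alpha> by simp
    ultimately show ?thesis by linarith
  next
    case False
    then have "\<alpha> * \<bar>z\<bar> \<le> \<bar>z\<bar> * \<bar>z\<bar>" by (intro mult_right_mono) auto
    then have "\<bar>z\<bar> \<le> z\<^sup>2 / \<alpha>" using \<alpha> by (simp add: field_simps power2_eq_square)
    then show ?thesis using \<alpha> by linarith
  qed
  have I: "integrable M (\<lambda>\<omega>. \<alpha> + (Z \<omega>)\<^sup>2 / \<alpha>)" using Z by simp
  show J: "integrable M (\<lambda>\<omega>. \<bar>Z \<omega>\<bar>)"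
    by (rule Bochner_Integration.integrable_bound[OF I])
      (use Z(1) le \<alpha> in \<open>auto intro!: AE_I2 simp: abs_of_nonneg\<close>)
  have "(LINT \<omega>|M. \<bar>Z \<omega>\<bar>) \<le> (LINT \<omega>|M. \<alpha> + (Z \<omega>)\<^sup>2 / \<alpha>)"
    using le by (intro integral_mono J I) auto
  also have "\<dots> = \<alpha> + (LINT \<omega>|M. (Z \<omega>)\<^sup>2) / \<alpha>" using Z by (simp add: prob_space)
  finally show "(LINT \<omega>|M. \<bar>Z \<omega>\<bar>) \<le> \<alpha> + (LINT \<omega>|M. (Z \<omega>)\<^sup>2) / \<alpha>" .
qed

lemma cos_expectation_positive:
  fixes W :: "'b \<Rightarrow> real"
  assumes N: "prob_space N" and W: "W \<in> borel_measurable N"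
  shows "\<exists>\<theta>>0. 0 < (LINT \<omega>|N. cos (\<theta> * W \<omega>))"
proof -
  interpret prob_space N by fact
  have "(\<lambda>n. LINT \<omega>|N. cos (inverse (real (Suc n)) * W \<omega>)) \<longlonglongrightarrow> (LINT \<omega>|N. cos (0 * W \<omega>))"
  proof (rule integral_dominated_convergence[where w = "\<lambda>_. 1"])
    show "AE \<omega> in N. (\<lambda>n. cos (inverse (real (Suc n)) * W \<omega>)) \<longlonglongrightarrow> cos (0 * W \<omega>)"
      by (intro AE_I2 tendsto_cos tendsto_mult LIMSEQ_inverse_real_of_nat tendsto_const)
  qed (use W in auto)
  then have "\<forall>\<^sub>F n in sequentially. 0 < (LINT \<omega>|N. cos (inverse (real (Suc n)) * W \<omega>))"
    by (rule order_tendstoD(1)) (simp add: prob_space)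
  then obtain n where "0 < (LINT \<omega>|N. cos (inverse (real (Suc n)) * W \<omega>))"
    by (auto simp: eventually_sequentially simp del: of_nat_Suc)
  then show ?thesis by (intro exI[of _ "inverse (real (Suc n))"]) simp
qed

text \<open>Some value of the limiting characteristic function with \<open>\<theta> \<noteq> 0\<close> is positive, by continuity at zero. Taking the
logarithm of \<open>exp (- \<theta>\<^sup>2 * q u / 2)\<close> there shows that the variances converge, which determines the limit law.
In particular the variances cannot escape to infinity.\<close>

lemma centered_normal_limit:
  fixes W :: "'b \<Rightarrow> real" and Z :: "'c \<Rightarrow> 'a \<Rightarrow> real"
  assumes F: "F \<noteq> bot" and N: "prob_space N" and W: "W \<in> borel_measurable N"
    and Z: "\<forall>\<^sub>F u in F. centered_normal M (Z u) (q u)"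
    and cos: "\<And>\<theta>. ((\<lambda>u. LINT \<omega>|M. cos (\<theta> * Z u \<omega>)) \<longlongrightarrow> (LINT \<omega>|N. cos (\<theta> * W \<omega>))) F"
    and sin: "\<And>\<theta>. ((\<lambda>u. LINT \<omega>|M. sin (\<theta> * Z u \<omega>)) \<longlongrightarrow> (LINT \<omega>|N. sin (\<theta> * W \<omega>))) F"
  shows "centered_normal N W (LINT \<omega>|N. (W \<omega>)\<^sup>2)" and "(q \<longlongrightarrow> (LINT \<omega>|N. (W \<omega>)\<^sup>2)) F"
proof -
  obtain \<theta> where \<theta>: "0 < \<theta>" "0 < (LINT \<omega>|N. cos (\<theta> * W \<omega>))"
    using cos_expectation_positive[OF N W] by blast
  have ecos: "((\<lambda>u. exp (- (\<theta>\<^sup>2 * q u / 2))) \<longlongrightarrow> (LINT \<omega>|N. cos (\<theta> * W \<omega>))) F" for \<theta>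
  proof (rule Lim_transform_eventually[OF cos])
    show "\<forall>\<^sub>F u in F. (LINT \<omega>|M. cos (\<theta> * Z u \<omega>)) = exp (- (\<theta>\<^sup>2 * q u / 2))"
      using Z by eventually_elim (rule centered_normal_cos_sin(1))
  qed
  define q' where "q' = - (2 / \<theta>\<^sup>2) * ln (LINT \<omega>|N. cos (\<theta> * W \<omega>))"
  have "((\<lambda>u. - (2 / \<theta>\<^sup>2) * ln (exp (- (\<theta>\<^sup>2 * q u / 2)))) \<longlongrightarrow> q') F"
    unfolding q'_def using \<theta> by (intro tendsto_intros ecos) auto
  then have q: "(q \<longlongrightarrow> q') F" using \<theta> by simp
  have q0: "0 \<le> q'"
    by (rule tendsto_lowerbound[OF q _ F])
      (use Z in \<open>auto elim!: eventually_mono simp: centered_normal_def\<close>)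
  have nW: "centered_normal N W q'"
  proof (rule centered_normalI[OF N W q0])
    fix \<theta>
    have "((\<lambda>u. exp (- (\<theta>\<^sup>2 * q u / 2))) \<longlongrightarrow> exp (- (\<theta>\<^sup>2 * q' / 2))) F"
      by (intro tendsto_intros q) simp
    then show "(LINT \<omega>|N. cos (\<theta> * W \<omega>)) = exp (- (\<theta>\<^sup>2 * q' / 2))"
      using tendsto_unique[OF F ecos] by blast
    have "((\<lambda>u. 0) \<longlongrightarrow> (LINT \<omega>|N. sin (\<theta> * W \<omega>))) F"
    proof (rule Lim_transform_eventually[OF sin])
      show "\<forall>\<^sub>F u in F. (LINT \<omega>|M. sin (\<theta> * Z u \<omega>)) = 0"
        using Z by eventually_elim (rule centered_normal_cos_sin(2))
    qed
    from tendsto_unique[OF F this tendsto_const] show "(LINT \<omega>|N. sin (\<theta> * W \<omega>)) = 0" .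
  qed
  then have "(LINT \<omega>|N. (W \<omega>)\<^sup>2) = q'" by (rule centered_normal_second_moment)
  with nW q show "centered_normal N W (LINT \<omega>|N. (W \<omega>)\<^sup>2)" "(q \<longlongrightarrow> (LINT \<omega>|N. (W \<omega>)\<^sup>2)) F" by auto
qed

lemma abs_sin_diff_le: "\<bar>sin x - sin y\<bar> \<le> \<bar>x - y\<bar>" for x y :: real
proof -
  have "\<bar>sin x - sin y\<bar> = 2 * (\<bar>sin ((x - y) / 2)\<bar> * \<bar>cos ((x + y) / 2)\<bar>)"
    by (simp add: sin_diff_sin abs_mult)
  also have "\<dots> \<le> 2 * (\<bar>(x - y) / 2\<bar> * 1)"
    by (intro mult_left_mono mult_mono abs_sin_x_le_abs_x) (auto simp: abs_le_iff)
  finally show ?thesis by simp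
qed

lemma coord_lipschitz_of_combination:
  assumes f: "\<And>x y :: real. \<bar>f x - f y\<bar> \<le> \<bar>x - y\<bar>" and S: "finite S"
  shows "coord_lipschitz S (\<bar>\<theta>\<bar> * (\<Sum>i\<in>S. \<bar>c i\<bar>)) (\<lambda>x. f (\<theta> * (\<Sum>i\<in>S. c i * x i)))"
  unfolding coord_lipschitz_def
proof (intro allI)
  fix x y :: "real \<Rightarrow> real"
  have "\<bar>f (\<theta> * (\<Sum>i\<in>S. c i * x i)) - f (\<theta> * (\<Sum>i\<in>S. c i * y i))\<bar> \<le>
      \<bar>\<theta> * (\<Sum>i\<in>S. c i * x i) - \<theta> * (\<Sum>i\<in>S. c i * y i)\<bar>" by (rule f)
  also have "\<dots> = \<bar>\<theta>\<bar> * \<bar>\<Sum>i\<in>S. c i * (x i - y i)\<bar>"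
    by (simp add: right_diff_distrib[symmetric] abs_mult[symmetric] sum_subtractf[symmetric])
  also have "\<bar>\<Sum>i\<in>S. c i * (x i - y i)\<bar> \<le> (\<Sum>i\<in>S. \<bar>c i\<bar> * \<bar>x i - y i\<bar>)"
    by (rule order_trans[OF sum_abs]) (simp add: abs_mult)
  also have "\<dots> \<le> (\<Sum>i\<in>S. (\<Sum>j\<in>S. \<bar>c j\<bar>) * \<bar>x i - y i\<bar>)"
    using S by (intro sum_mono mult_right_mono member_le_sum) auto
  also have "\<dots> = (\<Sum>j\<in>S. \<bar>c j\<bar>) * (\<Sum>i\<in>S. \<bar>x i - y i\<bar>)" by (simp add: sum_distrib_left)
  finally show "\<bar>f (\<theta> * (\<Sum>i\<in>S. c i * x i)) - f (\<theta> * (\<Sum>i\<in>S. c i * y i))\<bar> \<le>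
      \<bar>\<theta>\<bar> * (\<Sum>i\<in>S. \<bar>c i\<bar>) * (\<Sum>i\<in>S. \<bar>x i - y i\<bar>)"
    by (simp add: mult.assoc mult_left_mono)
qed

section \<open>Regular variation\<close>

lemma filterlim_scale_at_right_0: "0 < c \<Longrightarrow> filterlim (\<lambda>h::real. c * h) (at_right 0) (at_right 0)"
proof -
  assume c: "0 < c"
  have "((\<lambda>h. c * h) \<longlongrightarrow> c * 0) (at_right 0)" by (intro tendsto_intros)
  moreover have "\<forall>\<^sub>F h in at_right 0. c * h \<in> {0<..} \<and> c * h \<noteq> 0"
    using eventually_at_right_less[of "0::real"] by eventually_elim (use c in auto)
  ultimately show ?thesis by (simp add: filterlim_at)
qed

text \<open>After subtraction of the linear part, \<open>f\<close> vanishes at 1, hence on the rationals; every real differs from a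
rational by less than \<open>\<delta>\<close>, so the remainder is bounded above everywhere. A bounded additive function is zero,
because its value at \<open>n * x\<close> is \<open>n\<close> times its value at \<open>x\<close>.\<close>

lemma additive_bounded_above_linear:
  fixes f :: "real \<Rightarrow> real"
  assumes add: "\<And>x y. f (x + y) = f x + f y"
    and bd: "0 < \<delta>" "\<And>x. \<bar>x\<bar> \<le> \<delta> \<Longrightarrow> f x \<le> C"
  shows "f x = x * f 1"
proof -
  \<comment> \<open>The deviation from linearity, which is additive and vanishes at 1.\<close>
  define h where "h x = f x - x * f 1" for x
  have hadd: "h (x + y) = h x + h y" for x y by (simp add: h_def add algebra_simps)
  have h0: "h 0 = 0" using hadd[of 0 0] by simp
  have hm: "h (- x) = - h x" for x using hadd[of x "- x"] h0 by simp
  have hn: "h (real n * x) = real n * h x" for n x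
    by (induction n) (simp_all add: h0 hadd distrib_right)
  have hrat: "h q = 0" if q: "q \<in> \<rat>" for q
  proof -
    obtain m n where n: "n \<noteq> 0" "\<bar>q\<bar> = real m / real n" by (rule Rats_abs_nat_div_natE[OF q])
    have "real n * h \<bar>q\<bar> = h (real n * \<bar>q\<bar>)" by (rule hn[symmetric])
    also have "real n * \<bar>q\<bar> = real m * 1" using n by simp
    also have "h (real m * 1) = real m * h 1" by (rule hn)
    also have "h 1 = 0" by (simp add: h_def)
    finally have "h \<bar>q\<bar> = 0" using n by simp
    then show ?thesis using hm[of q] by (cases "0 \<le> q") auto
  qed
  define K where "K = C + \<delta> * \<bar>f 1\<bar>"
  have hle: "h x \<le> K" if "\<bar>x\<bar> \<le> \<delta>" for x
  proof -
    have "- (x * f 1) \<le> \<bar>x\<bar> * \<bar>f 1\<bar>" using abs_ge_minus_self[of "x * f 1"] by (simp add: abs_mult)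
    also have "\<dots> \<le> \<delta> * \<bar>f 1\<bar>" using that by (intro mult_right_mono) auto
    finally show ?thesis using bd(2)[OF that] by (simp add: h_def K_def)
  qed
  have hK: "h x \<le> K" for x
  proof -
    obtain q where q: "q \<in> \<rat>" "x - \<delta> < q" "q < x" using Rats_dense_in_real[of "x - \<delta>" x] bd(1) by auto
    have "h x = h (x - q) + h q" using hadd[of "x - q" q] by simp
    then show ?thesis using hle[of "x - q"] hrat[OF q(1)] q by simp
  qed
  have hneg: "h x \<le> 0" for x
  proof (rule ccontr)
    assume "\<not> h x \<le> 0"
    then have pos: "0 < h x" by simp
    obtain n where "K < real n * h x" using reals_Archimedean3[OF pos] by blast
    then show False using hK[of "real n * x"] hn[of n x] by simp
  qed
  have "h x = 0" using hneg[of x] hneg[of "- x"] hm[of x] by simp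
  then show ?thesis by (simp add: h_def)
qed

text \<open>The limit \<open>w\<close> is multiplicative, because scaling by \<open>r * s\<close> is scaling by \<open>s\<close> and then by \<open>r\<close>. Its logarithm,
in exponential coordinates, is an additive function that is bounded above near zero.\<close>

lemma regular_variation:
  fixes f w :: "real \<Rightarrow> real"
  assumes pos: "\<forall>\<^sub>F h in at_right 0. 0 < f h"
    and lim: "\<And>r. 0 < r \<Longrightarrow> ((\<lambda>h. f (r * h) / f h) \<longlongrightarrow> w r) (at_right 0)"
    and bd: "\<And>r. 1 / 2 \<le> r \<Longrightarrow> r \<le> 2 \<Longrightarrow> w r \<le> C"
  shows "\<exists>\<rho>. \<forall>r>0. w r = r powr \<rho>"
proof -
  have mult: "w (r * s) = w r * w s" if r: "0 < r" and s: "0 < s" for r s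
  proof (rule tendsto_unique[OF trivial_limit_at_right_real lim])
    show "((\<lambda>h. f (r * s * h) / f h) \<longlongrightarrow> w r * w s) (at_right 0)"
    proof (rule Lim_transform_eventually)
      show "((\<lambda>h. (f (r * (s * h)) / f (s * h)) * (f (s * h) / f h)) \<longlongrightarrow> w r * w s) (at_right 0)"
        by (intro tendsto_mult lim s filterlim_compose[OF lim[OF r] filterlim_scale_at_right_0[OF s]])
      show "\<forall>\<^sub>F h in at_right 0. (f (r * (s * h)) / f (s * h)) * (f (s * h) / f h) = f (r * s * h) / f h"
        using eventually_compose_filterlim[OF pos filterlim_scale_at_right_0[OF s]]
        by eventually_elim (simp add: mult.assoc)
    qed
  qed (use r s in simp)
  have w1: "w 1 = 1"
  proof (rule tendsto_unique[OF trivial_limit_at_right_real lim])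
    show "((\<lambda>h. f (1 * h) / f h) \<longlongrightarrow> 1) (at_right 0)"
      by (rule Lim_transform_eventually[OF tendsto_const])
        (use pos in \<open>auto elim!: eventually_mono\<close>)
  qed simp
  have wpos: "0 < w r" if r: "0 < r" for r
  proof -
    have "0 \<le> w r"
    proof (rule tendsto_lowerbound[OF lim[OF r] _ trivial_limit_at_right_real])
      show "\<forall>\<^sub>F h in at_right 0. 0 \<le> f (r * h) / f h"
        using eventually_compose_filterlim[OF pos filterlim_scale_at_right_0[OF r]] pos
        by eventually_elim simp
    qed
    moreover have "w r * w (1 / r) = 1" using mult[of r "1 / r"] r w1 by simp
    ultimately show ?thesis by (cases "w r = 0") auto
  qed
  define k where "k s = ln (w (exp s))" for s
  have "k s = s * k 1" for s
  proof (rule additive_bounded_above_linear[of k "ln 2" "ln (max C 1)"])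
    show "k (x + y) = k x + k y" for x y
      using wpos[of "exp x"] wpos[of "exp y"] by (simp add: k_def exp_add mult ln_mult_pos)
    fix x :: real assume x: "\<bar>x\<bar> \<le> ln 2"
    have "exp (- ln 2) \<le> exp x" "exp x \<le> exp (ln 2)"
      using x by (simp_all only: exp_le_cancel_iff abs_le_iff) linarith+
    then have "w (exp x) \<le> C" by (intro bd) (simp_all add: exp_minus inverse_eq_divide)
    then show "k x \<le> ln (max C 1)" unfolding k_def using wpos[of "exp x"] by (subst ln_le_cancel_iff) auto
  qed simp
  then have "w (exp s) = exp (s * k 1)" for s
    using wpos[of "exp s"] by (metis exp_gt_zero exp_ln k_def)
  then have "w r = r powr k 1" if "0 < r" for r
    using that by (metis exp_ln powr_def mult.commute less_irrefl)
  then show ?thesis by blast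
qed

section \<open>Continuous modifications\<close>

lemma cadlag_process_left_limit:
  assumes "cadlag_process N Y" "\<omega> \<in> space N" "0 < t"
  obtains k where "((\<lambda>s. Y s \<omega>) \<longlongrightarrow> k) (at_left t)"
proof -
  have "sample_path Y \<omega> \<in> cadlag" using assms by (simp add: cadlag_process_def)
  then obtain k where "(sample_path Y \<omega> \<longlongrightarrow> k) (at_left t)"
    using assms(3) unfolding cadlag_def by blast
  moreover have "\<forall>\<^sub>F s in at_left t. sample_path Y \<omega> s = Y s \<omega>"
    using eventually_at_left_real[OF assms(3)] by eventually_elim (simp add: sample_path_def)
  ultimately have "((\<lambda>s. Y s \<omega>) \<longlongrightarrow> k) (at_left t)" by (rule Lim_transform_eventually)
  then show ?thesis by (rule that)
qed

text \<open>A jump at \<open>t\<close> would be seen as an increment of nearly its own size over every fine dyadic interval that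
contains \<open>t\<close> in its interior or as its right end point.\<close>

lemma cadlag_continuous_of_dyadic_increments:
  assumes Y: "cadlag_process N Y" and \<omega>: "\<omega> \<in> space N"
    and small: "\<And>T e :: nat. \<forall>\<^sub>F n in sequentially. \<forall>k<T * 2 ^ n.
      \<bar>Y (real (Suc k) / 2 ^ n) \<omega> - Y (real k / 2 ^ n) \<omega>\<bar> \<le> 1 / real (Suc e)"
  shows "continuous_on {0..} (\<lambda>t. Y t \<omega>)"
  unfolding continuous_on_def
proof
  fix t :: real assume "t \<in> {0..}"
  show "((\<lambda>t. Y t \<omega>) \<longlongrightarrow> Y t \<omega>) (at t within {0..})"
  proof (cases "t = 0")
    case True
    then show ?thesis using cadlag_process_right[OF Y \<omega>, of 0] by (simp add: at_within_Ici_at_right)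
  next
    case False
    then have t: "0 < t" using \<open>t \<in> {0..}\<close> by simp
    have R: "((\<lambda>s. Y s \<omega>) \<longlongrightarrow> Y t \<omega>) (at_right t)" using cadlag_process_right[OF Y \<omega>] t by simp
    obtain k where L: "((\<lambda>s. Y s \<omega>) \<longlongrightarrow> k) (at_left t)" by (rule cadlag_process_left_limit[OF Y \<omega> t])
    have "k = Y t \<omega>"
    proof (rule ccontr)
      assume "k \<noteq> Y t \<omega>"
      then have "0 < \<bar>k - Y t \<omega>\<bar> / 3" by simp
      then obtain e where e: "1 / real (Suc e) < \<bar>k - Y t \<omega>\<bar> / 3" using nat_approx_posE by blast
      define \<epsilon> where "\<epsilon> = 1 / real (Suc e)"
      have \<epsilon>: "0 < \<epsilon>" "3 * \<epsilon> < \<bar>k - Y t \<omega>\<bar>" using e by (auto simp: \<epsilon>_def)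
      obtain b1 where b1: "b1 < t" "\<And>s. b1 < s \<Longrightarrow> s < t \<Longrightarrow> \<bar>Y s \<omega> - k\<bar> < \<epsilon>"
        using tendstoD[OF L \<epsilon>(1)] unfolding eventually_at_left_field dist_real_def by blast
      obtain b2 where b2: "t < b2" "\<And>s. t < s \<Longrightarrow> s < b2 \<Longrightarrow> \<bar>Y s \<omega> - Y t \<omega>\<bar> < \<epsilon>"
        using tendstoD[OF R \<epsilon>(1)] unfolding eventually_at_right_field dist_real_def by blast
      obtain T :: nat where T: "t < real T" using reals_Archimedean2 by blast
      have "(\<lambda>n. (1 / 2 :: real) ^ n) \<longlonglongrightarrow> 0" by (rule LIMSEQ_realpow_zero) auto
      then have "\<forall>\<^sub>F n in sequentially. (1 / 2 :: real) ^ n < min (t - b1) (b2 - t)"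
        by (rule order_tendstoD(2)) (use b1 b2 in simp)
      with small[of T e] have "\<forall>\<^sub>F n in sequentially. (1 / 2 :: real) ^ n < min (t - b1) (b2 - t) \<and>
          (\<forall>k<T * 2 ^ n. \<bar>Y (real (Suc k) / 2 ^ n) \<omega> - Y (real k / 2 ^ n) \<omega>\<bar> \<le> \<epsilon>)"
        unfolding \<epsilon>_def by eventually_elim simp
      then obtain n where n: "(1 / 2 :: real) ^ n < min (t - b1) (b2 - t)"
        "\<And>k. k < T * 2 ^ n \<Longrightarrow> \<bar>Y (real (Suc k) / 2 ^ n) \<omega> - Y (real k / 2 ^ n) \<omega>\<bar> \<le> \<epsilon>"
        by (auto simp: eventually_sequentially)
      define p where "p = (2 :: real) ^ n"
      have p: "0 < p" "1 / p = (1 / 2) ^ n" by (simp_all add: p_def power_one_over)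
      have tp: "0 < t * p" using t p by simp
      \<comment> \<open>the last dyadic point strictly before \<open>t\<close>\<close>
      define j where "j = nat (\<lceil>t * p\<rceil> - 1)"
      have "real j = real_of_int \<lceil>t * p\<rceil> - 1" using tp by (simp add: j_def)
      then have j: "real j < t * p" "t * p \<le> real (Suc j)" by linarith+
      have "real j < real T * p" using j(1) T p by (smt (verit) mult_strict_right_mono)
      then have "real j < real (T * 2 ^ n)" by (simp add: p_def)
      then have jT: "j < T * 2 ^ n" by (simp only: of_nat_less_iff)
      have "t * p - 1 \<le> real j" using j by simp
      then have "(t * p - 1) / p \<le> real j / p" using p(1) by (intro divide_right_mono) auto
      then have "t - 1 / p \<le> real j / p" using p(1) by (simp add: diff_divide_distrib)
      then have l: "b1 < real j / p" "real j / p < t"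
        using n(1) j(1) p(1) unfolding p(2) by (auto simp: pos_divide_less_eq)
      have "real (Suc j) / p \<le> (t * p + 1) / p" using j(1) p(1) by (intro divide_right_mono) auto
      then have "real (Suc j) / p \<le> t + 1 / p" using p(1) by (simp add: add_divide_distrib)
      then have r: "t \<le> real (Suc j) / p" "real (Suc j) / p < b2"
        using n(1) j(2) p(1) unfolding p(2) by (auto simp: pos_le_divide_eq)
      have "\<bar>Y (real j / p) \<omega> - k\<bar> < \<epsilon>" by (rule b1(2)[OF l])
      moreover have "\<bar>Y (real (Suc j) / p) \<omega> - Y t \<omega>\<bar> < \<epsilon>"
        using b2(2)[OF _ r(2)] r(1) \<epsilon>(1) by (cases "t = real (Suc j) / p") auto
      moreover have "\<bar>Y (real (Suc j) / p) \<omega> - Y (real j / p) \<omega>\<bar> \<le> \<epsilon>"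
        unfolding p_def by (rule n(2)[OF jT])
      ultimately show False using \<epsilon>(2) by linarith
    qed
    then have "((\<lambda>s. Y s \<omega>) \<longlongrightarrow> Y t \<omega>) (at t)" using L R by (simp add: filterlim_split_at)
    then show ?thesis by (rule tendsto_within_subset) simp
  qed
qed

text \<open>There are of order \<open>2 ^ n\<close> increments in generation \<open>n\<close>. The \<open>2 * m\<close>-th moment of each is of order
\<open>2 powr (- 2 * m * \<kappa> * n)\<close>, which is at most \<open>4 ^ (- n)\<close> if \<open>m * \<kappa> \<ge> 1\<close>. The exceptional probabilities are summable.\<close>

lemma dyadic_increments_small:
  assumes Y: "stochastic_process N Y" and \<kappa>: "0 < \<kappa>" and C: "0 \<le> C"
    and n: "\<And>r r'. 0 \<le> r \<Longrightarrow> 0 \<le> r' \<Longrightarrow> centered_normal N (\<lambda>\<omega>. Y r \<omega> - Y r' \<omega>) (C * \<bar>r - r'\<bar> powr (2 * \<kappa>))"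
    and \<epsilon>: "0 < \<epsilon>"
  shows "AE \<omega> in N. \<forall>\<^sub>F n in sequentially. \<forall>k<T * 2 ^ n.
      \<bar>Y (real (Suc k) / 2 ^ n) \<omega> - Y (real k / 2 ^ n) \<omega>\<bar> \<le> \<epsilon>"
proof -
  interpret prob_space N using Y by (simp add: stochastic_process_def)
  have Ym: "Y r \<in> borel_measurable N" if "0 \<le> r" for r using Y that by (simp add: stochastic_process_def)
  \<comment> \<open>Moments of order \<open>2 * m\<close> beat the number of dyadic intervals.\<close>
  obtain m :: nat where m: "1 < real m * \<kappa>" using reals_Archimedean3[OF \<kappa>] by blast
  define c where "c = (fact (2 * m) / (2 ^ m * fact m) :: real)"
  have c: "0 \<le> c" by (simp add: c_def)
  define E where "E n k = {\<omega>\<in>space N. \<epsilon> < \<bar>Y (real (Suc k) / 2 ^ n) \<omega> - Y (real k / 2 ^ n) \<omega>\<bar>}" for n k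
  have Em: "E n k \<in> sets N" for n k
  proof -
    have [measurable]: "Y (real (Suc k) / 2 ^ n) \<in> borel_measurable N" "Y (real k / 2 ^ n) \<in> borel_measurable N"
      by (simp_all add: Ym)
    show ?thesis unfolding E_def by measurable
  qed
  have prob_E: "prob (E n k) \<le> C ^ m * c / \<epsilon> ^ (2 * m) * ((1 / 2) ^ n)\<^sup>2" for n k
  proof -
    let ?d = "\<lambda>\<omega>. Y (real (Suc k) / 2 ^ n) \<omega> - Y (real k / 2 ^ n) \<omega>"
    let ?x = "(1 / 2 :: real) ^ n"
    have "real (Suc k) / 2 ^ n - real k / 2 ^ n = ?x"
      by (simp add: diff_divide_distrib[symmetric] power_one_over inverse_eq_divide)
    then have norm: "centered_normal N ?d (C * ?x powr (2 * \<kappa>))"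
      using n[of "real (Suc k) / 2 ^ n" "real k / 2 ^ n"] by simp
    have "E n k \<subseteq> {\<omega>\<in>space N. \<epsilon> ^ (2 * m) \<le> ?d \<omega> ^ (2 * m)}"
    proof
      fix \<omega> assume w: "\<omega> \<in> E n k"
      then have "\<epsilon> ^ (2 * m) \<le> \<bar>?d \<omega>\<bar> ^ (2 * m)" using \<epsilon> by (intro power_mono) (auto simp: E_def)
      then show "\<omega> \<in> {\<omega>\<in>space N. \<epsilon> ^ (2 * m) \<le> ?d \<omega> ^ (2 * m)}"
        using w by (simp add: E_def power_even_abs)
    qed
    then have "prob (E n k) \<le> prob {\<omega>\<in>space N. \<epsilon> ^ (2 * m) \<le> ?d \<omega> ^ (2 * m)}"
      using centered_normal_moments(1)[OF norm, of "2 * m"]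
      by (intro finite_measure_mono) (auto dest: borel_measurable_integrable)
    also have "\<dots> \<le> (LINT \<omega>|N. ?d \<omega> ^ (2 * m)) / \<epsilon> ^ (2 * m)"
      by (rule integral_Markov_inequality_measure[where A = "{}"])
        (use centered_normal_moments(1)[OF norm] \<epsilon> in \<open>auto intro!: AE_I2\<close>)
    also have "(LINT \<omega>|N. ?d \<omega> ^ (2 * m)) = (C * ?x powr (2 * \<kappa>)) ^ m * c"
      unfolding c_def by (rule centered_normal_moments(2)[OF norm])
    finally have le: "prob (E n k) \<le> (C * ?x powr (2 * \<kappa>)) ^ m * c / \<epsilon> ^ (2 * m)" .
    have "(C * ?x powr (2 * \<kappa>)) ^ m = C ^ m * ?x powr (real m * (2 * \<kappa>))"
      by (simp add: power_mult_distrib powr_power)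
    also have "\<dots> \<le> C ^ m * ?x powr 2"
      using C m by (intro mult_left_mono powr_mono') (auto simp: power_le_one)
    also have "?x powr 2 = ?x\<^sup>2" using powr_realpow[of ?x 2] by simp
    finally have "(C * ?x powr (2 * \<kappa>)) ^ m * (c / \<epsilon> ^ (2 * m)) \<le> C ^ m * ?x\<^sup>2 * (c / \<epsilon> ^ (2 * m))"
      using c \<epsilon> by (intro mult_right_mono) auto
    also have "\<dots> = C ^ m * c / \<epsilon> ^ (2 * m) * ?x\<^sup>2" by simp
    finally show ?thesis using le by simp
  qed
  have sum: "prob (\<Union>k<T * 2 ^ n. E n k) \<le> real T * (C ^ m * c / \<epsilon> ^ (2 * m)) * (1 / 2) ^ n" for n
  proof -
    have "prob (\<Union>k<T * 2 ^ n. E n k) \<le> (\<Sum>k<T * 2 ^ n. prob (E n k))"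
      by (rule finite_measure_subadditive_finite) (use Em in auto)
    also have "\<dots> \<le> (\<Sum>k<T * 2 ^ n. C ^ m * c / \<epsilon> ^ (2 * m) * ((1 / 2) ^ n)\<^sup>2)"
      by (rule sum_mono) (rule prob_E)
    also have "\<dots> = real T * (C ^ m * c / \<epsilon> ^ (2 * m)) * (2 ^ n * ((1 / 2) ^ n)\<^sup>2)" by simp
    also have "(2::real) ^ n * ((1 / 2) ^ n)\<^sup>2 = (1 / 2) ^ n"
    proof -
      have "(2::real) ^ n * (1 / 2) ^ n = 1" by (simp add: power_one_over)
      then show ?thesis by (simp only: power2_eq_square mult.assoc[symmetric] mult_1_left)
    qed
    finally show ?thesis .
  qed
  have "AE \<omega> in N. \<forall>\<^sub>F n in sequentially. \<omega> \<in> space N - (\<Union>k<T * 2 ^ n. E n k)"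
  proof (rule borel_cantelli_AE1)
    show "(\<Union>k<T * 2 ^ n. E n k) \<in> sets N" for n using Em by auto
    show "emeasure N (\<Union>k<T * 2 ^ n. E n k) < \<infinity>" for n by (simp add: emeasure_eq_measure)
    show "summable (\<lambda>n. prob (\<Union>k<T * 2 ^ n. E n k))"
    proof (rule summable_comparison_test')
      show "summable (\<lambda>n. real T * (C ^ m * c / \<epsilon> ^ (2 * m)) * (1 / 2) ^ n)"
        by (intro summable_mult summable_geometric) simp
      show "norm (prob (\<Union>k<T * 2 ^ n. E n k)) \<le> real T * (C ^ m * c / \<epsilon> ^ (2 * m)) * (1 / 2) ^ n"
        if "0 \<le> n" for n
        using sum[of n] by simp
    qed
  qed
  then show ?thesis
  proof eventually_elim
    case (elim \<omega>)
    then show ?case by eventually_elim (auto simp: E_def not_less)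
  qed
qed

lemma centered_normal_cong_AE:
  assumes Z: "centered_normal M Z q" and W: "W \<in> borel_measurable M" and ae: "AE \<omega> in M. W \<omega> = Z \<omega>"
  shows "centered_normal M W q"
proof -
  have "distr M borel W = distr M borel Z"
    by (rule distr_cong_AE) (use Z W ae in \<open>auto simp: centered_normal_def\<close>)
  then show ?thesis using Z W by (simp add: centered_normal_def)
qed

lemma same_fdd_AE:
  assumes Y: "\<And>t. 0 \<le> t \<Longrightarrow> Y t \<in> borel_measurable N" and W: "\<And>t. 0 \<le> t \<Longrightarrow> W t \<in> borel_measurable N"
    and ae: "\<And>t. 0 \<le> t \<Longrightarrow> AE \<omega> in N. Y t \<omega> = W t \<omega>"
  shows "same_fdd N Y N W"
  unfolding same_fdd_def
proof (intro allI impI, elim conjE)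
  fix S :: "real set" assume S: "finite S" "S \<subseteq> {0..}"
  have "AE \<omega> in N. \<forall>t\<in>S. Y t \<omega> = W t \<omega>"
    by (rule AE_finite_allI[OF S(1)]) (use S ae in auto)
  then have "AE \<omega> in N. (\<lambda>t\<in>S. Y t \<omega>) = (\<lambda>t\<in>S. W t \<omega>)"
    by eventually_elim (auto simp: restrict_def fun_eq_iff)
  then show "distr N (PiM S (\<lambda>_. borel)) (\<lambda>\<omega>. \<lambda>t\<in>S. Y t \<omega>) = distr N (PiM S (\<lambda>_. borel)) (\<lambda>\<omega>. \<lambda>t\<in>S. W t \<omega>)"
    using S Y W by (intro distr_cong_AE refl measurable_restrict) auto
qed

lemma continuous_modification_event:
  assumes Y: "cadlag_process N Y" and \<kappa>: "0 < \<kappa>" and C: "0 \<le> C"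
    and n: "\<And>r r'. 0 \<le> r \<Longrightarrow> 0 \<le> r' \<Longrightarrow> centered_normal N (\<lambda>\<omega>. Y r \<omega> - Y r' \<omega>) (C * \<bar>r - r'\<bar> powr (2 * \<kappa>))"
  obtains G where "G \<in> sets N" "AE \<omega> in N. \<omega> \<in> G" "\<And>\<omega>. \<omega> \<in> G \<Longrightarrow> continuous_on {0..} (\<lambda>t. Y t \<omega>)"
proof -
  have sp: "stochastic_process N Y" using Y by (simp add: cadlag_process_def)
  then have Ym: "Y r \<in> borel_measurable N" if "0 \<le> r" for r using that by (simp add: stochastic_process_def)
  have [measurable]: "Y (real k / 2 ^ n) \<in> borel_measurable N" for k n by (rule Ym) simp
  define G where "G = {\<omega>\<in>space N. \<forall>T e :: nat. \<exists>n0. \<forall>n\<ge>n0. \<forall>k<T * 2 ^ n.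
      \<bar>Y (real (Suc k) / 2 ^ n) \<omega> - Y (real k / 2 ^ n) \<omega>\<bar> \<le> 1 / real (Suc e)}"
  show ?thesis
  proof (rule that)
    show "G \<in> sets N" unfolding G_def by measurable
    have "AE \<omega> in N. \<forall>T e :: nat. \<forall>\<^sub>F n in sequentially. \<forall>k<T * 2 ^ n.
      \<bar>Y (real (Suc k) / 2 ^ n) \<omega> - Y (real k / 2 ^ n) \<omega>\<bar> \<le> 1 / real (Suc e)"
      unfolding AE_all_countable
      by (intro allI dyadic_increments_small[OF sp \<kappa> C n]) auto
    then show "AE \<omega> in N. \<omega> \<in> G"
      by (rule AE_mp) (auto intro!: AE_I2 simp: G_def eventually_sequentially)
    fix \<omega> assume "\<omega> \<in> G"
    then show "continuous_on {0..} (\<lambda>t. Y t \<omega>)"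
      by (intro cadlag_continuous_of_dyadic_increments[OF Y]) (auto simp: G_def eventually_sequentially)
  qed
qed

section \<open>The increments of the process\<close>

text \<open>The standing assumptions on \<open>X\<close>. The second locale below adds a base point \<open>t\<close> with its normalization and
limit; the theorem uses it for all base points at once, with \<open>t = 1\<close> as the reference.\<close>

locale scaling_gaussian_process = prob_space M for M :: "'a measure" +
  fixes X :: "real \<Rightarrow> 'a \<Rightarrow> real" and l :: "real \<Rightarrow> real" and \<gamma> \<sigma> :: real
  assumes gamma: "0 < \<gamma>" "\<gamma> < 1"
    and sigma: "0 < \<sigma>"
    and l_0: "l 0 = 1"
    and X_gaussian: "centered_gaussian_process M X"
    and X_paths: "\<And>\<omega>. \<omega> \<in> space M \<Longrightarrow> sample_path X \<omega> \<in> cadlag"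
    and X_cov: "\<And>s t. 0 < s \<Longrightarrow> 0 < t \<Longrightarrow> expectation (\<lambda>\<omega>. X s \<omega> * X t \<omega>) =
        \<sigma>\<^sup>2 * min s t powr (2 * \<gamma>) * l (\<bar>s - t\<bar> / min s t)"
begin

text \<open>The second moment of an increment of \<open>X\<close>, normalized to start at time 1 and to \<open>\<sigma> = 1\<close>.\<close>

definition g :: "real \<Rightarrow> real" where
  "g h = 1 + (1 + h) powr (2 * \<gamma>) - 2 * l h"

lemma X_combination:
  "finite I \<Longrightarrow> (\<And>i. i \<in> I \<Longrightarrow> 0 \<le> s i) \<Longrightarrow>
    centered_normal M (\<lambda>\<omega>. \<Sum>i\<in>I. b i * X (s i) \<omega>) (expectation (\<lambda>\<omega>. (\<Sum>i\<in>I. b i * X (s i) \<omega>)\<^sup>2))"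
  by (rule gaussian_process_combination[OF X_gaussian])

lemma X_measurable: "0 \<le> s \<Longrightarrow> X s \<in> borel_measurable M"
  using X_gaussian by (simp add: centered_gaussian_process_def stochastic_process_def)

lemma X_normal: "0 \<le> s \<Longrightarrow> centered_normal M (X s) (expectation (\<lambda>\<omega>. (X s \<omega>)\<^sup>2))"
  using X_combination[of "{s}" "\<lambda>i. i" "\<lambda>_. 1"] by simp

lemma X_increment_second_moment:
  assumes s: "0 < s" "s \<le> s'"
  shows "expectation (\<lambda>\<omega>. (X s \<omega> - X s' \<omega>)\<^sup>2) = \<sigma>\<^sup>2 * s powr (2 * \<gamma>) * g ((s' - s) / s)"
proof -
  have sq: "integrable M (\<lambda>\<omega>. (X r \<omega>)\<^sup>2)" if "0 < r" for r
    using centered_normal_square_integrable[OF X_normal] that by simp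
  have pr: "integrable M (\<lambda>\<omega>. X s \<omega> * X s' \<omega>)"
  proof (rule Bochner_Integration.integrable_bound)
    show "integrable M (\<lambda>\<omega>. (X s \<omega>)\<^sup>2 + (X s' \<omega>)\<^sup>2)" using sq[of s] sq[of s'] s by simp
    show "(\<lambda>\<omega>. X s \<omega> * X s' \<omega>) \<in> borel_measurable M"
      using X_measurable s by (intro borel_measurable_times) auto
    have "\<bar>x * y\<bar> \<le> x\<^sup>2 + y\<^sup>2" for x y :: real
      using sum_squares_bound[of x y] sum_squares_bound[of x "- y"] sum_power2_ge_zero[of x y]
      by (auto simp: abs_le_iff)
    then show "AE \<omega> in M. norm (X s \<omega> * X s' \<omega>) \<le> norm ((X s \<omega>)\<^sup>2 + (X s' \<omega>)\<^sup>2)"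
      by (intro AE_I2) (auto simp: abs_of_nonneg)
  qed
  have var: "expectation (\<lambda>\<omega>. (X r \<omega>)\<^sup>2) = \<sigma>\<^sup>2 * r powr (2 * \<gamma>)" if "0 < r" for r
    using X_cov[of r r] that by (simp add: power2_eq_square l_0)
  have "expectation (\<lambda>\<omega>. (X s \<omega> - X s' \<omega>)\<^sup>2) =
      expectation (\<lambda>\<omega>. (X s \<omega>)\<^sup>2 + (X s' \<omega>)\<^sup>2 - 2 * (X s \<omega> * X s' \<omega>))"
    by (intro Bochner_Integration.integral_cong) (auto simp: power2_diff)
  also have "\<dots> = expectation (\<lambda>\<omega>. (X s \<omega>)\<^sup>2) + expectation (\<lambda>\<omega>. (X s' \<omega>)\<^sup>2) - 2 * expectation (\<lambda>\<omega>. X s \<omega> * X s' \<omega>)"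
    using sq[of s] sq[of s'] s pr by simp
  also have "\<dots> = \<sigma>\<^sup>2 * (s powr (2 * \<gamma>) + s' powr (2 * \<gamma>) - 2 * s powr (2 * \<gamma>) * l ((s' - s) / s))"
    using s var[of s] var[of s'] X_cov[of s s'] by (simp add: min_def algebra_simps)
  also have "s' powr (2 * \<gamma>) = s powr (2 * \<gamma>) * (1 + (s' - s) / s) powr (2 * \<gamma>)"
  proof -
    have "s' = s * (1 + (s' - s) / s)" using s by (simp add: field_simps)
    then show ?thesis using s by (metis powr_mult less_imp_le divide_nonneg_pos diff_ge_0_iff_ge add_nonneg_nonneg zero_le_one)
  qed
  finally show ?thesis by (simp add: g_def algebra_simps)
qed

lemma g_nonneg: "0 \<le> h \<Longrightarrow> 0 \<le> g h"
proof -
  assume h: "0 \<le> h"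
  have "0 \<le> expectation (\<lambda>\<omega>. (X 1 \<omega> - X (1 + h) \<omega>)\<^sup>2)" by simp
  also have "\<dots> = \<sigma>\<^sup>2 * g h" using X_increment_second_moment[of 1 "1 + h"] h by simp
  finally show ?thesis using sigma by (simp add: zero_le_mult_iff)
qed

end

lemma cadlag_affine_time:
  assumes x: "x \<in> cadlag" and t: "0 \<le> t" and u: "0 < u"
  shows "(\<lambda>r\<in>{0..}. (c - x (t + r * u)) / d) \<in> cadlag"
proof -
  have R: "filterlim (\<lambda>s. t + s * u) (at_right (t + r * u)) (at_right r)" for r
  proof -
    have "((\<lambda>s. t + s * u) \<longlongrightarrow> t + r * u) (at_right r)" by (intro tendsto_intros)
    moreover have "\<forall>\<^sub>F s in at_right r. t + s * u \<in> {t + r * u<..} \<and> t + s * u \<noteq> t + r * u"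
      using eventually_at_right_less[of r] by eventually_elim (use u in auto)
    ultimately show ?thesis by (simp add: filterlim_at)
  qed
  have L: "filterlim (\<lambda>s. t + s * u) (at_left (t + r * u)) (at_left r)" for r
  proof -
    have "((\<lambda>s. t + s * u) \<longlongrightarrow> t + r * u) (at_left r)" by (intro tendsto_intros)
    moreover have "\<forall>\<^sub>F s in at_left r. s < r" by (simp add: eventually_at_filter)
    then have "\<forall>\<^sub>F s in at_left r. t + s * u \<in> {..<t + r * u} \<and> t + s * u \<noteq> t + r * u"
      by eventually_elim (use u in auto)
    ultimately show ?thesis by (simp add: filterlim_at)
  qed
  let ?y = "\<lambda>r\<in>{0..}. (c - x (t + r * u)) / d"
  have "(?y \<longlongrightarrow> ?y r) (at_right r)" if r: "0 \<le> r" for r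
  proof -
    have "((\<lambda>s. (c - x (t + s * u)) / d) \<longlongrightarrow> (c - x (t + r * u)) / d) (at_right r)"
      unfolding divide_inverse
      by (intro tendsto_intros filterlim_compose[OF cadlag_right[OF x] R]) (use t u r in simp)
    moreover have "\<forall>\<^sub>F s in at_right r. (c - x (t + s * u)) / d = ?y s"
      using eventually_at_right_less[of r] by eventually_elim (use r in simp)
    ultimately have "(?y \<longlongrightarrow> (c - x (t + r * u)) / d) (at_right r)"
      by (rule Lim_transform_eventually)
    then show ?thesis using r by simp
  qed
  moreover have "\<exists>k. (?y \<longlongrightarrow> k) (at_left r)" if r: "0 < r" for r
  proof -
    have "0 < t + r * u" using t u r by (simp add: add_nonneg_pos)
    then obtain k where k: "(x \<longlongrightarrow> k) (at_left (t + r * u))" using x by (auto simp: cadlag_def)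
    have "((\<lambda>s. (c - x (t + s * u)) / d) \<longlongrightarrow> (c - k) / d) (at_left r)"
      unfolding divide_inverse by (intro tendsto_intros filterlim_compose[OF k L])
    moreover have "\<forall>\<^sub>F s in at_left r. s \<in> {0<..<r}" using r by (rule eventually_at_left_real)
    then have "\<forall>\<^sub>F s in at_left r. (c - x (t + s * u)) / d = ?y s"
      by eventually_elim simp
    ultimately show ?thesis using Lim_transform_eventually by blast
  qed
  ultimately show ?thesis by (simp add: cadlag_def)
qed

lemma abs_cos_diff_le: "\<bar>cos x - cos y\<bar> \<le> \<bar>x - y\<bar>" for x y :: real
proof -
  have "\<bar>cos x - cos y\<bar> = 2 * (\<bar>sin ((x + y) / 2)\<bar> * \<bar>sin ((y - x) / 2)\<bar>)"
    by (simp add: cos_diff_cos abs_mult)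
  also have "\<dots> \<le> 2 * (1 * \<bar>(y - x) / 2\<bar>)"
    by (intro mult_left_mono mult_mono abs_sin_x_le_abs_x) (auto simp: abs_le_iff)
  finally show ?thesis by simp
qed

locale small_scale_convergence = scaling_gaussian_process M X l \<gamma> \<sigma>
  for M :: "'a measure" and X :: "real \<Rightarrow> 'a \<Rightarrow> real" and l :: "real \<Rightarrow> real" and \<gamma> \<sigma> :: real +
  fixes t A :: real and a :: "real \<Rightarrow> real" and N :: "'b measure" and Y :: "real \<Rightarrow> 'b \<Rightarrow> real"
  assumes t_pos: "0 < t" and A_pos: "0 < A"
    and a_pos: "\<And>u. 0 < u \<Longrightarrow> u < A \<Longrightarrow> 0 < a u"
    and Y_process: "stochastic_process N Y"
    and Y_nondegenerate: "\<not> (\<exists>c. AE \<omega> in N. Y 1 \<omega> = c)"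
    and Y_paths: "sample_path Y \<in> measurable N skorohod_borel"
    and a_tendsto_0: "(a \<longlongrightarrow> 0) (at_right 0)"
    and weak_limit: "weakly_converges skorohod_topology
        M (\<lambda>u. sample_path (scaled_increment X t a u)) (at_right 0) N (sample_path Y)"
begin

abbreviation "SI \<equiv> scaled_increment X t a"

definition V :: "real \<Rightarrow> real \<Rightarrow> real" where
  "V u r = expectation (\<lambda>\<omega>. (SI u r \<omega>)\<^sup>2)"

definition D :: "real \<Rightarrow> real \<Rightarrow> real \<Rightarrow> real" where
  "D u r r' = expectation (\<lambda>\<omega>. (SI u r \<omega> - SI u r' \<omega>)\<^sup>2)"

lemma eventually_small: "0 < b \<Longrightarrow> \<forall>\<^sub>F u in at_right (0::real). 0 < u \<and> u < b"
  using eventually_at_right_real[of 0 b] by simp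

lemma Y_cadlag: "cadlag_process N Y"
proof -
  have "{U. openin skorohod_topology U} \<subseteq> Pow cadlag"
    using openin_subset[of skorohod_topology] Metric_space.topspace_mtopology[OF Metric_space_skorohod]
    unfolding skorohod_topology_def by blast
  then have "space skorohod_borel = cadlag" by (simp add: skorohod_borel_def)
  then show ?thesis
    using Y_process measurable_space[OF Y_paths] by (simp add: cadlag_process_def)
qed

lemma prob_space_N: "prob_space N"
  using Y_process by (simp add: stochastic_process_def)

lemma Y_measurable: "0 \<le> r \<Longrightarrow> Y r \<in> borel_measurable N"
  using Y_process by (simp add: stochastic_process_def)

lemma SI_measurable: "0 < u \<Longrightarrow> 0 \<le> r \<Longrightarrow> SI u r \<in> borel_measurable M"
  unfolding scaled_increment_def using t_pos
  by (intro borel_measurable_divide borel_measurable_diff X_measurable borel_measurable_const) auto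

lemma SI_0: "SI u 0 \<omega> = 0"
  by (simp add: scaled_increment_def)

lemma SI_cadlag: "0 < u \<Longrightarrow> cadlag_process M (SI u)"
proof -
  assume u: "0 < u"
  have "sample_path (SI u) \<omega> \<in> cadlag" if \<omega>: "\<omega> \<in> space M" for \<omega>
  proof -
    have "sample_path (SI u) \<omega> = (\<lambda>r\<in>{0..}. (X t \<omega> - sample_path X \<omega> (t + r * u)) / a u)"
      using t_pos u by (auto simp: sample_path_def scaled_increment_def fun_eq_iff restrict_def)
    then show ?thesis using cadlag_affine_time[OF X_paths[OF \<omega>] _ u, of t] t_pos by simp
  qed
  then show ?thesis
    using SI_measurable[OF u] prob_space_axioms by (simp add: cadlag_process_def stochastic_process_def)
qed

lemma SI_combination:
  assumes "0 < u" "finite S" "S \<subseteq> {0..}"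
  shows "centered_normal M (\<lambda>\<omega>. \<Sum>r\<in>S. c r * SI u r \<omega>) (expectation (\<lambda>\<omega>. (\<Sum>r\<in>S. c r * SI u r \<omega>)\<^sup>2))"
proof -
  let ?b = "\<lambda>(r, h). if h then c r / a u else - (c r / a u)"
  let ?s = "\<lambda>(r, h). if h then t else t + r * u"
  have "(\<Sum>p\<in>S \<times> (UNIV :: bool set). ?b p * X (?s p) \<omega>) = (\<Sum>r\<in>S. c r * SI u r \<omega>)" for \<omega>
    unfolding sum.cartesian_product'
    by (intro sum.cong refl) (simp add: UNIV_bool scaled_increment_def diff_divide_distrib right_diff_distrib)
  moreover have "centered_normal M (\<lambda>\<omega>. \<Sum>p\<in>S \<times> (UNIV :: bool set). ?b p * X (?s p) \<omega>)
      (expectation (\<lambda>\<omega>. (\<Sum>p\<in>S \<times> (UNIV :: bool set). ?b p * X (?s p) \<omega>)\<^sup>2))"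
    by (rule X_combination) (use assms t_pos in \<open>auto intro!: add_nonneg_nonneg mult_nonneg_nonneg\<close>)
  ultimately show ?thesis by simp
qed

lemma SI_diff_normal:
  assumes "0 < u" "0 \<le> r" "0 \<le> r'"
  shows "centered_normal M (\<lambda>\<omega>. SI u r \<omega> - SI u r' \<omega>) (D u r r')"
proof -
  let ?b = "\<lambda>h. if h then 1 / a u else - (1 / a u)"
  let ?s = "\<lambda>h. if h then t + r' * u else t + r * u"
  have "(\<Sum>h\<in>(UNIV :: bool set). ?b h * X (?s h) \<omega>) = SI u r \<omega> - SI u r' \<omega>" for \<omega>
    by (simp add: UNIV_bool scaled_increment_def diff_divide_distrib)
  moreover have "centered_normal M (\<lambda>\<omega>. \<Sum>h\<in>(UNIV :: bool set). ?b h * X (?s h) \<omega>)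
      (expectation (\<lambda>\<omega>. (\<Sum>h\<in>(UNIV :: bool set). ?b h * X (?s h) \<omega>)\<^sup>2))"
    by (rule X_combination) (use assms t_pos in \<open>auto intro!: add_nonneg_nonneg mult_nonneg_nonneg\<close>)
  ultimately show ?thesis by (simp add: D_def)
qed

lemma V_eq_D: "V u r = D u r 0"
  by (simp add: V_def D_def SI_0)

lemma SI_normal: "0 < u \<Longrightarrow> 0 \<le> r \<Longrightarrow> centered_normal M (SI u r) (V u r)"
  using SI_diff_normal[of u r 0] by (simp add: SI_0 V_eq_D)

lemma D_commute: "D u r r' = D u r' r"
  by (simp add: D_def power2_commute)

lemma V_nonneg: "0 \<le> V u r"
  by (simp_all add: D_def V_def)

lemma D_eq:
  assumes "0 < u" "0 \<le> r" "r \<le> r'"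
  shows "D u r r' = \<sigma>\<^sup>2 * (t + r * u) powr (2 * \<gamma>) * g ((r' - r) * u / (t + r * u)) / (a u)\<^sup>2"
proof -
  have "D u r r' = expectation (\<lambda>\<omega>. (X (t + r * u) \<omega> - X (t + r' * u) \<omega>)\<^sup>2 / (a u)\<^sup>2)"
    unfolding D_def scaled_increment_def
    by (intro Bochner_Integration.integral_cong refl)
      (simp add: diff_divide_distrib[symmetric] power_divide power2_commute)
  also have "\<dots> = expectation (\<lambda>\<omega>. (X (t + r * u) \<omega> - X (t + r' * u) \<omega>)\<^sup>2) / (a u)\<^sup>2" by simp
  also have "expectation (\<lambda>\<omega>. (X (t + r * u) \<omega> - X (t + r' * u) \<omega>)\<^sup>2) =
      \<sigma>\<^sup>2 * (t + r * u) powr (2 * \<gamma>) * g ((t + r' * u - (t + r * u)) / (t + r * u))"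
    by (rule X_increment_second_moment) (use assms t_pos in \<open>auto intro!: add_pos_nonneg mult_right_mono\<close>)
  also have "t + r' * u - (t + r * u) = (r' - r) * u" by (simp add: algebra_simps)
  finally show ?thesis .
qed

lemma V_eq:
  assumes "0 < u" "0 \<le> r"
  shows "V u r = \<sigma>\<^sup>2 * t powr (2 * \<gamma>) * g (r * u / t) / (a u)\<^sup>2"
  using D_eq[of u 0 r] assms by (simp add: V_eq_D D_commute[of u r])

text \<open>Because the covariance is homogeneous, the variance of an increment between two later times is, up to a factor
close to one, the variance of an increment from the base point over almost the same time.\<close>

lemma D_eq_V:
  assumes "0 < u" "0 \<le> r" "r \<le> r'"
  shows "D u r r' = ((t + r * u) / t) powr (2 * \<gamma>) * V u ((r' - r) * t / (t + r * u))"
proof -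
  have p: "0 < t + r * u" using assms t_pos by (simp add: add_pos_nonneg)
  have "(r' - r) * t / (t + r * u) * u / t = (r' - r) * u / (t + r * u)" using t_pos by simp
  moreover have "0 \<le> (r' - r) * t / (t + r * u)" using p assms t_pos by simp
  ultimately have "V u ((r' - r) * t / (t + r * u)) = \<sigma>\<^sup>2 * t powr (2 * \<gamma>) * g ((r' - r) * u / (t + r * u)) / (a u)\<^sup>2"
    using V_eq[OF assms(1), of "(r' - r) * t / (t + r * u)"] by simp
  moreover have "((t + r * u) / t) powr (2 * \<gamma>) * t powr (2 * \<gamma>) = (t + r * u) powr (2 * \<gamma>)"
    using p t_pos by (simp add: powr_divide)
  ultimately show ?thesis unfolding D_eq[OF assms] by (simp add: field_simps)
qed

lemma V_triangle:
  assumes "0 < u" "0 \<le> r" "0 \<le> r'"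
  shows "V u r \<le> 2 * V u r' + 2 * D u r r'"
proof -
  have I: "integrable M (\<lambda>\<omega>. (SI u r' \<omega>)\<^sup>2)" "integrable M (\<lambda>\<omega>. (SI u r \<omega>)\<^sup>2)"
    "integrable M (\<lambda>\<omega>. (SI u r \<omega> - SI u r' \<omega>)\<^sup>2)"
    using assms by (intro centered_normal_square_integrable[OF SI_normal]
        centered_normal_square_integrable[OF SI_diff_normal]; simp)+
  have "V u r \<le> expectation (\<lambda>\<omega>. 2 * (SI u r' \<omega>)\<^sup>2 + 2 * (SI u r \<omega> - SI u r' \<omega>)\<^sup>2)"
    unfolding V_def
  proof (rule integral_mono)
    have "x\<^sup>2 \<le> 2 * y\<^sup>2 + 2 * (x - y)\<^sup>2" for x y :: real
      using zero_le_power2[of "x - 2 * y"] by (simp add: power2_eq_square algebra_simps)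
    then show "(SI u r \<omega>)\<^sup>2 \<le> 2 * (SI u r' \<omega>)\<^sup>2 + 2 * (SI u r \<omega> - SI u r' \<omega>)\<^sup>2" for \<omega> .
  qed (use I in auto)
  also have "\<dots> = 2 * V u r' + 2 * D u r r'" using I by (simp add: V_def D_def)
  finally show ?thesis .
qed

lemma D_le_V:
  assumes u: "0 < u" and r: "0 \<le> r" "r \<le> r'" "r * u \<le> t"
  shows "D u r r' \<le> 4 * V u ((r' - r) * t / (t + r * u))"
proof -
  have "((t + r * u) / t) powr (2 * \<gamma>) \<le> 2 powr (2 * \<gamma>)"
    using t_pos u r gamma by (intro powr_mono2) (auto simp: field_simps)
  also have "\<dots> \<le> 2 powr 2" using gamma by (intro powr_mono) auto
  finally show ?thesis
    unfolding D_eq_V[OF u r(1,2)] using V_nonneg by (intro mult_right_mono) auto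
qed

text \<open>Evaluation at a fixed time is not Skorohod continuous, so the limit only shows that \<open>V u\<close> is small on
average over \<open>[0, \<epsilon>]\<close>. But \<open>V u r\<close> is at most \<open>2 * V u r' + 8 * V u s\<close> with \<open>s\<close> roughly \<open>r' - r\<close>, for
every \<open>r'\<close> in \<open>[\<epsilon> / 2, \<epsilon>]\<close>. If \<open>V u r\<close> were large for one \<open>r \<le> \<epsilon> / 2\<close>, then for all these \<open>r'\<close> one of the
two terms would be large, which contradicts smallness on average.\<close>

lemma V_small:
  assumes \<eta>: "0 < \<eta>"
  shows "\<exists>\<epsilon>>0. \<forall>\<^sub>F u in at_right 0. \<forall>r\<in>{0..\<epsilon>}. V u r \<le> \<eta>"
proof -
  \<comment> \<open>If \<open>V u r \<ge> \<eta> / 16\<close>, then \<open>1 - E (cos (SI u r)) \<ge> c\<close>.\<close>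
  define c where "c = 1 - exp (- (\<eta> / 32))"
  have c: "0 < c" using \<eta> by (simp add: c_def)
  \<comment> \<open>The average over times \<open>r\<close> of \<open>E (cos (SI u r)) = exp (- V u r / 2)\<close> tends to that of \<open>E (cos (Y r))\<close>.\<close>
  define \<psi> where "\<psi> x = cos (x 0)" for x :: "real \<Rightarrow> real"
  have \<psi>: "coord_lipschitz {0} 1 \<psi>"
    unfolding coord_lipschitz_def \<psi>_def
  proof (intro allI)
    fix x y :: "real \<Rightarrow> real"
    have "\<bar>cos (x 0) - cos (y 0)\<bar> \<le> \<bar>x 0 - y 0\<bar>" by (rule abs_cos_diff_le)
    then show "\<bar>cos (x 0) - cos (y 0)\<bar> \<le> 1 * (\<Sum>i\<in>{0}. \<bar>x i - y i\<bar>)" by simp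
  qed
  have B: "\<bar>\<psi> x\<bar> \<le> 1" for x by (simp add: \<psi>_def abs_le_iff)
  interpret N: prob_space N by (rule prob_space_N)
  define y where "y r = N.expectation (\<lambda>\<omega>. \<psi> (\<lambda>\<tau>. Y (max 0 (\<tau> + r)) \<omega>))" for r
  define f where "f u r = expectation (\<lambda>\<omega>. \<psi> (\<lambda>\<tau>. SI u (max 0 (\<tau> + r)) \<omega>))" for u r
  have f_eq: "f u r = exp (- (V u r / 2))" if "0 < u" "0 \<le> r" for u r
    using centered_normal_cos_sin(1)[OF SI_normal[OF that], of 1] that by (simp add: f_def \<psi>_def)
  have fm: "f u \<in> borel_measurable borel" if "0 < u" for u
    unfolding f_def by (rule expectation_window(1)[OF _ \<psi> B SI_cadlag[OF that]]) simp
  have ym: "y \<in> borel_measurable borel"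
    unfolding y_def by (rule expectation_window(1)[OF _ \<psi> B Y_cadlag]) simp
  have yB: "\<bar>y r\<bar> \<le> 1" for r
  proof -
    have "(\<lambda>\<omega>. \<psi> (\<lambda>\<tau>. Y (max 0 (\<tau> + r)) \<omega>)) \<in> borel_measurable N"
      by (rule measurable_coord_lipschitz[OF _ \<psi>]) (simp_all add: Y_measurable)
    then have I: "integrable N (\<lambda>\<omega>. \<psi> (\<lambda>\<tau>. Y (max 0 (\<tau> + r)) \<omega>))"
      by (intro N.integrable_const_bound[of _ 1]) (use B in auto)
    have "norm (y r) \<le> N.expectation (\<lambda>\<omega>. norm (\<psi> (\<lambda>\<tau>. Y (max 0 (\<tau> + r)) \<omega>)))"
      unfolding y_def by (intro integral_norm_bound)
    also have "\<dots> \<le> 1"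
      using I B by (intro N.integral_le_const integrable_norm) auto
    finally show ?thesis by simp
  qed
  have "N.expectation (\<lambda>\<omega>. cos (Y 0 \<omega>)) = 1"
  proof (rule tendsto_unique[OF _ evaluation_at_0_expectation_tendsto[OF weak_limit, of cos 1]])
    show "((\<lambda>u. expectation (\<lambda>\<omega>. cos (SI u 0 \<omega>))) \<longlongrightarrow> 1) (at_right 0)"
      by (simp add: SI_0 prob_space)
  qed (auto simp: abs_le_iff intro!: continuous_intros)
  then have "(y \<longlongrightarrow> 1) (at_right 0)"
    using expectation_right_continuous[OF _ _ \<psi> B Y_cadlag] by (simp add: y_def[abs_def] \<psi>_def)
  then have "\<forall>\<^sub>F r in at_right 0. 1 - c / 16 < y r" by (rule order_tendstoD(1)) (use c in simp)
  then obtain b where b: "0 < b" "\<And>r. 0 < r \<Longrightarrow> r < b \<Longrightarrow> 1 - c / 16 < y r"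
    by (auto simp: eventually_at_right_field)
  have "1 - c / 16 < y 0"
    using \<open>N.expectation (\<lambda>\<omega>. cos (Y 0 \<omega>)) = 1\<close> c by (simp add: y_def \<psi>_def)
  with b have yb: "1 - c / 16 < y r" if "0 \<le> r" "r < b" for r using that by (cases "r = 0") auto
  define \<epsilon> where "\<epsilon> = b / 2"
  have \<epsilon>: "0 < \<epsilon>" "\<epsilon> < b" using b by (auto simp: \<epsilon>_def)
  have "\<bar>(LINT r:{0..\<epsilon>}|lborel. y r) - \<epsilon> * 1\<bar> \<le> \<epsilon> * (c / 16)"
  proof (rule window_average_close[OF ym yB])
    show "\<bar>y r - 1\<bar> \<le> c / 16" if "0 \<le> r" "r \<le> \<epsilon>" for r
      using yb[of r] that \<epsilon> yB[of r] by (simp add: abs_le_iff)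
  qed (use \<epsilon> in simp)
  then have "\<epsilon> - \<epsilon> * (c / 8) < (LINT r:{0..\<epsilon>}|lborel. y r)"
    using mult_pos_pos[OF \<epsilon>(1) c] by (simp only: abs_le_iff times_divide_eq_right mult_1_right) linarith
  moreover have "((\<lambda>u. LINT r:{0..\<epsilon>}|lborel. f u r) \<longlongrightarrow> (LINT r:{0..\<epsilon>}|lborel. y r)) (at_right 0)"
    unfolding f_def y_def
    by (rule window_expectation_tendsto[OF _ _ \<psi> B _ weak_limit _ Y_cadlag])
      (use \<epsilon> eventually_small[OF A_pos] SI_cadlag in \<open>auto elim!: eventually_mono\<close>)
  ultimately have ev: "\<forall>\<^sub>F u in at_right 0. \<epsilon> - \<epsilon> * (c / 8) < (LINT r:{0..\<epsilon>}|lborel. f u r)"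
    by (intro order_tendstoD(1))
  have main: "V u r \<le> \<eta>"
    if u: "0 < u" "u < t / (\<epsilon> + 1)" and int: "\<epsilon> - \<epsilon> * (c / 8) < (LINT r:{0..\<epsilon>}|lborel. f u r)"
      and r: "0 \<le> r" "r \<le> \<epsilon> / 2" for u r
  proof (rule ccontr)
    assume big: "\<not> V u r \<le> \<eta>"
    have ru: "r * u \<le> t"
    proof -
      have "r * u \<le> (\<epsilon> + 1) * u" using u r \<epsilon> by (intro mult_right_mono) auto
      also have "\<dots> < t" using u \<epsilon> by (simp add: field_simps)
      finally show ?thesis by simp
    qed
    define k where "k = t / (t + r * u)"
    have pos: "0 < t + r * u" using t_pos u r by (simp add: add_pos_nonneg)
    have k: "0 < k" "k \<le> 1" "1 / k \<le> 2"
      using t_pos u r ru pos by (auto simp: k_def field_simps)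
    define h where "h r = indicator {0..\<epsilon>} r * (1 - f u r)" for r
    have fB: "0 \<le> 1 - f u r" "\<bar>f u r\<bar> \<le> 1" if "0 \<le> r" for r
      using f_eq[OF u(1) that] V_nonneg[of u r] by auto
    have hn: "0 \<le> h r" for r using fB by (auto simp: h_def indicator_def)
    have h_int: "integrable lborel h"
    proof (rule Bochner_Integration.integrable_bound[OF integrable_indicator_interval[where B = 1]])
      show "h \<in> borel_measurable lborel" unfolding h_def using fm[OF u(1)] by measurable
      show "AE r in lborel. norm (h r) \<le> norm (indicat_real {0..\<epsilon>} r *\<^sub>R (1::real))"
        using hn f_eq[OF u(1)] by (intro AE_I2) (auto simp: h_def indicator_def)
    qed
    have h_val: "(LINT r|lborel. h r) < \<epsilon> * c / 8"
    proof -
      have Fi: "set_integrable lborel {0..\<epsilon>} (f u)"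
        unfolding set_integrable_def
        by (rule Bochner_Integration.integrable_bound[OF integrable_indicator_interval[where B = 1]])
          (use fm[OF u(1)] fB(2) in \<open>auto simp: indicator_def\<close>)
      have "(LINT r|lborel. h r) = (LINT r:{0..\<epsilon>}|lborel. 1 - f u r)"
        by (simp add: h_def set_lebesgue_integral_def)
      also have "\<dots> = (LINT r:{0..\<epsilon>}|lborel. 1) - (LINT r:{0..\<epsilon>}|lborel. f u r)"
        using integrable_indicator_interval[where B = 1]
        by (intro set_integral_diff(2) Fi) (simp add: set_integrable_def)
      also have "(LINT r:{0..\<epsilon>}|lborel. (1::real)) = \<epsilon>"
        using \<epsilon> by (simp add: set_lebesgue_integral_def)
      finally show ?thesis using int by simp
    qed
    \<comment> \<open>For \<open>r'\<close> in \<open>[\<epsilon> / 2, \<epsilon>]\<close>, one of the variances at \<open>r'\<close> and at the affine image \<open>k * (r' - r)\<close> is large.\<close>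
    have low: "indicator {\<epsilon>/2..\<epsilon>} r' * c \<le> h r' + h (- (k * r) + k * r')" for r'
    proof (cases "r' \<in> {\<epsilon>/2..\<epsilon>}")
      case True
      define s where "s = (r' - r) * t / (t + r * u)"
      have s: "0 \<le> s" "s \<le> \<epsilon>" "- (k * r) + k * r' = s"
      proof -
        show "0 \<le> s" using True r pos t_pos by (simp add: s_def)
        have "s = (r' - r) * k" by (simp add: s_def k_def)
        also have "\<dots> \<le> (r' - r) * 1" using True r k by (intro mult_left_mono) auto
        finally show "s \<le> \<epsilon>" using True r by simp
        show "- (k * r) + k * r' = s" by (simp add: s_def k_def algebra_simps diff_divide_distrib)
      qed
      have r': "0 \<le> r'" "r \<le> r'" "r' \<le> \<epsilon>" using True r by auto
      have "V u r \<le> 2 * V u r' + 8 * V u s"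
        using V_triangle[OF u(1) r(1) r'(1)] D_le_V[OF u(1) r(1) r'(2) ru] unfolding s_def by linarith
      then have "\<eta> / 16 \<le> V u r' \<or> \<eta> / 16 \<le> V u s" using big \<eta> by linarith
      then have "c \<le> 1 - f u r' \<or> c \<le> 1 - f u s"
        using f_eq[OF u(1) r'(1)] f_eq[OF u(1) s(1)] by (auto simp: c_def)
      then have "c \<le> h r' \<or> c \<le> h s" using r' s by (auto simp: h_def)
      then show ?thesis using True s(3) hn[of r'] hn[of s] by auto
    next
      case False
      then show ?thesis using hn by (simp add: add_nonneg_nonneg)
    qed
    have I2: "integrable lborel (\<lambda>r'. h (- (k * r) + k * r'))"
      using lborel_integrable_real_affine_iff[of k h "- (k * r)"] h_int k by simp
    \<comment> \<open>Integrating \<open>low\<close> over \<open>r'\<close> contradicts \<open>h_val\<close>, as the affine change of variable costs at most a factor 2.\<close>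
    have "\<epsilon> / 2 * c = (LINT r'|lborel. indicator {\<epsilon>/2..\<epsilon>} r' * c)" using \<epsilon> by simp
    also have "\<dots> \<le> (LINT r'|lborel. h r' + h (- (k * r) + k * r'))"
      by (rule integral_mono[OF _ Bochner_Integration.integrable_add[OF h_int I2] low])
        (use integrable_indicator_interval[of "\<epsilon>/2" \<epsilon> c] in simp)
    also have "\<dots> = (LINT r'|lborel. h r') + (LINT r'|lborel. h (- (k * r) + k * r'))"
      by (rule Bochner_Integration.integral_add[OF h_int I2])
    also have "(LINT r'|lborel. h (- (k * r) + k * r')) = (LINT r'|lborel. h r') / k"
      using lborel_integral_real_affine[of k h "- (k * r)"] k by simp
    also have "(LINT r'|lborel. h r') / k \<le> (LINT r'|lborel. h r') * 2"
      using mult_left_mono[OF k(3), of "LINT r'|lborel. h r'"] hn by (simp add: integral_nonneg_AE)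
    finally have "\<epsilon> / 2 * c \<le> 3 * (LINT r'|lborel. h r')" by simp
    then show False using h_val mult_pos_pos[OF \<epsilon>(1) c] by simp
  qed
  have "\<forall>\<^sub>F u in at_right 0. \<forall>r\<in>{0..\<epsilon>/2}. V u r \<le> \<eta>"
  proof -
    have "0 < t / (\<epsilon> + 1)" using t_pos \<epsilon> by simp
    from ev eventually_small[OF this] show ?thesis
      by eventually_elim (use main in auto)
  qed
  then show ?thesis using \<epsilon> by (intro exI[of _ "\<epsilon> / 2"]) simp
qed

end

section \<open>Equicontinuity and convergence of the finite-dimensional distributions\<close>

context small_scale_convergence
begin

text \<open>By homogeneity, increments between arbitrary times in \<open>[0, R]\<close> are controlled by increments from the base
point.\<close>

lemma D_small:
  assumes \<eta>: "0 < \<eta>"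
  shows "\<exists>\<delta>>0. \<forall>\<^sub>F u in at_right 0. \<forall>r\<in>{0..R}. \<forall>r'\<in>{0..R}. \<bar>r - r'\<bar> \<le> \<delta> \<longrightarrow> D u r r' \<le> \<eta>"
proof -
  obtain \<delta> where \<delta>: "0 < \<delta>" "\<forall>\<^sub>F u in at_right 0. \<forall>r\<in>{0..\<delta>}. V u r \<le> \<eta> / 4"
    using V_small[of "\<eta> / 4"] \<eta> by auto
  have "0 < t / (\<bar>R\<bar> + 1)" using t_pos by (simp add: add_nonneg_pos)
  from \<delta>(2) eventually_small[OF this]
  have "\<forall>\<^sub>F u in at_right 0. \<forall>r\<in>{0..R}. \<forall>r'\<in>{0..R}. \<bar>r - r'\<bar> \<le> \<delta> \<longrightarrow> D u r r' \<le> \<eta>"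
  proof eventually_elim
    case (elim u)
    have *: "D u r r' \<le> \<eta>" if r: "0 \<le> r" "r \<le> r'" "r' \<le> R" "r' - r \<le> \<delta>" for r r'
    proof -
      have "r * u \<le> (\<bar>R\<bar> + 1) * u" using r elim by (intro mult_right_mono) auto
      also have "\<dots> \<le> t" using elim by (simp add: field_simps)
      finally have ru: "r * u \<le> t" .
      have p: "0 < t + r * u" using t_pos r elim by (simp add: add_pos_nonneg)
      have "(r' - r) * (t / (t + r * u)) \<le> (r' - r) * 1"
        using p r elim by (intro mult_left_mono) auto
      then have "(r' - r) * t / (t + r * u) \<in> {0..\<delta>}" using p r t_pos by simp
      then have "V u ((r' - r) * t / (t + r * u)) \<le> \<eta> / 4" using elim by blast
      moreover have "D u r r' \<le> 4 * V u ((r' - r) * t / (t + r * u))"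
        by (rule D_le_V[OF _ r(1,2) ru]) (use elim in simp)
      ultimately show ?thesis by linarith
    qed
    show ?case
    proof (intro ballI impI)
      fix r r' assume "r \<in> {0..R}" "r' \<in> {0..R}" "\<bar>r - r'\<bar> \<le> \<delta>"
      then show "D u r r' \<le> \<eta>" using *[of r r'] *[of r' r] D_commute[of u r r'] by (cases "r \<le> r'") auto
    qed
  qed
  then show ?thesis using \<delta>(1) by blast
qed

text \<open>Chaining: the time from \<open>0\<close> to \<open>R\<close> is covered by a fixed number of steps of length \<open>\<delta>\<close>, each of
small variance.\<close>

lemma V_bounded: "\<exists>C. \<forall>\<^sub>F u in at_right 0. \<forall>r\<in>{0..R}. V u r \<le> C"
proof -
  obtain \<delta> where \<delta>: "0 < \<delta>"
    "\<forall>\<^sub>F u in at_right 0. \<forall>r\<in>{0..R}. \<forall>r'\<in>{0..R}. \<bar>r - r'\<bar> \<le> \<delta> \<longrightarrow> D u r r' \<le> 1"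
    using D_small[of 1 R] by auto
  have "\<exists>C\<ge>0. \<forall>\<^sub>F u in at_right 0. \<forall>r\<in>{0..R}. r \<le> real n * \<delta> \<longrightarrow> V u r \<le> C" for n
  proof (induction n)
    case 0
    have "V u 0 = 0" for u by (simp add: V_def SI_0)
    then show ?case by (intro exI[of _ 0] conjI order_refl always_eventually) auto
  next
    case (Suc n)
    then obtain C where C: "0 \<le> C" "\<forall>\<^sub>F u in at_right 0. \<forall>r\<in>{0..R}. r \<le> real n * \<delta> \<longrightarrow> V u r \<le> C" by blast
    from C(2) \<delta>(2) eventually_small[OF A_pos]
    have "\<forall>\<^sub>F u in at_right 0. \<forall>r\<in>{0..R}. r \<le> real (Suc n) * \<delta> \<longrightarrow> V u r \<le> 2 * C + 2"
    proof eventually_elim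
      case (elim u)
      show ?case
      proof (intro ballI impI)
        fix r assume r: "r \<in> {0..R}" "r \<le> real (Suc n) * \<delta>"
        show "V u r \<le> 2 * C + 2"
        proof (cases "r \<le> real n * \<delta>")
          case True
          then have "V u r \<le> C" using elim(1) r(1) by blast
          then show ?thesis using C(1) by linarith
        next
          case False
          define r' where "r' = max 0 (r - \<delta>)"
          have r': "r' \<in> {0..R}" "r' \<le> real n * \<delta>" "\<bar>r - r'\<bar> \<le> \<delta>"
            using r \<delta>(1) by (auto simp: r'_def max_def algebra_simps)
          have "V u r \<le> 2 * V u r' + 2 * D u r r'"
            using V_triangle[of u r r'] elim r r' by simp
          moreover have "V u r' \<le> C" using elim(1) r' by blast
          moreover have "D u r r' \<le> 1" using elim(2) r(1) r'(1,3) by blast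
          ultimately show ?thesis by linarith
        qed
      qed
    qed
    then show ?case using C(1) by (intro exI[of _ "2 * C + 2"]) simp
  qed
  note bnd = this
  obtain n where n: "R < real n * \<delta>" using reals_Archimedean3[OF \<delta>(1)] by blast
  obtain C where "\<forall>\<^sub>F u in at_right 0. \<forall>r\<in>{0..R}. r \<le> real n * \<delta> \<longrightarrow> V u r \<le> C"
    using bnd[of n] by blast
  then have "\<forall>\<^sub>F u in at_right 0. \<forall>r\<in>{0..R}. V u r \<le> C"
    by (rule eventually_mono) (use n in auto)
  then show ?thesis ..
qed

lemma coord_lipschitz_increment:
  assumes S: "finite S" "S \<subseteq> {0..}" and \<psi>: "coord_lipschitz S K \<psi>" and B: "\<And>x. \<bar>\<psi> x\<bar> \<le> B"
    and u: "0 < u" and \<alpha>: "0 < \<alpha>" and s: "\<And>i. i \<in> S \<Longrightarrow> 0 \<le> s i"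
    and D: "\<And>i. i \<in> S \<Longrightarrow> D u (s i) i \<le> \<alpha>\<^sup>2"
  shows "\<bar>expectation (\<lambda>\<omega>. \<psi> (\<lambda>i. SI u (s i) \<omega>)) - expectation (\<lambda>\<omega>. \<psi> (\<lambda>i. SI u i \<omega>))\<bar>
    \<le> \<bar>K\<bar> * (real (card S) * (2 * \<alpha>))"
proof -
  have m: "SI u (s i) \<in> borel_measurable M" "SI u i \<in> borel_measurable M" if "i \<in> S" for i
    using that S s u by (auto intro!: SI_measurable)
  have I: "integrable M (\<lambda>\<omega>. \<psi> (\<lambda>i. SI u (s i) \<omega>))" "integrable M (\<lambda>\<omega>. \<psi> (\<lambda>i. SI u i \<omega>))"
    by (rule integrable_const_bound[of _ B]; use B m in \<open>auto intro!: measurable_coord_lipschitz[OF S(1) \<psi>]\<close>)+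
  have J: "integrable M (\<lambda>\<omega>. \<bar>SI u (s i) \<omega> - SI u i \<omega>\<bar>)"
    "expectation (\<lambda>\<omega>. \<bar>SI u (s i) \<omega> - SI u i \<omega>\<bar>) \<le> 2 * \<alpha>" if i: "i \<in> S" for i
  proof -
    have n: "centered_normal M (\<lambda>\<omega>. SI u (s i) \<omega> - SI u i \<omega>) (D u (s i) i)"
      using i S s u by (intro SI_diff_normal) auto
    note ab = integral_abs_le_second_moment[OF prob_space_axioms _ centered_normal_square_integrable[OF n] \<alpha>]
    show "integrable M (\<lambda>\<omega>. \<bar>SI u (s i) \<omega> - SI u i \<omega>\<bar>)" by (rule ab(1)) (use m[OF i] in measurable)
    have "expectation (\<lambda>\<omega>. \<bar>SI u (s i) \<omega> - SI u i \<omega>\<bar>) \<le> \<alpha> + D u (s i) i / \<alpha>"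
      unfolding D_def by (rule ab(2)) (use m[OF i] in measurable)
    also have "D u (s i) i / \<alpha> \<le> \<alpha>\<^sup>2 / \<alpha>" using D[OF i] \<alpha> by (intro divide_right_mono) auto
    finally show "expectation (\<lambda>\<omega>. \<bar>SI u (s i) \<omega> - SI u i \<omega>\<bar>) \<le> 2 * \<alpha>"
      using \<alpha> by (simp add: power2_eq_square)
  qed
  have "\<bar>expectation (\<lambda>\<omega>. \<psi> (\<lambda>i. SI u (s i) \<omega>)) - expectation (\<lambda>\<omega>. \<psi> (\<lambda>i. SI u i \<omega>))\<bar>
      = norm (expectation (\<lambda>\<omega>. \<psi> (\<lambda>i. SI u (s i) \<omega>) - \<psi> (\<lambda>i. SI u i \<omega>)))"
    using I by simp
  also have "\<dots> \<le> expectation (\<lambda>\<omega>. norm (\<psi> (\<lambda>i. SI u (s i) \<omega>) - \<psi> (\<lambda>i. SI u i \<omega>)))"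
    by (rule integral_norm_bound)
  also have "\<dots> \<le> expectation (\<lambda>\<omega>. \<bar>K\<bar> * (\<Sum>i\<in>S. \<bar>SI u (s i) \<omega> - SI u i \<omega>\<bar>))"
  proof (rule integral_mono)
    show "norm (\<psi> (\<lambda>i. SI u (s i) \<omega>) - \<psi> (\<lambda>i. SI u i \<omega>)) \<le> \<bar>K\<bar> * (\<Sum>i\<in>S. \<bar>SI u (s i) \<omega> - SI u i \<omega>\<bar>)" for \<omega>
    proof -
      have "K * (\<Sum>i\<in>S. \<bar>SI u (s i) \<omega> - SI u i \<omega>\<bar>) \<le> \<bar>K\<bar> * (\<Sum>i\<in>S. \<bar>SI u (s i) \<omega> - SI u i \<omega>\<bar>)"
        by (intro mult_right_mono sum_nonneg) auto
      then show ?thesis using coord_lipschitzD[OF \<psi>, of "\<lambda>i. SI u (s i) \<omega>" "\<lambda>i. SI u i \<omega>"] by simp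
    qed
  qed (use I J(1) in \<open>auto intro!: Bochner_Integration.integrable_sum\<close>)
  also have "\<dots> = \<bar>K\<bar> * (\<Sum>i\<in>S. expectation (\<lambda>\<omega>. \<bar>SI u (s i) \<omega> - SI u i \<omega>\<bar>))"
    using J(1) by (simp add: Bochner_Integration.integral_sum)
  also have "\<dots> \<le> \<bar>K\<bar> * (real (card S) * (2 * \<alpha>))"
    by (intro mult_left_mono sum_bounded_above J) auto
  finally show ?thesis .
qed

text \<open>Equicontinuity allows the expectation at times \<open>\<tau>\<close> to be replaced, uniformly in \<open>u\<close>, by its average over the times
\<open>\<tau> + r\<close> with \<open>0 \<le> r \<le> \<epsilon>\<close>; the averages converge. For the limit the replacement is justified by right-continuity.\<close>

lemma coord_lipschitz_convergence:
  assumes S: "finite S" "S \<subseteq> {0..}" and \<psi>: "coord_lipschitz S K \<psi>" and B: "\<And>x. \<bar>\<psi> x\<bar> \<le> B"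
  shows "((\<lambda>u. expectation (\<lambda>\<omega>. \<psi> (\<lambda>i. SI u i \<omega>))) \<longlongrightarrow> (LINT \<omega>|N. \<psi> (\<lambda>i. Y i \<omega>))) (at_right 0)"
proof (rule tendstoI)
  fix e :: real assume e: "0 < e"
  define \<alpha> where "\<alpha> = e / (8 * (\<bar>K\<bar> * real (card S) + 1))"
  have pos: "0 < \<bar>K\<bar> * real (card S) + 1" by (intro add_nonneg_pos mult_nonneg_nonneg) auto
  have \<alpha>: "0 < \<alpha>" "\<bar>K\<bar> * (real (card S) * (2 * \<alpha>)) \<le> e / 4"
  proof -
    show "0 < \<alpha>" using pos e by (simp add: \<alpha>_def)
    have "\<bar>K\<bar> * (real (card S) * (2 * \<alpha>)) \<le> (\<bar>K\<bar> * real (card S) + 1) * (2 * \<alpha>)"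
      using \<open>0 < \<alpha>\<close> by (simp add: algebra_simps)
    also have "\<dots> = e / 4" using pos by (simp add: \<alpha>_def field_simps)
    finally show "\<bar>K\<bar> * (real (card S) * (2 * \<alpha>)) \<le> e / 4" .
  qed
  obtain R where R: "\<And>i. i \<in> S \<Longrightarrow> i \<le> R"
    using S(1) bdd_above_finite[OF S(1)] by (auto simp: bdd_above_def)
  have "0 < \<alpha>\<^sup>2" using \<alpha> by simp
  from D_small[OF this, of "R + 1"]
  obtain \<delta> where \<delta>: "0 < \<delta>"
    "\<forall>\<^sub>F u in at_right 0. \<forall>r\<in>{0..R+1}. \<forall>r'\<in>{0..R+1}. \<bar>r - r'\<bar> \<le> \<delta> \<longrightarrow> D u r r' \<le> \<alpha>\<^sup>2" by blast
  define y where "y r = (LINT \<omega>|N. \<psi> (\<lambda>\<tau>. Y (max 0 (\<tau> + r)) \<omega>))" for r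
  define f where "f u r = expectation (\<lambda>\<omega>. \<psi> (\<lambda>\<tau>. SI u (max 0 (\<tau> + r)) \<omega>))" for u r
  define y0 where "y0 = (LINT \<omega>|N. \<psi> (\<lambda>\<tau>. Y \<tau> \<omega>))"
  define f0 where "f0 u = expectation (\<lambda>\<omega>. \<psi> (\<lambda>\<tau>. SI u \<tau> \<omega>))" for u
  have expB: "\<bar>LINT \<omega>|P. \<psi> (\<lambda>\<tau>. Z \<tau> \<omega>)\<bar> \<le> B"
    if P: "prob_space P" and Z: "\<And>i. Z i \<in> borel_measurable P" for P :: "'d measure" and Z
  proof -
    interpret P: prob_space P by fact
    have "integrable P (\<lambda>\<omega>. \<psi> (\<lambda>\<tau>. Z \<tau> \<omega>))"
      by (rule P.integrable_const_bound[of _ B]) (use B Z in \<open>auto intro!: measurable_coord_lipschitz[OF S(1) \<psi>]\<close>)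
    then have "(LINT \<omega>|P. norm (\<psi> (\<lambda>\<tau>. Z \<tau> \<omega>))) \<le> B"
      using B by (intro P.integral_le_const integrable_norm) auto
    moreover have "norm (LINT \<omega>|P. \<psi> (\<lambda>\<tau>. Z \<tau> \<omega>)) \<le> (LINT \<omega>|P. norm (\<psi> (\<lambda>\<tau>. Z \<tau> \<omega>)))"
      by (rule integral_norm_bound)
    ultimately have "norm (LINT \<omega>|P. \<psi> (\<lambda>\<tau>. Z \<tau> \<omega>)) \<le> B" by (rule order_trans[rotated])
    then show ?thesis by simp
  qed
  have yB: "\<bar>y r\<bar> \<le> B" for r unfolding y_def by (rule expB[OF prob_space_N]) (simp add: Y_measurable)
  have fB: "\<bar>f u r\<bar> \<le> B" if "0 < u" for u r
    unfolding f_def by (rule expB[OF prob_space_axioms]) (simp add: SI_measurable that)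
  have "(y \<longlongrightarrow> y0) (at_right 0)"
    using expectation_right_continuous[OF S \<psi> B Y_cadlag] by (simp add: y_def[abs_def] y0_def)
  then have "\<forall>\<^sub>F r in at_right 0. dist (y r) y0 < e / 4" by (rule tendstoD) (use e in simp)
  then obtain b where b: "0 < b" "\<And>r. 0 < r \<Longrightarrow> r < b \<Longrightarrow> \<bar>y r - y0\<bar> \<le> e / 4"
    by (fastforce simp: eventually_at_right_field dist_real_def)
  have "y 0 = y0"
    unfolding y_def y0_def
    by (intro Bochner_Integration.integral_cong refl coord_lipschitz_cong[OF \<psi>]) (use S in auto)
  with b e have yb: "\<bar>y r - y0\<bar> \<le> e / 4" if "0 \<le> r" "r < b" for r using that by (cases "r = 0") auto
  define \<epsilon> where "\<epsilon> = min (b / 2) (min \<delta> 1)"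
  have \<epsilon>: "0 < \<epsilon>" "\<epsilon> < b" "\<epsilon> \<le> \<delta>" "\<epsilon> \<le> 1" using b \<delta> by (auto simp: \<epsilon>_def)
  have ycl: "\<bar>(LINT r:{0..\<epsilon>}|lborel. y r) - \<epsilon> * y0\<bar> \<le> \<epsilon> * (e / 4)"
  proof (rule window_average_close)
    show "y \<in> borel_measurable borel" unfolding y_def by (rule expectation_window(1)[OF S(1) \<psi> B Y_cadlag])
  qed (use yB yb \<epsilon> in auto)
  have "((\<lambda>u. LINT r:{0..\<epsilon>}|lborel. f u r) \<longlongrightarrow> (LINT r:{0..\<epsilon>}|lborel. y r)) (at_right 0)"
    unfolding f_def y_def
    by (rule window_expectation_tendsto[OF S \<psi> B _ weak_limit _ Y_cadlag])
      (use \<epsilon> eventually_small[OF A_pos] SI_cadlag in \<open>auto elim!: eventually_mono\<close>)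
  then have "\<forall>\<^sub>F u in at_right 0. dist (LINT r:{0..\<epsilon>}|lborel. f u r) (LINT r:{0..\<epsilon>}|lborel. y r) < \<epsilon> * (e / 4)"
    by (rule tendstoD) (use \<epsilon> e in simp)
  then show "\<forall>\<^sub>F u in at_right 0. dist (expectation (\<lambda>\<omega>. \<psi> (\<lambda>i. SI u i \<omega>))) (LINT \<omega>|N. \<psi> (\<lambda>i. Y i \<omega>)) < e"
    using \<delta>(2) eventually_small[OF A_pos]
  proof eventually_elim
    case (elim u)
    have u: "0 < u" using elim by simp
    have fcl: "\<bar>(LINT r:{0..\<epsilon>}|lborel. f u r) - \<epsilon> * f0 u\<bar> \<le> \<epsilon> * (e / 4)"
    proof (rule window_average_close)
      show "f u \<in> borel_measurable borel"
        unfolding f_def by (rule expectation_window(1)[OF S(1) \<psi> B SI_cadlag[OF u]])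
      fix r assume r: "0 \<le> r" "r \<le> \<epsilon>"
      have "\<bar>f u r - f0 u\<bar> \<le> \<bar>K\<bar> * (real (card S) * (2 * \<alpha>))"
        unfolding f_def f0_def
      proof (rule coord_lipschitz_increment[OF S \<psi> B u \<alpha>(1)])
        fix i assume i: "i \<in> S"
        then have "0 \<le> i" "i \<le> R" using S R by auto
        then show "D u (max 0 (i + r)) i \<le> \<alpha>\<^sup>2"
          using elim(2) r \<epsilon> by (auto simp: max_def)
      qed simp
      then show "\<bar>f u r - f0 u\<bar> \<le> e / 4" using \<alpha>(2) by linarith
    qed (use fB[OF u] \<epsilon> in auto)
    have "\<bar>\<epsilon> * f0 u - \<epsilon> * y0\<bar> < \<epsilon> * e"
      using fcl ycl elim(1) mult_pos_pos[OF \<epsilon>(1) e] unfolding dist_real_def by linarith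
    then have "\<epsilon> * \<bar>f0 u - y0\<bar> < \<epsilon> * e"
      using \<epsilon>(1) by (simp add: abs_mult right_diff_distrib[symmetric])
    then show ?case using \<epsilon>(1) by (simp add: f0_def y0_def dist_real_def)
  qed
qed

lemma fdd_convergence: "fdd_converges M SI (at_right 0) N Y"
  unfolding fdd_converges_def
proof (intro allI impI, elim conjE)
  fix S :: "real set" assume S: "finite S" "S \<subseteq> {0..}"
  show "weakly_converges (product_topology (\<lambda>_. euclideanreal) S) M (\<lambda>u \<omega>. \<lambda>\<tau>\<in>S. SI u \<tau> \<omega>)
      (at_right 0) N (\<lambda>\<omega>. \<lambda>\<tau>\<in>S. Y \<tau> \<omega>)"
  proof (rule weakly_converges_coordsI[OF S(1) prob_space_axioms prob_space_N])
    show "\<forall>\<^sub>F u in at_right 0. \<forall>i\<in>S. SI u i \<in> borel_measurable M"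
      using eventually_small[OF A_pos] by eventually_elim (use S SI_measurable in auto)
    show "Y i \<in> borel_measurable N" if "i \<in> S" for i using that S by (auto intro: Y_measurable)
  qed (rule coord_lipschitz_convergence[OF S])
qed

end

section \<open>The Gaussian limit\<close>

context small_scale_convergence
begin

definition v :: "real \<Rightarrow> real" where
  "v r = (LINT \<omega>|N. (Y r \<omega>)\<^sup>2)"

lemma eventually_pos: "\<forall>\<^sub>F u in at_right (0::real). 0 < u"
  by (rule eventually_at_right_less)

lemma Y_combination:
  assumes S: "finite S" "S \<subseteq> {0..}"
  shows "centered_normal N (\<lambda>\<omega>. \<Sum>i\<in>S. c i * Y i \<omega>) (LINT \<omega>|N. (\<Sum>i\<in>S. c i * Y i \<omega>)\<^sup>2)"
    and "((\<lambda>u. expectation (\<lambda>\<omega>. (\<Sum>i\<in>S. c i * SI u i \<omega>)\<^sup>2)) \<longlongrightarrow> (LINT \<omega>|N. (\<Sum>i\<in>S. c i * Y i \<omega>)\<^sup>2)) (at_right 0)"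
proof -
  have 1: "(\<lambda>\<omega>. \<Sum>i\<in>S. c i * Y i \<omega>) \<in> borel_measurable N"
    using S by (intro borel_measurable_sum borel_measurable_times borel_measurable_const Y_measurable) auto
  have 2: "\<forall>\<^sub>F u in at_right 0. centered_normal M (\<lambda>\<omega>. \<Sum>i\<in>S. c i * SI u i \<omega>) (expectation (\<lambda>\<omega>. (\<Sum>i\<in>S. c i * SI u i \<omega>)\<^sup>2))"
    using eventually_pos by eventually_elim (rule SI_combination[OF _ S])
  have 3: "((\<lambda>u. expectation (\<lambda>\<omega>. cos (\<theta> * (\<Sum>i\<in>S. c i * SI u i \<omega>)))) \<longlongrightarrow> (LINT \<omega>|N. cos (\<theta> * (\<Sum>i\<in>S. c i * Y i \<omega>)))) (at_right 0)" for \<theta>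
    by (rule coord_lipschitz_convergence[OF S coord_lipschitz_of_combination[OF abs_cos_diff_le S(1)], where B = 1]) simp
  have 4: "((\<lambda>u. expectation (\<lambda>\<omega>. sin (\<theta> * (\<Sum>i\<in>S. c i * SI u i \<omega>)))) \<longlongrightarrow> (LINT \<omega>|N. sin (\<theta> * (\<Sum>i\<in>S. c i * Y i \<omega>)))) (at_right 0)" for \<theta>
    by (rule coord_lipschitz_convergence[OF S coord_lipschitz_of_combination[OF abs_sin_diff_le S(1)], where B = 1]) simp
  show "centered_normal N (\<lambda>\<omega>. \<Sum>i\<in>S. c i * Y i \<omega>) (LINT \<omega>|N. (\<Sum>i\<in>S. c i * Y i \<omega>)\<^sup>2)"
    by (rule centered_normal_limit(1)[OF trivial_limit_at_right_real prob_space_N 1 2 3 4])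
  show "((\<lambda>u. expectation (\<lambda>\<omega>. (\<Sum>i\<in>S. c i * SI u i \<omega>)\<^sup>2)) \<longlongrightarrow> (LINT \<omega>|N. (\<Sum>i\<in>S. c i * Y i \<omega>)\<^sup>2)) (at_right 0)"
    by (rule centered_normal_limit(2)[OF trivial_limit_at_right_real prob_space_N 1 2 3 4])
qed

lemma Y_normal: "0 \<le> r \<Longrightarrow> centered_normal N (Y r) (v r)"
  and V_tendsto: "0 \<le> r \<Longrightarrow> ((\<lambda>u. V u r) \<longlongrightarrow> v r) (at_right 0)"
  using Y_combination[of "{r}" "\<lambda>_. 1"] by (simp_all add: v_def V_def)

lemma v_nonneg: "0 \<le> v r"
  by (simp add: v_def)

lemma
  assumes "0 \<le> r" "0 \<le> r'"
  shows D_tendsto: "((\<lambda>u. D u r r') \<longlongrightarrow> (LINT \<omega>|N. (Y r \<omega> - Y r' \<omega>)\<^sup>2)) (at_right 0)"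
    and Y_diff_normal: "centered_normal N (\<lambda>\<omega>. Y r \<omega> - Y r' \<omega>) (LINT \<omega>|N. (Y r \<omega> - Y r' \<omega>)\<^sup>2)"
proof -
  let ?c = "\<lambda>i. if i = r then 1 else - 1 :: real"
  have ne: "(\<Sum>i\<in>{r, r'}. ?c i * f i) = f r - f r'" if "r \<noteq> r'" for f :: "real \<Rightarrow> real" using that by simp
  show "((\<lambda>u. D u r r') \<longlongrightarrow> (LINT \<omega>|N. (Y r \<omega> - Y r' \<omega>)\<^sup>2)) (at_right 0)"
  proof (cases "r = r'")
    case False
    have "{r, r'} \<subseteq> {0..}" using assms by auto
    from Y_combination(2)[OF _ this, of ?c] show ?thesis
      unfolding ne[OF False] D_def by simp
  qed (simp add: D_def)
  show "centered_normal N (\<lambda>\<omega>. Y r \<omega> - Y r' \<omega>) (LINT \<omega>|N. (Y r \<omega> - Y r' \<omega>)\<^sup>2)"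
  proof (cases "r = r'")
    case False
    have "{r, r'} \<subseteq> {0..}" using assms by auto
    from Y_combination(1)[OF _ this, of ?c] show ?thesis
      unfolding ne[OF False] by simp
  qed (simp add: centered_normal_AE_0[OF prob_space_N])
qed

text \<open>Values of the characteristic function at two close times differ by at most the mean distance of the
increments, which is controlled uniformly in \<open>u\<close>.\<close>

lemma V_tendsto_along:
  assumes s: "(s \<longlongrightarrow> x) (at_right 0)" "\<forall>\<^sub>F u in at_right 0. 0 \<le> s u" and x: "0 \<le> x"
  shows "((\<lambda>u. V u (s u)) \<longlongrightarrow> v x) (at_right 0)"
proof -
  have \<psi>: "coord_lipschitz {x} 1 (\<lambda>y. cos (y x))"
    using abs_cos_diff_le by (simp add: coord_lipschitz_def)
  have "((\<lambda>u. exp (- (V u (s u) / 2)) - exp (- (V u x / 2))) \<longlongrightarrow> 0) (at_right 0)"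
  proof (rule tendstoI)
    fix e :: real assume e: "0 < e"
    define \<alpha> where "\<alpha> = e / 4"
    have \<alpha>: "0 < \<alpha>" "2 * \<alpha> < e" using e by (auto simp: \<alpha>_def)
    have "0 < \<alpha>\<^sup>2" using \<alpha> by simp
    from D_small[OF this, of "x + 1"] obtain \<delta> where \<delta>: "0 < \<delta>"
      "\<forall>\<^sub>F u in at_right 0. \<forall>r\<in>{0..x+1}. \<forall>r'\<in>{0..x+1}. \<bar>r - r'\<bar> \<le> \<delta> \<longrightarrow> D u r r' \<le> \<alpha>\<^sup>2" by blast
    have "\<forall>\<^sub>F u in at_right 0. dist (s u) x < min \<delta> 1" by (rule tendstoD[OF s(1)]) (use \<delta> in simp)
    then show "\<forall>\<^sub>F u in at_right 0. dist (exp (- (V u (s u) / 2)) - exp (- (V u x / 2))) 0 < e"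
      using \<delta>(2) s(2) eventually_pos
    proof eventually_elim
      case (elim u)
      have "s u \<in> {0..x+1}" "x \<in> {0..x+1}" "\<bar>s u - x\<bar> \<le> \<delta>"
        using elim x by (auto simp: dist_real_def)
      then have "D u (s u) x \<le> \<alpha>\<^sup>2" using elim(2) by blast
      then have "\<bar>expectation (\<lambda>\<omega>. cos (SI u (s u) \<omega>)) - expectation (\<lambda>\<omega>. cos (SI u x \<omega>))\<bar> \<le> \<bar>1\<bar> * (real (card {x}) * (2 * \<alpha>))"
        using elim x by (intro coord_lipschitz_increment[OF _ _ \<psi>, where s = "\<lambda>_. s u" and B = 1] \<alpha>) auto
      moreover have "expectation (\<lambda>\<omega>. cos (SI u r \<omega>)) = exp (- (V u r / 2))" if "0 \<le> r" for r
        using centered_normal_cos_sin(1)[OF SI_normal[OF elim(4) that], of 1] by simp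
      ultimately show ?case using \<alpha>(2) elim x by (simp add: dist_real_def)
    qed
  qed
  moreover have "((\<lambda>u. exp (- (V u x / 2))) \<longlongrightarrow> exp (- (v x / 2))) (at_right 0)"
    by (intro tendsto_intros V_tendsto x) simp
  ultimately have "((\<lambda>u. exp (- (V u (s u) / 2)) - exp (- (V u x / 2)) + exp (- (V u x / 2))) \<longlongrightarrow> 0 + exp (- (v x / 2))) (at_right 0)"
    by (rule tendsto_add)
  then have e: "((\<lambda>u. exp (- (V u (s u) / 2))) \<longlongrightarrow> exp (- (v x / 2))) (at_right 0)" by simp
  have "((\<lambda>u. - 2 * ln (exp (- (V u (s u) / 2)))) \<longlongrightarrow> - 2 * ln (exp (- (v x / 2)))) (at_right 0)"
    by (rule tendsto_mult[OF tendsto_const tendsto_ln[OF e]]) simp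
  then show ?thesis by simp
qed

text \<open>In \<open>D_eq_V\<close> the factor tends to one and the time to \<open>r' - r\<close> as the scale tends to zero.\<close>

lemma Y_increments_stationary:
  assumes r: "0 \<le> r" "r \<le> r'"
  shows "(LINT \<omega>|N. (Y r \<omega> - Y r' \<omega>)\<^sup>2) = v (r' - r)"
proof (rule tendsto_unique[OF trivial_limit_at_right_real D_tendsto])
  let ?s = "\<lambda>u. (r' - r) * t / (t + r * u)"
  have lim: "((\<lambda>u. t + r * u) \<longlongrightarrow> t + r * 0) (at_right 0)" by (intro tendsto_intros)
  have "(?s \<longlongrightarrow> (r' - r) * t / (t + r * 0)) (at_right 0)"
    using t_pos by (intro tendsto_intros lim) auto
  then have s: "(?s \<longlongrightarrow> r' - r) (at_right 0)" using t_pos by simp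
  have s0: "\<forall>\<^sub>F u in at_right 0. 0 \<le> ?s u"
    using eventually_pos by eventually_elim (use r t_pos in \<open>auto intro!: divide_nonneg_nonneg\<close>)
  have "((\<lambda>u. ((t + r * u) / t) powr (2 * \<gamma>)) \<longlongrightarrow> ((t + r * 0) / t) powr (2 * \<gamma>)) (at_right 0)"
    using t_pos by (intro tendsto_powr tendsto_divide lim tendsto_const) auto
  then have p: "((\<lambda>u. ((t + r * u) / t) powr (2 * \<gamma>)) \<longlongrightarrow> 1) (at_right 0)" using t_pos by simp
  have "((\<lambda>u. ((t + r * u) / t) powr (2 * \<gamma>) * V u (?s u)) \<longlongrightarrow> 1 * v (r' - r)) (at_right 0)"
    by (rule tendsto_mult[OF p V_tendsto_along[OF s s0]]) (use r in simp)
  moreover have "\<forall>\<^sub>F u in at_right 0. ((t + r * u) / t) powr (2 * \<gamma>) * V u (?s u) = D u r r'"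
    using eventually_pos by eventually_elim (simp add: D_eq_V[OF _ r])
  ultimately show "((\<lambda>u. D u r r') \<longlongrightarrow> v (r' - r)) (at_right 0)"
    using Lim_transform_eventually by fastforce
qed (use r in auto)

lemma v_bounded: "\<exists>C. \<forall>r\<in>{0..R}. v r \<le> C"
proof -
  obtain C where C: "\<forall>\<^sub>F u in at_right 0. \<forall>r\<in>{0..R}. V u r \<le> C" using V_bounded by blast
  have "v r \<le> C" if "r \<in> {0..R}" for r
    by (rule tendsto_upperbound[OF V_tendsto _ trivial_limit_at_right_real])
      (use C that in \<open>auto elim!: eventually_mono\<close>)
  then show ?thesis by blast
qed

lemma v_small: "0 < \<eta> \<Longrightarrow> \<exists>\<epsilon>>0. \<forall>r\<in>{0..\<epsilon>}. v r \<le> \<eta>"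
proof -
  assume "0 < \<eta>"
  then obtain \<epsilon> where \<epsilon>: "0 < \<epsilon>" "\<forall>\<^sub>F u in at_right 0. \<forall>r\<in>{0..\<epsilon>}. V u r \<le> \<eta>"
    using V_small by blast
  have "v r \<le> \<eta>" if "r \<in> {0..\<epsilon>}" for r
    by (rule tendsto_upperbound[OF V_tendsto _ trivial_limit_at_right_real])
      (use \<epsilon> that in \<open>auto elim!: eventually_mono\<close>)
  then show ?thesis using \<epsilon>(1) by blast
qed

lemma v_1_pos: "0 < v 1"
proof (rule ccontr)
  assume "\<not> 0 < v 1"
  then have "v 1 = 0" using v_nonneg[of 1] by simp
  then have "AE \<omega> in N. Y 1 \<omega> = 0" using centered_normal_0_AE Y_normal[of 1] by simp
  then show False using Y_nondegenerate by blast
qed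

text \<open>\<open>Y 2\<close> is the sum of \<open>Y 1\<close> and an increment with the same variance. This is what bounds the exponent by one.\<close>

lemma v_2_le: "v 2 \<le> 4 * v 1"
proof -
  have I: "integrable N (\<lambda>\<omega>. (Y 1 \<omega>)\<^sup>2)" "integrable N (\<lambda>\<omega>. (Y 2 \<omega>)\<^sup>2)"
    "integrable N (\<lambda>\<omega>. (Y 1 \<omega> - Y 2 \<omega>)\<^sup>2)"
    by (rule centered_normal_square_integrable[OF Y_normal] centered_normal_square_integrable[OF Y_diff_normal]; simp)+
  have "v 2 \<le> (LINT \<omega>|N. 2 * (Y 1 \<omega>)\<^sup>2 + 2 * (Y 1 \<omega> - Y 2 \<omega>)\<^sup>2)"
    unfolding v_def
  proof (rule integral_mono)
    have "x\<^sup>2 \<le> 2 * y\<^sup>2 + 2 * (y - x)\<^sup>2" for x y :: real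
      using zero_le_power2[of "x - 2 * y"] by (simp add: power2_eq_square algebra_simps)
    then show "(Y 2 \<omega>)\<^sup>2 \<le> 2 * (Y 1 \<omega>)\<^sup>2 + 2 * (Y 1 \<omega> - Y 2 \<omega>)\<^sup>2" for \<omega> .
  qed (use I in auto)
  also have "\<dots> = 2 * v 1 + 2 * v 1" using I Y_increments_stationary[of 1 2] by (simp add: v_def)
  finally show ?thesis by simp
qed

lemma g_normalized_tendsto:
  assumes "0 \<le> r"
  shows "((\<lambda>u. g (r * u / t) / (a u)\<^sup>2) \<longlongrightarrow> v r / (\<sigma>\<^sup>2 * t powr (2 * \<gamma>))) (at_right 0)"
proof -
  have p: "\<sigma>\<^sup>2 * t powr (2 * \<gamma>) \<noteq> 0" using sigma t_pos by simp
  have "((\<lambda>u. V u r / (\<sigma>\<^sup>2 * t powr (2 * \<gamma>))) \<longlongrightarrow> v r / (\<sigma>\<^sup>2 * t powr (2 * \<gamma>))) (at_right 0)"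
    by (intro tendsto_intros V_tendsto assms p)
  then show ?thesis
  proof (rule Lim_transform_eventually)
    show "\<forall>\<^sub>F u in at_right 0. V u r / (\<sigma>\<^sup>2 * t powr (2 * \<gamma>)) = g (r * u / t) / (a u)\<^sup>2"
      using eventually_pos by eventually_elim (use p in \<open>simp add: V_eq[OF _ assms] field_simps\<close>)
  qed
qed

lemma eventually_g_pos: "\<forall>\<^sub>F h in at_right 0. 0 < g h"
proof -
  have "0 < v 1 / (\<sigma>\<^sup>2 * t powr (2 * \<gamma>))" using v_1_pos sigma t_pos by simp
  with g_normalized_tendsto[of 1] have "\<forall>\<^sub>F u in at_right 0. 0 < g (1 * u / t) / (a u)\<^sup>2"
    by (intro order_tendstoD(1)) auto
  from eventually_compose_filterlim[OF this filterlim_scale_at_right_0[OF t_pos]]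
  have "\<forall>\<^sub>F h in at_right 0. 0 < g (1 * (t * h) / t) / (a (t * h))\<^sup>2" .
  then show ?thesis
  proof eventually_elim
    case (elim h)
    then have "0 < g h / (a (t * h))\<^sup>2" using t_pos by simp
    then show ?case by (metis divide_le_0_iff linorder_not_less zero_le_power2)
  qed
qed

lemma g_ratio_tendsto:
  assumes "0 < r"
  shows "((\<lambda>h. g (r * h) / g h) \<longlongrightarrow> v r / v 1) (at_right 0)"
proof -
  have p: "\<sigma>\<^sup>2 * t powr (2 * \<gamma>) \<noteq> 0" using sigma t_pos by simp
  have "((\<lambda>u. (g (r * u / t) / (a u)\<^sup>2) / (g (1 * u / t) / (a u)\<^sup>2)) \<longlongrightarrow>
      (v r / (\<sigma>\<^sup>2 * t powr (2 * \<gamma>))) / (v 1 / (\<sigma>\<^sup>2 * t powr (2 * \<gamma>)))) (at_right 0)"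
    using v_1_pos p by (intro tendsto_divide g_normalized_tendsto less_imp_le[OF assms]) auto
  then have "((\<lambda>u. (g (r * u / t) / (a u)\<^sup>2) / (g (1 * u / t) / (a u)\<^sup>2)) \<longlongrightarrow> v r / v 1) (at_right 0)"
    using p by simp
  from filterlim_compose[OF this filterlim_scale_at_right_0[OF t_pos]]
  have "((\<lambda>h. (g (r * (t * h) / t) / (a (t * h))\<^sup>2) / (g (1 * (t * h) / t) / (a (t * h))\<^sup>2)) \<longlongrightarrow> v r / v 1) (at_right 0)" .
  then show ?thesis
  proof (rule Lim_transform_eventually)
    have "0 < A / t" using A_pos t_pos by simp
    from eventually_small[OF this]
    show "\<forall>\<^sub>F h in at_right 0. (g (r * (t * h) / t) / (a (t * h))\<^sup>2) / (g (1 * (t * h) / t) / (a (t * h))\<^sup>2) = g (r * h) / g h"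
    proof eventually_elim
      case (elim h)
      then have "0 < a (t * h)" using t_pos by (intro a_pos) (auto simp: field_simps)
      moreover have "r * (t * h) / t = r * h" "1 * (t * h) / t = h" using t_pos by auto
      ultimately show ?case by simp
    qed
  qed
qed

end

section \<open>The exponent and the normalization\<close>

context small_scale_convergence
begin

lemma v_0: "v 0 = 0"
proof (rule tendsto_unique[OF trivial_limit_at_right_real V_tendsto])
  show "((\<lambda>u. V u 0) \<longlongrightarrow> 0) (at_right 0)" by (simp add: V_def SI_0)
qed simp

text \<open>A nonpositive index would keep \<open>v r\<close> above \<open>v 1\<close> for small \<open>r\<close>, against \<open>v_small\<close>; an index above 2 would
violate \<open>v_2_le\<close>.\<close>

lemma power_law: "\<exists>\<kappa>. 0 < \<kappa> \<and> \<kappa> \<le> 1 \<and> (\<forall>r>0. ((\<lambda>h. g (r * h) / g h) \<longlongrightarrow> r powr (2 * \<kappa>)) (at_right 0))"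
proof -
  obtain C where C: "\<And>r. r \<in> {0..2} \<Longrightarrow> v r \<le> C" using v_bounded[of 2] by blast
  have "\<exists>\<rho>. \<forall>r>0. v r / v 1 = r powr \<rho>"
    using C v_1_pos
    by (intro regular_variation[OF eventually_g_pos g_ratio_tendsto, where C = "C / v 1"]) (auto intro!: divide_right_mono)
  then obtain \<rho> where \<rho>: "\<And>r. 0 < r \<Longrightarrow> v r / v 1 = r powr \<rho>" by blast
  have "0 < \<rho>"
  proof (rule ccontr)
    assume "\<not> 0 < \<rho>"
    obtain \<epsilon> where \<epsilon>: "0 < \<epsilon>" "\<And>r. r \<in> {0..\<epsilon>} \<Longrightarrow> v r \<le> v 1 / 2"
      using v_small[of "v 1 / 2"] v_1_pos by auto
    define r where "r = min \<epsilon> 1"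
    have r: "0 < r" "r \<le> 1" "r \<in> {0..\<epsilon>}" using \<epsilon> by (auto simp: r_def)
    have "r powr 0 \<le> r powr \<rho>" using \<open>\<not> 0 < \<rho>\<close> r by (intro powr_mono') auto
    then have "1 \<le> v r / v 1" using \<rho>[OF r(1)] r by simp
    then show False using \<epsilon>(2)[OF r(3)] v_1_pos by simp
  qed
  moreover have "\<rho> \<le> 2"
  proof -
    have "v 2 / v 1 \<le> 4" using v_2_le v_1_pos by (simp add: pos_divide_le_eq)
    then have "2 powr \<rho> \<le> 2 powr (2::real)" using \<rho>[of 2] by simp
    then show ?thesis by (rule iffD1[OF powr_le_cancel_iff, rotated]) simp
  qed
  moreover have "((\<lambda>h. g (r * h) / g h) \<longlongrightarrow> r powr (2 * (\<rho> / 2))) (at_right 0)" if "0 < r" for r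
    using g_ratio_tendsto[OF that] \<rho>[OF that] by simp
  ultimately show ?thesis by (intro exI[of _ "\<rho> / 2"]) auto
qed

lemma v_power:
  assumes \<kappa>: "0 < \<kappa>" "\<And>r. 0 < r \<Longrightarrow> ((\<lambda>h. g (r * h) / g h) \<longlongrightarrow> r powr (2 * \<kappa>)) (at_right 0)"
    and r: "0 \<le> r"
  shows "v r = v 1 * r powr (2 * \<kappa>)"
proof (cases "r = 0")
  case False
  then have "0 < r" using r by simp
  then have "v r / v 1 = r powr (2 * \<kappa>)"
    using tendsto_unique[OF trivial_limit_at_right_real g_ratio_tendsto \<kappa>(2)] by blast
  then show ?thesis using v_1_pos by (simp add: field_simps)
qed (simp add: v_0)

lemma variance_Y_1: "prob_space.variance N (Y 1) = v 1"
  using centered_normal_mean[OF Y_normal[of 1]] by (simp add: v_def)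

text \<open>The ratio \<open>(a u)\<^sup>2 / g u\<close> is the quotient of \<open>g (u / t) / g u\<close>, which tends to \<open>t powr (- 2 * \<kappa>)\<close>, by
\<open>g (u / t) / (a u)\<^sup>2\<close>, whose limit comes from the variance of \<open>Y 1\<close>. The weight \<open>w\<close> is the variance of the
limit at base point 1.\<close>

lemma normalization_asymptotics:
  assumes lim: "\<And>r. 0 < r \<Longrightarrow> ((\<lambda>h. g (r * h) / g h) \<longlongrightarrow> r powr (2 * \<kappa>)) (at_right 0)"
    and w: "0 < w"
  shows "(\<lambda>u. sqrt w * a u) \<sim>[at_right 0] (\<lambda>u. \<sigma> * t powr (\<gamma> - \<kappa>) * sqrt (w / v 1) * sqrt (g u))"
proof (rule asymp_equivI')
  let ?c = "\<sigma> * t powr (\<gamma> - \<kappa>) * sqrt (w / v 1)"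
  have c: "0 < ?c" using sigma t_pos w v_1_pos by simp
  have "((\<lambda>u. (g (1 / t * u) / g u) / (g (1 * u / t) / (a u)\<^sup>2)) \<longlongrightarrow>
      (1 / t) powr (2 * \<kappa>) / (v 1 / (\<sigma>\<^sup>2 * t powr (2 * \<gamma>)))) (at_right 0)"
    using t_pos sigma v_1_pos by (intro tendsto_divide lim g_normalized_tendsto) auto
  then have "((\<lambda>u. w / ?c\<^sup>2 * ((g (1 / t * u) / g u) / (g (1 * u / t) / (a u)\<^sup>2))) \<longlongrightarrow>
      w / ?c\<^sup>2 * ((1 / t) powr (2 * \<kappa>) / (v 1 / (\<sigma>\<^sup>2 * t powr (2 * \<gamma>))))) (at_right 0)"
    by (rule tendsto_mult[OF tendsto_const])
  moreover have "w / ?c\<^sup>2 * ((1 / t) powr (2 * \<kappa>) / (v 1 / (\<sigma>\<^sup>2 * t powr (2 * \<gamma>)))) = 1"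
  proof -
    have "(t powr (\<gamma> - \<kappa>))\<^sup>2 = t powr (2 * \<gamma>) * (1 / t) powr (2 * \<kappa>)"
      using t_pos by (simp add: power2_eq_square powr_add[symmetric] powr_divide powr_minus_divide[symmetric] powr_diff[symmetric] algebra_simps)
    then have "?c\<^sup>2 = \<sigma>\<^sup>2 * (t powr (2 * \<gamma>) * (1 / t) powr (2 * \<kappa>)) * (w / v 1)"
      using w v_1_pos by (simp add: power_mult_distrib)
    moreover have "0 < t powr (2 * \<gamma>)" "0 < (1 / t) powr (2 * \<kappa>)" using t_pos by auto
    ultimately show ?thesis using sigma w v_1_pos by (simp add: field_simps)
  qed
  ultimately have "((\<lambda>u. w / ?c\<^sup>2 * ((g (1 / t * u) / g u) / (g (1 * u / t) / (a u)\<^sup>2))) \<longlongrightarrow> 1) (at_right 0)"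
    by simp
  from tendsto_real_sqrt[OF this]
  have "((\<lambda>u. sqrt (w / ?c\<^sup>2 * ((g (1 / t * u) / g u) / (g (1 * u / t) / (a u)\<^sup>2)))) \<longlongrightarrow> 1) (at_right 0)"
    by simp
  then show "((\<lambda>u. sqrt w * a u / (?c * sqrt (g u))) \<longlongrightarrow> 1) (at_right 0)"
  proof (rule Lim_transform_eventually)
    have "0 < 1 / t" using t_pos by simp
    from eventually_compose_filterlim[OF eventually_g_pos filterlim_scale_at_right_0[OF this]]
      eventually_g_pos eventually_small[OF A_pos]
    show "\<forall>\<^sub>F u in at_right 0. sqrt (w / ?c\<^sup>2 * ((g (1 / t * u) / g u) / (g (1 * u / t) / (a u)\<^sup>2))) = sqrt w * a u / (?c * sqrt (g u))"
    proof eventually_elim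
      case (elim u)
      have a: "0 < a u" using elim a_pos by simp
      have "(g (1 / t * u) / g u) / (g (1 * u / t) / (a u)\<^sup>2) = (a u)\<^sup>2 / g u" using elim a by simp
      then have "w / ?c\<^sup>2 * ((g (1 / t * u) / g u) / (g (1 * u / t) / (a u)\<^sup>2)) = (w * (a u)\<^sup>2) / (?c\<^sup>2 * g u)"
        by simp
      also have "sqrt \<dots> = sqrt w * a u / (?c * sqrt (g u))"
      proof -
        have "sqrt (w * (a u)\<^sup>2) = sqrt w * a u" using a by (simp add: real_sqrt_mult)
        moreover have "sqrt (?c\<^sup>2 * g u) = ?c * sqrt (g u)"
          unfolding real_sqrt_mult[of "?c\<^sup>2"] real_sqrt_abs abs_of_pos[OF c] ..
        ultimately show ?thesis by (simp only: real_sqrt_divide)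
      qed
      finally show ?case .
    qed
  qed
qed

end

context scaling_gaussian_process
begin

lemma slowly_varying_factor:
  assumes l: "l \<in> borel_measurable (restrict_space borel {0..})"
    and pos: "\<forall>\<^sub>F h in at_right 0. 0 < g h"
    and lim: "\<And>r. 0 < r \<Longrightarrow> ((\<lambda>h. g (r * h) / g h) \<longlongrightarrow> r powr (2 * \<kappa>)) (at_right 0)"
  shows "slowly_varying_at_zero (\<lambda>u. sqrt (g u) / u powr \<kappa>)"
  unfolding slowly_varying_at_zero_def
proof (intro conjI allI impI)
  let ?R = "restrict_space borel {0::real<..}"
  have "{0::real<..} \<subseteq> {0..}" by auto
  then have [measurable]: "l \<in> borel_measurable ?R" by (rule measurable_restrict_mono[OF l])
  have [measurable]: "(\<lambda>u. (1 + u) powr (2 * \<gamma>)) \<in> borel_measurable ?R" "(\<lambda>u. u powr \<kappa>) \<in> borel_measurable ?R"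
    by (rule measurable_restrict_space1; measurable)+
  show "(\<lambda>u. sqrt (g u) / u powr \<kappa>) \<in> borel_measurable ?R" unfolding g_def by measurable
  show "0 \<le> sqrt (g u) / u powr \<kappa>" if "0 < u" for u using g_nonneg[of u] that by simp
  obtain \<delta> where "0 < \<delta>" "\<And>u. 0 < u \<Longrightarrow> u < \<delta> \<Longrightarrow> 0 < g u"
    using pos by (auto simp: eventually_at_right_field)
  then show "\<exists>\<delta>>0. \<forall>u. 0 < u \<and> u < \<delta> \<longrightarrow> 0 < sqrt (g u) / u powr \<kappa>"
    by (intro exI[of _ \<delta>]) auto
  fix c :: real assume c: "0 < c"
  have "((\<lambda>h. sqrt (g (c * h) / g h) / c powr \<kappa>) \<longlongrightarrow> sqrt (c powr (2 * \<kappa>)) / c powr \<kappa>) (at_right 0)"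
    using c by (intro tendsto_divide tendsto_real_sqrt lim tendsto_const) auto
  moreover have "sqrt (c powr (2 * \<kappa>)) = c powr \<kappa>"
    using c by (intro real_sqrt_unique) (simp_all add: power2_eq_square powr_add[symmetric])
  ultimately have "((\<lambda>h. sqrt (g (c * h) / g h) / c powr \<kappa>) \<longlongrightarrow> 1) (at_right 0)" using c by simp
  then show "((\<lambda>u. (sqrt (g (c * u)) / (c * u) powr \<kappa>) / (sqrt (g u) / u powr \<kappa>)) \<longlongrightarrow> 1) (at_right 0)"
  proof (rule Lim_transform_eventually)
    show "\<forall>\<^sub>F u in at_right 0. sqrt (g (c * u) / g u) / c powr \<kappa> = (sqrt (g (c * u)) / (c * u) powr \<kappa>) / (sqrt (g u) / u powr \<kappa>)"
      using eventually_at_right_less[of "0::real"]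
      by eventually_elim (use c in \<open>simp add: powr_mult real_sqrt_divide field_simps\<close>)
  qed
qed

end

section \<open>The limit as a fractional Brownian motion\<close>

context small_scale_convergence
begin

text \<open>Polarization of the variances of the increments gives the covariance of fractional Brownian motion. For
\<open>\<kappa> < 1\<close> the paths are set to zero off the event of continuity. For \<open>\<kappa> = 1\<close> the process is linear in time:
\<open>Y r - r * Y 1\<close> has second moment zero.\<close>

lemma fractional_brownian_limit:
  assumes \<kappa>: "0 < \<kappa>" "\<kappa> \<le> 1" and v: "\<And>r. 0 \<le> r \<Longrightarrow> v r = v 1 * r powr (2 * \<kappa>)"
  shows "\<exists>c B. fractional_brownian_motion \<kappa> N B \<and> same_fdd N Y N (\<lambda>\<tau> \<omega>. c * B \<tau> \<omega>)"
proof -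
  interpret N: prob_space N by (rule prob_space_N)
  define c where "c = sqrt (v 1)"
  have c: "0 < c" "c\<^sup>2 = v 1" using v_1_pos by (auto simp: c_def)
  have diff: "(LINT \<omega>|N. (Y r \<omega> - Y r' \<omega>)\<^sup>2) = v 1 * \<bar>r - r'\<bar> powr (2 * \<kappa>)" if "0 \<le> r" "0 \<le> r'" for r r'
  proof (cases "r \<le> r'")
    case True
    then show ?thesis using Y_increments_stationary[of r r'] v[of "r' - r"] that by (simp add: abs_minus_commute)
  next
    case False
    then show ?thesis using Y_increments_stationary[of r' r] v[of "r - r'"] that by (simp add: power2_commute)
  qed
  have sq: "integrable N (\<lambda>\<omega>. (Y r \<omega>)\<^sup>2)" if "0 \<le> r" for r
    by (rule centered_normal_square_integrable[OF Y_normal[OF that]])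
  have sqd: "integrable N (\<lambda>\<omega>. (Y r \<omega> - Y r' \<omega>)\<^sup>2)" if "0 \<le> r" "0 \<le> r'" for r r'
    by (rule centered_normal_square_integrable[OF Y_diff_normal[OF that]])
  have prod: "integrable N (\<lambda>\<omega>. Y r \<omega> * Y s \<omega>)"
    "(LINT \<omega>|N. Y r \<omega> * Y s \<omega>) = v 1 * ((r powr (2 * \<kappa>) + s powr (2 * \<kappa>) - \<bar>s - r\<bar> powr (2 * \<kappa>)) / 2)"
    if "0 \<le> r" "0 \<le> s" for r s
  proof -
    have eq: "Y r \<omega> * Y s \<omega> = ((Y r \<omega>)\<^sup>2 + (Y s \<omega>)\<^sup>2 - (Y r \<omega> - Y s \<omega>)\<^sup>2) / 2" for \<omega>
      by (simp add: power2_diff)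
    show "integrable N (\<lambda>\<omega>. Y r \<omega> * Y s \<omega>)" unfolding eq using sq sqd that by auto
    have "(LINT \<omega>|N. Y r \<omega> * Y s \<omega>) = (v r + v s - v 1 * \<bar>r - s\<bar> powr (2 * \<kappa>)) / 2"
      unfolding eq using sq sqd that diff[OF that] by (simp add: v_def)
    then show "(LINT \<omega>|N. Y r \<omega> * Y s \<omega>) = v 1 * ((r powr (2 * \<kappa>) + s powr (2 * \<kappa>) - \<bar>s - r\<bar> powr (2 * \<kappa>)) / 2)"
      using v[OF that(1)] v[OF that(2)] by (simp add: abs_minus_commute algebra_simps)
  qed
  show ?thesis
  proof (cases "\<kappa> = 1")
    case True
    define Z where "Z \<omega> = (1 / c) * Y 1 \<omega>" for \<omega>
    have "centered_normal N Z (LINT \<omega>|N. (Z \<omega>)\<^sup>2)"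
      using Y_combination(1)[of "{1}" "\<lambda>_. 1 / c"] by (simp add: Z_def[abs_def])
    moreover have "(LINT \<omega>|N. (Z \<omega>)\<^sup>2) = 1"
      using c sq[of 1] v_1_pos by (simp add: Z_def power_mult_distrib power_divide v_def[symmetric])
    ultimately have Z: "centered_normal N Z 1" by simp
    have Zd: "distributed N lborel Z std_normal_density"
      using centered_normal_pos_distributed[OF Z] by simp
    have fbm: "fractional_brownian_motion \<kappa> N (\<lambda>t \<omega>. t * Z \<omega>)"
      unfolding fractional_brownian_motion_def stochastic_process_def
      using True Zd Z prob_space_N by (auto simp: centered_normal_def)
    have ae: "AE \<omega> in N. Y r \<omega> = c * (r * Z \<omega>)" if r: "0 \<le> r" for r
    proof -
      have eq: "(Y r \<omega> - r * Y 1 \<omega>)\<^sup>2 = (Y r \<omega>)\<^sup>2 + r\<^sup>2 * (Y 1 \<omega>)\<^sup>2 - 2 * r * (Y r \<omega> * Y 1 \<omega>)" for \<omega>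
        by (simp add: power2_diff power_mult_distrib)
      have I: "integrable N (\<lambda>\<omega>. (Y r \<omega> - r * Y 1 \<omega>)\<^sup>2)"
        unfolding eq using sq[OF r] sq[of 1] prod(1)[OF r, of 1] by simp
      have sqr: "x powr 2 = x\<^sup>2" if "0 \<le> x" for x :: real using that by simp
      have "(LINT \<omega>|N. (Y r \<omega> - r * Y 1 \<omega>)\<^sup>2) = v r + r\<^sup>2 * v 1 - 2 * r * (LINT \<omega>|N. Y r \<omega> * Y 1 \<omega>)"
        unfolding eq v_def using sq[OF r] sq[of 1] prod(1)[OF r, of 1] by simp
      also have "\<dots> = 0"
        unfolding v[OF r] prod(2)[OF r zero_le_one] using True r
        by (simp add: sqr power2_eq_square algebra_simps)
      finally have "AE \<omega> in N. (Y r \<omega> - r * Y 1 \<omega>)\<^sup>2 = 0"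
        using integral_nonneg_eq_0_iff_AE[OF I] by simp
      then show ?thesis by eventually_elim (use c in \<open>simp add: Z_def\<close>)
    qed
    have "same_fdd N Y N (\<lambda>\<tau> \<omega>. c * (\<tau> * Z \<omega>))"
      by (rule same_fdd_AE[OF Y_measurable _ ae]) (use Z in \<open>auto simp: centered_normal_def\<close>)
    with fbm show ?thesis by blast
  next
    case False
    then have \<kappa>1: "\<kappa> < 1" using \<kappa> by simp
    obtain G where G: "G \<in> sets N" "AE \<omega> in N. \<omega> \<in> G" "\<And>\<omega>. \<omega> \<in> G \<Longrightarrow> continuous_on {0..} (\<lambda>t. Y t \<omega>)"
      by (rule continuous_modification_event[OF Y_cadlag \<kappa>(1), of "v 1"])
        (use v_nonneg Y_diff_normal diff in auto)
    define B where "B t \<omega> = (if \<omega> \<in> G then Y t \<omega> / c else 0)" for t \<omega>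
    have Bm: "B t \<in> borel_measurable N" if "0 \<le> t" for t
      unfolding B_def using G(1) Y_measurable[OF that] by (intro measurable_If_set) auto
    have ae: "AE \<omega> in N. \<forall>t. B t \<omega> = Y t \<omega> / c"
      using G(2) by eventually_elim (simp add: B_def)
    have gauss: "gaussian_variable N (\<lambda>\<omega>. \<Sum>t\<in>S. b t * B t \<omega>)" if S: "finite S" "S \<subseteq> {0..}" for S b
    proof (rule centered_normal_gaussian_variable[OF centered_normal_cong_AE[OF Y_combination(1)[OF S, of "\<lambda>t. b t / c"]]])
      show "(\<lambda>\<omega>. \<Sum>t\<in>S. b t * B t \<omega>) \<in> borel_measurable N"
        using S by (intro borel_measurable_sum borel_measurable_times borel_measurable_const Bm) auto
      show "AE \<omega> in N. (\<Sum>t\<in>S. b t * B t \<omega>) = (\<Sum>t\<in>S. b t / c * Y t \<omega>)"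
        using ae by eventually_elim simp
    qed
    have mean: "(LINT \<omega>|N. B t \<omega>) = 0" if "0 \<le> t" for t
    proof -
      have "(LINT \<omega>|N. B t \<omega>) = (LINT \<omega>|N. Y t \<omega> / c)"
        using Bm[OF that] Y_measurable[OF that] ae by (intro integral_cong_AE) (auto elim!: eventually_mono)
      then show ?thesis using centered_normal_mean[OF Y_normal[OF that]] by simp
    qed
    have cov: "(LINT \<omega>|N. B s \<omega> * B t \<omega>) = (s powr (2 * \<kappa>) + t powr (2 * \<kappa>) - \<bar>t - s\<bar> powr (2 * \<kappa>)) / 2"
      if st: "0 \<le> s" "0 \<le> t" for s t
    proof -
      have "(LINT \<omega>|N. B s \<omega> * B t \<omega>) = (LINT \<omega>|N. (Y s \<omega> * Y t \<omega>) / c\<^sup>2)"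
        using Bm[OF st(1)] Bm[OF st(2)] Y_measurable[OF st(1)] Y_measurable[OF st(2)] ae
        by (intro integral_cong_AE) (auto elim!: eventually_mono simp: power2_eq_square)
      also have "\<dots> = (LINT \<omega>|N. Y s \<omega> * Y t \<omega>) / v 1" using c by simp
      finally show ?thesis unfolding prod(2)[OF st] using v_1_pos by simp
    qed
    have sp: "stochastic_process N B"
      unfolding stochastic_process_def using prob_space_N Bm by simp
    have cgp: "centered_gaussian_process N B"
      unfolding centered_gaussian_process_def
    proof (intro conjI allI impI)
      show "gaussian_variable N (\<lambda>\<omega>. \<Sum>t\<in>S. b t * B t \<omega>)" if "finite S \<and> S \<subseteq> {0..}" for S b
        by (rule gauss) (use that in auto)
    qed (use sp mean in auto)
    have "continuous_on {0..} (\<lambda>t. B t \<omega>)" for \<omega>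
    proof (cases "\<omega> \<in> G")
      case True
      have "continuous_on {0..} (\<lambda>t. Y t \<omega> / c)"
        using G(3)[OF True] c by (intro continuous_on_divide continuous_on_const) auto
      then show ?thesis using True by (simp add: B_def)
    qed (simp add: B_def)
    then have "fractional_brownian_motion \<kappa> N B"
      unfolding fractional_brownian_motion_def if_not_P[OF False]
      by (intro conjI allI impI ballI sp cgp cov \<kappa>(1) \<kappa>1)
    moreover have "same_fdd N Y N (\<lambda>\<tau> \<omega>. c * B \<tau> \<omega>)"
      by (rule same_fdd_AE[OF Y_measurable]) (use Bm ae c in \<open>auto elim!: eventually_mono\<close>)
    ultimately show ?thesis by blast
  qed
qed

end

section \<open>Uniqueness of the limit\<close>

context small_scale_convergence
begin

text \<open>Convergence of types. Let \<open>k = a / b\<close> be the ratio of the two normalizations. Convergence at time 1 under both forces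
\<open>k\<close> to converge, since \<open>(k u)\<^sup>2 * V u 1\<close> and \<open>V u 1\<close> both converge and \<open>v 1 > 0\<close>. Bounded second moments then
allow \<open>k u\<close> to be replaced by its limit in every Lipschitz functional.\<close>

lemma small_scale_limit_unique:
  assumes Z: "small_scale_limit M X t Q Z"
  shows "\<exists>c. same_fdd Q Z N (\<lambda>\<tau> \<omega>. c * Y \<tau> \<omega>)"
proof -
  obtain b where b: "\<forall>\<^sub>F u in at_right 0. b u > 0"
    and fdd: "fdd_converges M (scaled_increment X t b) (at_right 0) Q Z"
    using Z unfolding small_scale_limit_def by blast
  have Q: "prob_space Q" and Zm: "\<And>r. 0 \<le> r \<Longrightarrow> Z r \<in> borel_measurable Q"
    using Z by (auto simp: small_scale_limit_def stochastic_process_def)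
  define k where "k u = a u / b u" for u
  have good: "\<forall>\<^sub>F u in at_right 0. 0 < u \<and> 0 < k u \<and> (\<forall>r \<omega>. scaled_increment X t b u r \<omega> = k u * SI u r \<omega>)"
    using eventually_small[OF A_pos] b
  proof eventually_elim
    case (elim u)
    then have "0 < a u" using a_pos by simp
    then show ?case using elim by (simp add: k_def scaled_increment_def)
  qed
  have conv: "((\<lambda>u. LINT \<omega>|M. \<psi> (\<lambda>i. k u * SI u i \<omega>)) \<longlongrightarrow> (LINT \<omega>|Q. \<psi> (\<lambda>i. Z i \<omega>))) (at_right 0)"
    if S: "finite S" "S \<subseteq> {0..}" and \<psi>: "coord_lipschitz S K \<psi>" and B: "\<And>x. \<bar>\<psi> x\<bar> \<le> B" for S K \<psi> B
  proof -
    have rs: "\<psi> (\<lambda>i\<in>S. x i) = \<psi> x" for x by (rule coord_lipschitz_cong[OF \<psi>]) simp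
    have "bounded (\<psi> ` topspace (product_topology (\<lambda>_::real. euclideanreal) S))"
      using B by (intro boundedI[of _ B]) auto
    then have "((\<lambda>u. LINT \<omega>|M. \<psi> (\<lambda>i\<in>S. scaled_increment X t b u i \<omega>)) \<longlongrightarrow> (LINT \<omega>|Q. \<psi> (\<lambda>i\<in>S. Z i \<omega>))) (at_right 0)"
      using fdd[unfolded fdd_converges_def weakly_converges_def, rule_format, of S \<psi>] S
        continuous_map_coord_lipschitz[OF S(1) \<psi>] by simp
    then have "((\<lambda>u. LINT \<omega>|M. \<psi> (\<lambda>i. scaled_increment X t b u i \<omega>)) \<longlongrightarrow> (LINT \<omega>|Q. \<psi> (\<lambda>i. Z i \<omega>))) (at_right 0)"
      unfolding rs .
    then show ?thesis
      by (rule Lim_transform_eventually) (use good in \<open>auto elim!: eventually_mono\<close>)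
  qed
  have trig: "((\<lambda>u. LINT \<omega>|M. f (\<theta> * (k u * SI u 1 \<omega>))) \<longlongrightarrow> (LINT \<omega>|Q. f (\<theta> * Z 1 \<omega>))) (at_right 0)"
    if f: "\<And>x y :: real. \<bar>f x - f y\<bar> \<le> \<bar>x - y\<bar>" "\<And>x. \<bar>f x\<bar> \<le> 1" for f :: "real \<Rightarrow> real" and \<theta>
    using conv[OF _ _ coord_lipschitz_of_combination[OF f(1), of "{1}" \<theta> "\<lambda>_. 1"] f(2)] by simp
  define z where "z = (LINT \<omega>|Q. (Z 1 \<omega>)\<^sup>2)"
  have nk: "\<forall>\<^sub>F u in at_right 0. centered_normal M (\<lambda>\<omega>. k u * SI u 1 \<omega>) ((k u)\<^sup>2 * V u 1)"
    using eventually_pos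
  proof eventually_elim
    case (elim u)
    have "(LINT \<omega>|M. (k u * SI u 1 \<omega>)\<^sup>2) = (k u)\<^sup>2 * V u 1" by (simp add: power_mult_distrib V_def)
    then show ?case using SI_combination[OF elim, of "{1}" "\<lambda>_. k u"] by simp
  qed
  have "((\<lambda>u. (k u)\<^sup>2 * V u 1) \<longlongrightarrow> z) (at_right 0)"
    unfolding z_def
    by (rule centered_normal_limit(2)[OF trivial_limit_at_right_real Q Zm nk trig[OF abs_cos_diff_le] trig[OF abs_sin_diff_le]])
      simp_all
  then have "((\<lambda>u. (k u)\<^sup>2 * V u 1 / V u 1) \<longlongrightarrow> z / v 1) (at_right 0)"
    using V_tendsto[of 1] v_1_pos by (intro tendsto_divide) auto
  then have "((\<lambda>u. sqrt ((k u)\<^sup>2 * V u 1 / V u 1)) \<longlongrightarrow> sqrt (z / v 1)) (at_right 0)"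
    by (rule tendsto_real_sqrt)
  moreover have "\<forall>\<^sub>F u in at_right 0. 0 < V u 1"
    by (rule order_tendstoD(1)[OF V_tendsto v_1_pos]) simp
  with good have "\<forall>\<^sub>F u in at_right 0. sqrt ((k u)\<^sup>2 * V u 1 / V u 1) = k u"
    by eventually_elim simp
  ultimately have k: "(k \<longlongrightarrow> sqrt (z / v 1)) (at_right 0)" by (rule Lim_transform_eventually)
  define c where "c = sqrt (z / v 1)"
  have k: "(k \<longlongrightarrow> c) (at_right 0)" using k by (simp add: c_def)
  have "distr Q (PiM S (\<lambda>_. borel)) (\<lambda>\<omega>. \<lambda>i\<in>S. Z i \<omega>) = distr N (PiM S (\<lambda>_. borel)) (\<lambda>\<omega>. \<lambda>i\<in>S. c * Y i \<omega>)"
    if S: "finite S" "S \<subseteq> {0..}" for S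
  proof (rule coord_lipschitz_law_unique[OF S(1) Q prob_space_N])
    show "Z i \<in> borel_measurable Q" if "i \<in> S" for i using that S Zm by auto
    show "(\<lambda>\<omega>. c * Y i \<omega>) \<in> borel_measurable N" if "i \<in> S" for i
      using that S by (intro borel_measurable_times borel_measurable_const Y_measurable) auto
    fix \<psi> K B assume \<psi>: "coord_lipschitz S K \<psi>" and B: "\<And>x. \<bar>\<psi> x\<bar> \<le> B"
    have \<psi>c: "coord_lipschitz S (K * \<bar>c\<bar>) (\<lambda>x. \<psi> (\<lambda>i. c * x i))"
      unfolding coord_lipschitz_def
    proof (intro allI)
      fix x y
      show "\<bar>\<psi> (\<lambda>i. c * x i) - \<psi> (\<lambda>i. c * y i)\<bar> \<le> K * \<bar>c\<bar> * (\<Sum>i\<in>S. \<bar>x i - y i\<bar>)"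
        using coord_lipschitzD[OF \<psi>, of "\<lambda>i. c * x i" "\<lambda>i. c * y i"]
        by (simp add: right_diff_distrib[symmetric] abs_mult sum_distrib_left[symmetric] mult.assoc)
    qed
    have 1: "((\<lambda>u. LINT \<omega>|M. \<psi> (\<lambda>i. c * SI u i \<omega>)) \<longlongrightarrow> (LINT \<omega>|N. \<psi> (\<lambda>i. c * Y i \<omega>))) (at_right 0)"
      by (rule coord_lipschitz_convergence[OF S \<psi>c]) (rule B)
    have 2: "((\<lambda>u. LINT \<omega>|M. \<psi> (\<lambda>i. k u * SI u i \<omega>)) \<longlongrightarrow> (LINT \<omega>|Q. \<psi> (\<lambda>i. Z i \<omega>))) (at_right 0)"
      by (rule conv[OF S \<psi> B])
    have "((\<lambda>u. (LINT \<omega>|M. \<psi> (\<lambda>i. k u * SI u i \<omega>)) - (LINT \<omega>|M. \<psi> (\<lambda>i. c * SI u i \<omega>))) \<longlongrightarrow> 0) (at_right 0)"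
    proof (rule Lim_null_comparison)
      have "((\<lambda>u. \<bar>K\<bar> * (\<bar>k u - c\<bar> * (\<Sum>i\<in>S. 1 + V u i))) \<longlongrightarrow> \<bar>K\<bar> * (\<bar>c - c\<bar> * (\<Sum>i\<in>S. 1 + v i))) (at_right 0)"
        using S by (intro tendsto_intros k V_tendsto) auto
      then show "((\<lambda>u. \<bar>K\<bar> * (\<bar>k u - c\<bar> * (\<Sum>i\<in>S. 1 + V u i))) \<longlongrightarrow> 0) (at_right 0)" by simp
      show "\<forall>\<^sub>F u in at_right 0. norm ((LINT \<omega>|M. \<psi> (\<lambda>i. k u * SI u i \<omega>)) - (LINT \<omega>|M. \<psi> (\<lambda>i. c * SI u i \<omega>)))
          \<le> \<bar>K\<bar> * (\<bar>k u - c\<bar> * (\<Sum>i\<in>S. 1 + V u i))"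
        using eventually_pos
      proof eventually_elim
        case (elim u)
        have m: "SI u i \<in> borel_measurable M" if "i \<in> S" for i using that S elim by (auto intro: SI_measurable)
        have I: "integrable M (\<lambda>\<omega>. \<psi> (\<lambda>i. e * SI u i \<omega>))" for e
          by (rule integrable_const_bound[of _ B])
            (use B m in \<open>auto intro!: measurable_coord_lipschitz[OF S(1) \<psi>]\<close>)
        have J: "integrable M (\<lambda>\<omega>. \<bar>SI u i \<omega>\<bar>)" "expectation (\<lambda>\<omega>. \<bar>SI u i \<omega>\<bar>) \<le> 1 + V u i" if i: "i \<in> S" for i
        proof -
          have "0 \<le> i" using i S by auto
          note sq = centered_normal_square_integrable[OF SI_normal[OF elim this]]
          from integral_abs_le_second_moment[OF prob_space_axioms m[OF i] sq zero_less_one]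
          show "integrable M (\<lambda>\<omega>. \<bar>SI u i \<omega>\<bar>)" "expectation (\<lambda>\<omega>. \<bar>SI u i \<omega>\<bar>) \<le> 1 + V u i"
            by (simp_all add: V_def)
        qed
        have "norm ((LINT \<omega>|M. \<psi> (\<lambda>i. k u * SI u i \<omega>)) - (LINT \<omega>|M. \<psi> (\<lambda>i. c * SI u i \<omega>)))
            = norm (LINT \<omega>|M. \<psi> (\<lambda>i. k u * SI u i \<omega>) - \<psi> (\<lambda>i. c * SI u i \<omega>))"
          by (simp add: Bochner_Integration.integral_diff[OF I I])
        also have "\<dots> \<le> (LINT \<omega>|M. norm (\<psi> (\<lambda>i. k u * SI u i \<omega>) - \<psi> (\<lambda>i. c * SI u i \<omega>)))"
          by (rule integral_norm_bound)
        also have "\<dots> \<le> (LINT \<omega>|M. \<bar>K\<bar> * (\<bar>k u - c\<bar> * (\<Sum>i\<in>S. \<bar>SI u i \<omega>\<bar>)))"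
        proof (rule integral_mono)
          show "integrable M (\<lambda>\<omega>. norm (\<psi> (\<lambda>i. k u * SI u i \<omega>) - \<psi> (\<lambda>i. c * SI u i \<omega>)))"
            by (intro integrable_norm Bochner_Integration.integrable_diff I)
          show "integrable M (\<lambda>\<omega>. \<bar>K\<bar> * (\<bar>k u - c\<bar> * (\<Sum>i\<in>S. \<bar>SI u i \<omega>\<bar>)))"
            by (intro integrable_mult_right Bochner_Integration.integrable_sum J(1))
          fix \<omega>
          have "\<bar>\<psi> (\<lambda>i. k u * SI u i \<omega>) - \<psi> (\<lambda>i. c * SI u i \<omega>)\<bar> \<le> K * (\<Sum>i\<in>S. \<bar>k u * SI u i \<omega> - c * SI u i \<omega>\<bar>)"
            by (rule coord_lipschitzD[OF \<psi>])
          also have "(\<Sum>i\<in>S. \<bar>k u * SI u i \<omega> - c * SI u i \<omega>\<bar>) = \<bar>k u - c\<bar> * (\<Sum>i\<in>S. \<bar>SI u i \<omega>\<bar>)"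
            by (simp add: left_diff_distrib[symmetric] abs_mult sum_distrib_left)
          also have "K * (\<bar>k u - c\<bar> * (\<Sum>i\<in>S. \<bar>SI u i \<omega>\<bar>)) \<le> \<bar>K\<bar> * (\<bar>k u - c\<bar> * (\<Sum>i\<in>S. \<bar>SI u i \<omega>\<bar>))"
            by (intro mult_right_mono mult_nonneg_nonneg sum_nonneg) auto
          finally show "norm (\<psi> (\<lambda>i. k u * SI u i \<omega>) - \<psi> (\<lambda>i. c * SI u i \<omega>)) \<le> \<bar>K\<bar> * (\<bar>k u - c\<bar> * (\<Sum>i\<in>S. \<bar>SI u i \<omega>\<bar>))"
            by simp
        qed
        also have "\<dots> = \<bar>K\<bar> * (\<bar>k u - c\<bar> * (\<Sum>i\<in>S. expectation (\<lambda>\<omega>. \<bar>SI u i \<omega>\<bar>)))"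
          using J(1) by (simp add: Bochner_Integration.integral_sum)
        also have "\<dots> \<le> \<bar>K\<bar> * (\<bar>k u - c\<bar> * (\<Sum>i\<in>S. 1 + V u i))"
          by (intro mult_left_mono sum_mono J(2)) auto
        finally show ?case .
      qed
    qed
    from tendsto_add[OF this 1]
    have "((\<lambda>u. LINT \<omega>|M. \<psi> (\<lambda>i. k u * SI u i \<omega>)) \<longlongrightarrow> (LINT \<omega>|N. \<psi> (\<lambda>i. c * Y i \<omega>))) (at_right 0)" by simp
    from tendsto_unique[OF trivial_limit_at_right_real 2 this]
    show "(LINT \<omega>|Q. \<psi> (\<lambda>i. Z i \<omega>)) = (LINT \<omega>|N. \<psi> (\<lambda>i. c * Y i \<omega>))" .
  qed
  then have "same_fdd Q Z N (\<lambda>\<tau> \<omega>. c * Y \<tau> \<omega>)" unfolding same_fdd_def by blast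
  then show ?thesis ..
qed

lemma small_scale_limit_Y: "small_scale_limit M X t N Y"
  unfolding small_scale_limit_def
proof (intro conjI exI)
  show "\<forall>\<^sub>F u in at_right 0. 0 < a u"
    using eventually_small[OF A_pos] by eventually_elim (simp add: a_pos)
qed (rule Y_process a_tendsto_0 fdd_convergence)+

end

section \<open>The theorem\<close>

theorem theorem2:
  fixes M :: "'a measure" and X :: "real \<Rightarrow> 'a \<Rightarrow> real"
    and N :: "real \<Rightarrow> 'b measure" and Y :: "real \<Rightarrow> real \<Rightarrow> 'b \<Rightarrow> real"
    and a :: "real \<Rightarrow> real \<Rightarrow> real" and l :: "real \<Rightarrow> real" and \<gamma> \<sigma> A :: real
  assumes gamma: "0 < \<gamma>" "\<gamma> < 1"
    and sigma: "0 < \<sigma>"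
    and l_measurable: "l \<in> borel_measurable (restrict_space borel {0..})"
    and l_0: "l 0 = 1"
    and X_gaussian: "centered_gaussian_process M X"
    and X_paths: "\<forall>\<omega>\<in>space M. sample_path X \<omega> \<in> cadlag"
    and X_0: "\<forall>\<omega>\<in>space M. X 0 \<omega> = 0"
    and X_cov: "\<forall>s>0. \<forall>t>0. prob_space.expectation M (\<lambda>\<omega>. X s \<omega> * X t \<omega>) =
        \<sigma>\<^sup>2 * min s t powr (2 * \<gamma>) * l (\<bar>s - t\<bar> / min s t)"
    and A: "0 < A"
    and Y_process: "\<forall>t>0. stochastic_process (N t) (Y t)"
    and a_pos: "\<forall>t>0. \<forall>u. 0 < u \<and> u < A \<longrightarrow> a t u > 0"
    and y1: "\<forall>t>0. \<not> (\<exists>c. AE \<omega> in N t. Y t 1 \<omega> = c)"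
    and y2: "\<forall>t>0. sample_path (Y t) \<in> measurable (N t) skorohod_borel"
    and a1: "\<forall>t>0. (a t \<longlongrightarrow> 0) (at_right 0)"
    and a2: "\<forall>t>0. weakly_converges skorohod_topology
        M (\<lambda>u. sample_path (scaled_increment X t (a t) u)) (at_right 0)
        (N t) (sample_path (Y t))"
  shows "\<exists>\<kappa> L. 0 < \<kappa> \<and> \<kappa> \<le> 1 \<and>
    slowly_varying_at_zero L \<and>
    (\<forall>t>0. (\<lambda>u. sqrt (prob_space.variance (N 1) (Y 1 1)) * a t u) \<sim>[at_right 0]
       (\<lambda>u. \<sigma> * t powr (\<gamma> - \<kappa>) *
            sqrt (prob_space.variance (N 1) (Y 1 1) / prob_space.variance (N t) (Y t 1)) *
            u powr \<kappa> * L u)) \<and>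
    (\<forall>u>0. l u = (1 + (1 + u) powr (2 * \<gamma>) - (u powr \<kappa> * L u)\<^sup>2) / 2) \<and>
    (\<forall>t>0.
       (\<exists>c (P :: 'b measure) B. fractional_brownian_motion \<kappa> P B \<and>
          same_fdd (N t) (Y t) P (\<lambda>\<tau> \<omega>. c * B \<tau> \<omega>)) \<and>
       small_scale_limit M X t (N t) (Y t) \<and>
       (\<forall>(Q :: 'c measure) Z. small_scale_limit M X t Q Z \<longrightarrow>
          (\<exists>c. same_fdd Q Z (N t) (\<lambda>\<tau> \<omega>. c * Y t \<tau> \<omega>))))"
proof -
  have at: "small_scale_convergence M X l \<gamma> \<sigma> t A (a t) (N t) (Y t)" if t: "0 < t" for t
  proof -
    have "prob_space M" using X_gaussian by (simp add: centered_gaussian_process_def stochastic_process_def)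
    then interpret prob_space M .
    show ?thesis
    proof unfold_locales
      show "0 < \<gamma>" "\<gamma> < 1" "0 < \<sigma>" "l 0 = 1" "0 < A" "0 < t"
        by (fact gamma sigma l_0 A t)+
      show "centered_gaussian_process M X" by (fact X_gaussian)
      show "sample_path X \<omega> \<in> cadlag" if "\<omega> \<in> space M" for \<omega> using X_paths that by blast
      show "expectation (\<lambda>\<omega>. X s \<omega> * X r \<omega>) = \<sigma>\<^sup>2 * min s r powr (2 * \<gamma>) * l (\<bar>s - r\<bar> / min s r)"
        if "0 < s" "0 < r" for s r using X_cov that by simp
      show "0 < a t u" if "0 < u" "u < A" for u using a_pos t that by simp
      show "stochastic_process (N t) (Y t)" using Y_process t by simp
      show "\<not> (\<exists>c. AE \<omega> in N t. Y t 1 \<omega> = c)" using y1 t by simp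
      show "sample_path (Y t) \<in> measurable (N t) skorohod_borel" using y2 t by simp
      show "(a t \<longlongrightarrow> 0) (at_right 0)" using a1 t by simp
      show "weakly_converges skorohod_topology M (\<lambda>u. sample_path (scaled_increment X t (a t) u)) (at_right 0)
          (N t) (sample_path (Y t))" using a2 t by simp
    qed
  qed
  \<comment> \<open>The base point 1 yields \<open>\<kappa>\<close>, \<open>L\<close> and the regular variation of \<open>g\<close>, which then serve all base points.\<close>
  interpret one: small_scale_convergence M X l \<gamma> \<sigma> 1 A "a 1" "N 1" "Y 1" by (rule at) simp
  obtain \<kappa> where \<kappa>: "0 < \<kappa>" "\<kappa> \<le> 1"
    and lim: "\<And>r. 0 < r \<Longrightarrow> ((\<lambda>h. one.g (r * h) / one.g h) \<longlongrightarrow> r powr (2 * \<kappa>)) (at_right 0)"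
    using one.power_law by blast
  define L where "L u = sqrt (one.g u) / u powr \<kappa>" for u
  have L: "u powr \<kappa> * L u = sqrt (one.g u)" if "0 < u" for u using that by (simp add: L_def)
  have "slowly_varying_at_zero L"
    unfolding L_def[abs_def] by (rule one.slowly_varying_factor[OF l_measurable one.eventually_g_pos lim])
  moreover have "(\<lambda>u. sqrt (prob_space.variance (N 1) (Y 1 1)) * a t u) \<sim>[at_right 0]
       (\<lambda>u. \<sigma> * t powr (\<gamma> - \<kappa>) *
            sqrt (prob_space.variance (N 1) (Y 1 1) / prob_space.variance (N t) (Y t 1)) *
            u powr \<kappa> * L u)" if t: "0 < t" for t
  proof -
    interpret small_scale_convergence M X l \<gamma> \<sigma> t A "a t" "N t" "Y t" by (rule at[OF t])
    have "\<forall>\<^sub>F u in at_right 0. \<sigma> * t powr (\<gamma> - \<kappa>) * sqrt (one.v 1 / v 1) * sqrt (one.g u) =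
        \<sigma> * t powr (\<gamma> - \<kappa>) * sqrt (one.v 1 / v 1) * u powr \<kappa> * L u"
      using eventually_pos by eventually_elim (simp add: L mult.assoc)
    from asymp_equiv_trans[OF normalization_asymptotics[OF lim one.v_1_pos] asymp_equiv_refl_ev[OF this]]
    show ?thesis unfolding variance_Y_1 one.variance_Y_1 .
  qed
  moreover have "l u = (1 + (1 + u) powr (2 * \<gamma>) - (u powr \<kappa> * L u)\<^sup>2) / 2" if u: "0 < u" for u
  proof -
    have "(u powr \<kappa> * L u)\<^sup>2 = one.g u" unfolding L[OF u] using one.g_nonneg[of u] u by simp
    then show ?thesis by (simp add: one.g_def)
  qed
  moreover have "(\<exists>c (P :: 'b measure) B. fractional_brownian_motion \<kappa> P B \<and>
          same_fdd (N t) (Y t) P (\<lambda>\<tau> \<omega>. c * B \<tau> \<omega>)) \<and>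
       small_scale_limit M X t (N t) (Y t) \<and>
       (\<forall>(Q :: 'c measure) Z. small_scale_limit M X t Q Z \<longrightarrow>
          (\<exists>c. same_fdd Q Z (N t) (\<lambda>\<tau> \<omega>. c * Y t \<tau> \<omega>)))" if t: "0 < t" for t
  proof -
    interpret small_scale_convergence M X l \<gamma> \<sigma> t A "a t" "N t" "Y t" by (rule at[OF t])
    show ?thesis
      using fractional_brownian_limit[OF \<kappa> v_power[OF \<kappa>(1) lim]] small_scale_limit_Y small_scale_limit_unique
      by (intro conjI allI impI) blast+
  qed
  ultimately show ?thesis using \<kappa> by (intro exI[of _ \<kappa>] exI[of _ L]) simp
qed

end
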